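(* Suppose $\mathcal{M}$ is a von Neumann algebra with a tracial state $\tau$ and is generated, as a von Neumann algebra, by a family of elements $\{x_1,\ldots,x_n\}$. If $\mathfrak{K}_2(x_1,\ldots,x_n)=0$, then $\mathfrak{K}_2(\mathcal{M})=0$.
   Context: Tracial states are faithful and normal. Let $\mathcal{M}_k(\mathbb{C})$ be the $k\times k$ complex matrices, $\tau_k=\frac1k Tr$, $\mathcal{U}(k)$ the unitary group, and $\|(A_1,\ldots,A_n)\|_2^2=\sum_j\tau_k(A_j^*A_j)$ on $\mathcal{M}_k(\mathbb{C})^n$; $\|\cdot\|$ is the operator norm. For $R,\epsilon>0$ and $m,k\in\mathbb{N}$, $\Gamma_R(x_1,\ldots,x_n;m,k,\epsilon)$ is the set of $(A_1,\ldots,A_n)\in\mathcal{M}_k(\mathbb{C})^n$ with $\|A_j\|\le R$ for all $j$ and $|\tau_k(A_{i_1}^{\eta_1}\cdots A_{i_q}^{\eta_q})-\tau(x_{i_1}^{\eta_1}\cdots x_{i_q}^{\eta_q})|<\epsilon$ for all $1\le q\le m$, $1\le i_1,\ldots,i_q\le n$, $\eta_1,\ldots,\eta_q\in\{1,*\}$. For $\omega>0$, the $\omega$-orbit-ball $\mathcal{U}(B_1,\ldots,B_n;\omega)$ is the set of $(A_1,\ldots,A_n)\in\mathcal{M}_k(\mathbb{C})^n$ for which there is $W\in\mathcal{U}(k)$ with $\|(A_1,\ldots,A_n)-(WB_1W^*,\ldots,WB_nW^* )\|_2<\omega$. The $\omega$-orbit covering number $\nu(\Gamma_R(x_1,\ldots,x_n;m,k,\epsilon),\omega)$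 is the minimal number of $\omega$-orbit-balls with centers in $\Gamma_R(x_1,\ldots,x_n;m,k,\epsilon)$ that cover this set (by convention $\nu(\emptyset,\omega)=1$, so that the quantities below are $\ge0$ for $0<\omega<1$). Define $$\mathfrak{K}(x_1,\ldots,x_n;\omega,R)=\inf_{m\in\mathbb{N},\epsilon>0}\limsup_{k\to\infty}\frac{\log\nu(\Gamma_R(x_1,\ldots,x_n;m,k,\epsilon),\omega)}{-k^2\log\omega},$$ $\mathfrak{K}(x_1,\ldots,x_n;\omega)=\sup_{R>0}\mathfrak{K}(x_1,\ldots,x_n;\omega,R)$, and $\mathfrak{K}_2(x_1,\ldots,x_n)=\sup_{0<\omega<1}\mathfrak{K}(x_1,\ldots,x_n;\omega)$. For a finitely generated von Neumann algebra $\mathcal{M}$ with tracial state $\tau$, the upper free orbit-dimension $\mathfrak{K}_2(\mathcal{M})$ is the supremum of $\mathfrak{K}_2(x_1,\ldots,x_n)$ over all finite families $x_1,\ldots,x_n$ that generate $\mathcal{M}$ as a von Neumann algebra. *)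

theory Defs
  imports
    "HOL-Analysis.Bounded_Linear_Function"
    "HOL-Library.Extended_Real"
    "Jordan_Normal_Form.Schur_Decomposition"
begin

text \<open>The inner product is linear in its first argument.\<close>

class complex_hilbert_space = banach +
  fixes scaleC :: "complex \<Rightarrow> 'a \<Rightarrow> 'a"  (infixr \<open>*\<^sub>C\<close> 75)
    and cinner :: "'a \<Rightarrow> 'a \<Rightarrow> complex"
  assumes scaleC_add_right: "c *\<^sub>C (x + y) = c *\<^sub>C x + c *\<^sub>C y"
    and scaleC_add_left: "(b + c) *\<^sub>C x = b *\<^sub>C x + c *\<^sub>C x"
    and scaleC_scaleC: "b *\<^sub>C (c *\<^sub>C x) = (b * c) *\<^sub>C x"
    and scaleR_scaleC: "r *\<^sub>R x = complex_of_real r *\<^sub>C x"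
    and cinner_commute: "cinner x y = cnj (cinner y x)"
    and cinner_add_left: "cinner (x + y) z = cinner x z + cinner y z"
    and cinner_scaleC_left: "cinner (c *\<^sub>C x) y = c * cinner x y"
    and cinner_self: "cinner x x = complex_of_real ((norm x)\<^sup>2)"

lemma norm_scaleC: "norm (c *\<^sub>C x) = cmod c * norm (x :: 'a::complex_hilbert_space)"
proof -
  have "cinner x (c *\<^sub>C x) = cnj c * cinner x x"
    by (metis cinner_commute cinner_scaleC_left complex_cnj_mult)
  then have "cinner (c *\<^sub>C x) (c *\<^sub>C x) = (c * cnj c) * cinner x x"
    by (simp add: cinner_scaleC_left)
  then have "complex_of_real ((norm (c *\<^sub>C x))\<^sup>2) = complex_of_real ((cmod c * norm x)\<^sup>2)"
    by (simp only: cinner_self complex_norm_square[symmetric] of_real_mult power_mult_distrib)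
  then have "(norm (c *\<^sub>C x))\<^sup>2 = (cmod c * norm x)\<^sup>2"
    using of_real_eq_iff by blast
  then show ?thesis
    by (simp add: power2_eq_iff_nonneg)
qed

lemma bounded_linear_scaleC: "bounded_linear (\<lambda>x :: 'a::complex_hilbert_space. c *\<^sub>C x)"
  by (rule bounded_linear_intro[where K = "cmod c"])
    (simp_all add: scaleC_add_right scaleR_scaleC scaleC_scaleC norm_scaleC mult.commute)

text \<open>
  The elements of \<open>'h \<Rightarrow>\<^sub>L 'h\<close> are the bounded \<^emph>\<open>real\<close>-linear maps; the bounded operators on the
  Hilbert space are those satisfying the following predicate.
\<close>

definition complex_linear :: "('h::complex_hilbert_space \<Rightarrow>\<^sub>L 'h) \<Rightarrow> bool" where
  "complex_linear T \<longleftrightarrow> (\<forall>c x. blinfun_apply T (c *\<^sub>C x) = c *\<^sub>C blinfun_apply T x)"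

lift_definition op_scaleC ::
    "complex \<Rightarrow> ('h::complex_hilbert_space \<Rightarrow>\<^sub>L 'h) \<Rightarrow> ('h \<Rightarrow>\<^sub>L 'h)"
  is "\<lambda>c T x. c *\<^sub>C T x"
  by (rule bounded_linear_compose[OF bounded_linear_scaleC])

text \<open>Meaningful for complex-linear \<open>T\<close> only, where existence is Riesz representation.\<close>

definition op_adjoint :: "('h::complex_hilbert_space \<Rightarrow>\<^sub>L 'h) \<Rightarrow> ('h \<Rightarrow>\<^sub>L 'h)" where
  "op_adjoint T =
     (THE S. \<forall>x y. cinner (blinfun_apply T x) y = cinner x (blinfun_apply S y))"

definition ultraweak_topology :: "('h::complex_hilbert_space \<Rightarrow>\<^sub>L 'h) topology" where
  "ultraweak_topology = topology_generated_by
     {{T. (\<Sum>j. cinner (blinfun_apply T (\<xi> j)) (\<eta> j)) \<in> U} | \<xi> \<eta> U.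
        summable (\<lambda>j::nat. (norm (\<xi> j))\<^sup>2) \<and> summable (\<lambda>j. (norm (\<eta> j))\<^sup>2) \<and> open U}"

definition von_neumann_algebra :: "('h::complex_hilbert_space \<Rightarrow>\<^sub>L 'h) set \<Rightarrow> bool" where
  "von_neumann_algebra M \<longleftrightarrow>
     (\<forall>T\<in>M. complex_linear T) \<and>
     id_blinfun \<in> M \<and>
     (\<forall>S\<in>M. \<forall>T\<in>M. S + T \<in> M) \<and>
     (\<forall>c. \<forall>T\<in>M. op_scaleC c T \<in> M) \<and>
     (\<forall>S\<in>M. \<forall>T\<in>M. S o\<^sub>L T \<in> M) \<and>
     (\<forall>T\<in>M. op_adjoint T \<in> M) \<and>
     closedin strong_operator_topology M"

definition generates ::
    "('h::complex_hilbert_space \<Rightarrow>\<^sub>L 'h) list \<Rightarrow> ('h \<Rightarrow>\<^sub>L 'h) set \<Rightarrow> bool" where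
  "generates xs M \<longleftrightarrow> von_neumann_algebra hull (set xs) = M"

text \<open>In the remainder only the values of \<open>\<tau>\<close> on \<open>M\<close> matter.\<close>

definition tracial_state ::
    "('h::complex_hilbert_space \<Rightarrow>\<^sub>L 'h) set \<Rightarrow> (('h \<Rightarrow>\<^sub>L 'h) \<Rightarrow> complex) \<Rightarrow> bool" where
  "tracial_state M \<tau> \<longleftrightarrow>
     (\<forall>S\<in>M. \<forall>T\<in>M. \<tau> (S + T) = \<tau> S + \<tau> T) \<and>
     (\<forall>c. \<forall>T\<in>M. \<tau> (op_scaleC c T) = c * \<tau> T) \<and>
     (\<forall>T\<in>M. Im (\<tau> (op_adjoint T o\<^sub>L T)) = 0 \<and> 0 \<le> Re (\<tau> (op_adjoint T o\<^sub>L T))) \<and>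
     \<tau> id_blinfun = 1 \<and>
     (\<forall>S\<in>M. \<forall>T\<in>M. \<tau> (S o\<^sub>L T) = \<tau> (T o\<^sub>L S))"

definition faithful ::
    "('h::complex_hilbert_space \<Rightarrow>\<^sub>L 'h) set \<Rightarrow> (('h \<Rightarrow>\<^sub>L 'h) \<Rightarrow> complex) \<Rightarrow> bool" where
  "faithful M \<tau> \<longleftrightarrow> (\<forall>T\<in>M. \<tau> (op_adjoint T o\<^sub>L T) = 0 \<longrightarrow> T = 0)"

definition normal_functional ::
    "('h::complex_hilbert_space \<Rightarrow>\<^sub>L 'h) set \<Rightarrow> (('h \<Rightarrow>\<^sub>L 'h) \<Rightarrow> complex) \<Rightarrow> bool" where
  "normal_functional M \<tau> \<longleftrightarrow> continuous_map (subtopology ultraweak_topology M) euclidean \<tau>"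

definition mat_ntrace :: "complex mat \<Rightarrow> complex" where
  "mat_ntrace A = (\<Sum>i<dim_row A. A $$ (i, i)) / of_nat (dim_row A)"

definition vec_l2norm :: "complex vec \<Rightarrow> real" where
  "vec_l2norm v = sqrt (\<Sum>i<dim_vec v. (cmod (v $ i))\<^sup>2)"

definition mat_opnorm :: "complex mat \<Rightarrow> real" where
  "mat_opnorm A = (SUP v\<in>{v \<in> carrier_vec (dim_col A). vec_l2norm v \<le> 1}. vec_l2norm (A *\<^sub>v v))"

definition unitary_group :: "nat \<Rightarrow> complex mat set" where
  "unitary_group k =
     {W \<in> carrier_mat k k. W * mat_adjoint W = 1\<^sub>m k \<and> mat_adjoint W * W = 1\<^sub>m k}"

text \<open>A tuple in \<open>M\<^sub>k(\<complex>)\<^sup>n\<close> is a list of length \<open>n\<close>.\<close>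

definition mat_tuples :: "nat \<Rightarrow> nat \<Rightarrow> complex mat list set" where
  "mat_tuples n k = {As. length As = n \<and> set As \<subseteq> carrier_mat k k}"

definition tuple_norm2 :: "complex mat list \<Rightarrow> real" where
  "tuple_norm2 As = sqrt (\<Sum>A\<leftarrow>As. Re (mat_ntrace (mat_adjoint A * A)))"

text \<open>
  A *-word \<open>[(i\<^sub>1, s\<^sub>1), \<dots>, (i\<^sub>q, s\<^sub>q)]\<close> stands for the product of the \<open>i\<^sub>j\<close>-th letters (numbered
  from 0), where \<open>s\<^sub>j = True\<close> means that the adjoint is taken.
\<close>

definition star_words :: "nat \<Rightarrow> nat \<Rightarrow> (nat \<times> bool) list set" where
  "star_words n m = {w. 1 \<le> length w \<and> length w \<le> m \<and> (\<forall>(i, s)\<in>set w. i < n)}"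

definition op_word ::
    "('h::complex_hilbert_space \<Rightarrow>\<^sub>L 'h) list \<Rightarrow> (nat \<times> bool) list \<Rightarrow> ('h \<Rightarrow>\<^sub>L 'h)" where
  "op_word xs w =
     foldr (\<lambda>(i, s) T. (if s then op_adjoint (xs ! i) else xs ! i) o\<^sub>L T) w id_blinfun"

definition mat_word :: "nat \<Rightarrow> complex mat list \<Rightarrow> (nat \<times> bool) list \<Rightarrow> complex mat" where
  "mat_word k As w =
     foldr (\<lambda>(i, s) B. (if s then mat_adjoint (As ! i) else As ! i) * B) w (1\<^sub>m k)"

definition microstates ::
    "(('h::complex_hilbert_space \<Rightarrow>\<^sub>L 'h) \<Rightarrow> complex) \<Rightarrow> ('h \<Rightarrow>\<^sub>L 'h) list \<Rightarrow>
     real \<Rightarrow> nat \<Rightarrow> nat \<Rightarrow> real \<Rightarrow> complex mat list set" where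
  "microstates \<tau> xs R m k \<epsilon> =
     {As \<in> mat_tuples (length xs) k.
        (\<forall>A\<in>set As. mat_opnorm A \<le> R) \<and>
        (\<forall>w\<in>star_words (length xs) m.
           cmod (mat_ntrace (mat_word k As w) - \<tau> (op_word xs w)) < \<epsilon>)}"

definition orbit_ball :: "nat \<Rightarrow> complex mat list \<Rightarrow> real \<Rightarrow> complex mat list set" where
  "orbit_ball k Bs \<omega> =
     {As \<in> mat_tuples (length Bs) k.
        \<exists>W\<in>unitary_group k. tuple_norm2 (map2 (\<lambda>A B. A - W * B * mat_adjoint W) As Bs) < \<omega>}"

text \<open>Sets of microstates are bounded, so finite covers exist whenever \<open>\<omega> > 0\<close>.\<close>

definition orbit_covering_number :: "nat \<Rightarrow> complex mat list set \<Rightarrow> real \<Rightarrow> nat" where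
  "orbit_covering_number k \<Gamma> \<omega> =
     (if \<Gamma> = {} then 1
      else (LEAST N. \<exists>C\<subseteq>\<Gamma>. finite C \<and> card C = N \<and> \<Gamma> \<subseteq> (\<Union>Bs\<in>C. orbit_ball k Bs \<omega>)))"

definition orbit_dim_at_radius ::
    "(('h::complex_hilbert_space \<Rightarrow>\<^sub>L 'h) \<Rightarrow> complex) \<Rightarrow> ('h \<Rightarrow>\<^sub>L 'h) list \<Rightarrow>
     real \<Rightarrow> real \<Rightarrow> ereal" where
  "orbit_dim_at_radius \<tau> xs \<omega> R =
     (INF (m, \<epsilon>) \<in> UNIV \<times> {0<..}.
        limsup (\<lambda>k. ereal
          (ln (real (orbit_covering_number k (microstates \<tau> xs R m k \<epsilon>) \<omega>))
            / (- (real k)\<^sup>2 * ln \<omega>))))"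

definition orbit_dim_at ::
    "(('h::complex_hilbert_space \<Rightarrow>\<^sub>L 'h) \<Rightarrow> complex) \<Rightarrow> ('h \<Rightarrow>\<^sub>L 'h) list \<Rightarrow> real \<Rightarrow> ereal" where
  "orbit_dim_at \<tau> xs \<omega> = (SUP R\<in>{0<..}. orbit_dim_at_radius \<tau> xs \<omega> R)"

definition upper_orbit_dim ::
    "(('h::complex_hilbert_space \<Rightarrow>\<^sub>L 'h) \<Rightarrow> complex) \<Rightarrow> ('h \<Rightarrow>\<^sub>L 'h) list \<Rightarrow> ereal" where
  "upper_orbit_dim \<tau> xs = (SUP \<omega>\<in>{0<..<1}. orbit_dim_at \<tau> xs \<omega>)"

definition upper_free_orbit_dimension ::
    "('h::complex_hilbert_space \<Rightarrow>\<^sub>L 'h) set \<Rightarrow> (('h \<Rightarrow>\<^sub>L 'h) \<Rightarrow> complex) \<Rightarrow> ereal" where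
  "upper_free_orbit_dimension M \<tau> = (SUP xs\<in>{xs. generates xs M}. upper_orbit_dim \<tau> xs)"

end

theory Submission
  imports Defs "HOL-Analysis.Inner_Product"
begin

text \<open>
  Let \<open>x\<close> and \<open>y\<close> be generating families. Every element of \<open>M\<close> is a limit in 2-norm of
  star-polynomials in the generators: the set of such limits is a von Neumann algebra, where strong
  closedness follows by amplifying to square-summable sequences of vectors, on which a normal trace
  is controlled by a single vector. So \<open>y \<approx> \<psi>(x)\<close> and \<open>x \<approx> \<phi>(y)\<close> with polynomials \<open>\<psi>\<close>,
  \<open>\<phi>\<close>; composing with a polynomial cutoff of \<open>2 t / (1 + t\<^sup>2)\<close> keeps the norm of \<open>\<phi>\<close> at
  matrices of norm at most \<open>R\<close> below a constant that depends on \<open>x\<close> only.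

  Given a radius \<open>R\<close> and \<open>\<omega>\<close> for \<open>y\<close>, fix \<open>\<psi>\<close>, then \<open>\<omega>'\<close> small against \<open>\<omega>\<close> and the
  Lipschitz constant of \<open>\<psi>\<close>, then \<open>(m', \<epsilon>')\<close> for \<open>x\<close>, and only then \<open>\<phi>\<close>. For suitable
  \<open>(m, \<epsilon>)\<close>, \<open>\<phi>\<close> maps microstates of \<open>y\<close> to microstates of \<open>x\<close> and \<open>\<psi>\<close> almost inverts
  it, so a cover by \<open>\<omega>'\<close>-orbit-balls of the latter pulls back to a cover by \<open>\<omega>\<close>-orbit-balls of
  the former. The covering number of \<open>y\<close> is therefore at most that of \<open>x\<close>, whose logarithm is
  \<open>o(k\<^sup>2)\<close>.
\<close>

section \<open>Tracial algebras and cutoff\<close>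

text \<open>Operators of M and matrices of each size enter as instances of one abstract
  \<open>tracial_algebra\<close>, because facts keep moving between them: a polynomial built on the
  operator side must obey the same norm bound at matrices, and a trace estimate in M must persist at
  microstates. The bounds for the cutoff are therefore proved from the trace alone, by
  Cauchy-Schwarz and geometric series, and not by spectral calculus in a representation. The
  obstacle is that the radius for x is fixed before the accuracy, while better approximants of x may
  have larger norms. Kaplansky's density theorem overcomes this for operators; here one and the same
  polynomial must be bounded in M and at all matrices of bounded norm. Hence the function of
  Kaplansky's proof, with the inverse replaced by a partial geometric sum. The class extends
  \<open>ring\<close> and \<open>monoid_mult\<close> instead of \<open>ring_1\<close> because 1 = 0
  for operators on the zero space.\<close>

class star_algebra = ring + monoid_mult +
  fixes scl :: "complex \<Rightarrow> 'a \<Rightarrow> 'a"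
    and star :: "'a \<Rightarrow> 'a"
  assumes scl_add_right: "scl c (x + y) = scl c x + scl c y"
    and scl_add_left: "scl (b + c) x = scl b x + scl c x"
    and scl_scl [simp]: "scl b (scl c x) = scl (b * c) x"
    and scl_one [simp]: "scl 1 x = x"
    and scl_mult_left [simp]: "scl c x * y = scl c (x * y)"
    and scl_mult_right [simp]: "x * scl c y = scl c (x * y)"
    and star_add [simp]: "star (x + y) = star x + star y"
    and star_mult [simp]: "star (x * y) = star y * star x"
    and star_scl [simp]: "star (scl c x) = scl (cnj c) (star x)"
    and star_star [simp]: "star (star x) = x"
begin

lemma scl_zero_left [simp]: "scl 0 x = 0"
  using scl_add_left[of 0 0 x] by simp

lemma scl_zero_right [simp]: "scl c 0 = 0"
  using scl_add_right[of c 0 0] by simp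

lemma scl_minus_left: "scl (- c) x = - scl c x"
  using scl_add_left[of c "- c" x] by (simp add: eq_neg_iff_add_eq_0 add.commute)

lemma scl_minus_right: "scl c (- x) = - scl c x"
  using scl_add_right[of c x "- x"] by (simp add: eq_neg_iff_add_eq_0 add.commute)

lemma scl_diff_right: "scl c (x - y) = scl c x - scl c y"
  using scl_add_right[of c x "- y"] by (simp add: scl_minus_right)

lemma star_zero [simp]: "star 0 = 0"
  using star_add[of 0 0] by simp

lemma star_minus [simp]: "star (- x) = - star x"
  using star_add[of x "- x"] by (simp add: eq_neg_iff_add_eq_0 add.commute)

lemma star_diff [simp]: "star (x - y) = star x - star y"
  using star_add[of x "- y"] by simp

lemma star_one [simp]: "star 1 = 1"
  by (metis mult_1_left mult_1_right star_mult star_star)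

end

section \<open>Cauchy-Schwarz inequality and the 2-norm of a trace\<close>

lemma discriminant_le:
  fixes p q r :: real
  assumes "\<And>t. 0 \<le> p - 2 * t * q + t\<^sup>2 * r" "0 \<le> r"
  shows "q\<^sup>2 \<le> p * r"
proof (cases "r = 0")
  case True
  show ?thesis
  proof (cases "q = 0")
    case False
    then show ?thesis
      \<comment> \<open>With r = 0 the form is linear in t, and this t gives it the value
        -1.\<close>
      using assms(1)[of "(p + 1) / (2 * q)"] True by simp
  qed (use True in simp)
next
  case False
  have "0 \<le> (p - 2 * (q / r) * q + (q / r)\<^sup>2 * r) * r"
    by (rule mult_nonneg_nonneg[OF assms])
  also have "\<dots> = p * r - q\<^sup>2"
    using False by (simp add: field_simps power2_eq_square)
  finally show ?thesis by simp
qed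

text \<open>The algebra is a subset of a type because M is only a subset of all operators. For
  matrix families the trace at size k sees a single member of the family, so \<open>n2\<close> below
  is in general a seminorm.\<close>

locale tracial_algebra =
  fixes A :: "'a::star_algebra set"
    and tr :: "'a \<Rightarrow> complex"
  assumes one_closed [simp, intro]: "1 \<in> A"
    and add_closed [simp, intro]: "a \<in> A \<Longrightarrow> b \<in> A \<Longrightarrow> a + b \<in> A"
    and mult_closed [simp, intro]: "a \<in> A \<Longrightarrow> b \<in> A \<Longrightarrow> a * b \<in> A"
    and scl_closed [simp, intro]: "a \<in> A \<Longrightarrow> scl c a \<in> A"
    and star_closed [simp, intro]: "a \<in> A \<Longrightarrow> star a \<in> A"
    and tr_add: "a \<in> A \<Longrightarrow> b \<in> A \<Longrightarrow> tr (a + b) = tr a + tr b"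
    and tr_scl: "a \<in> A \<Longrightarrow> tr (scl c a) = c * tr a"
    and tr_pos: "a \<in> A \<Longrightarrow> Im (tr (star a * a)) = 0 \<and> 0 \<le> Re (tr (star a * a))"
    and tr_one: "tr 1 = 1"
    and tr_comm: "a \<in> A \<Longrightarrow> b \<in> A \<Longrightarrow> tr (a * b) = tr (b * a)"
begin

lemma zero_closed [simp, intro]: "0 \<in> A"
  using scl_closed[OF one_closed, of 0] by simp

lemma minus_closed [simp, intro]: "a \<in> A \<Longrightarrow> - a \<in> A"
  using scl_closed[of a "- 1"] by (simp add: scl_minus_left)

lemma diff_closed [simp, intro]: "a \<in> A \<Longrightarrow> b \<in> A \<Longrightarrow> a - b \<in> A"
  using add_closed[of a "- b"] by simp

lemma power_closed [simp, intro]: "a \<in> A \<Longrightarrow> a ^ n \<in> A"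
  by (induction n) auto

lemma tr_zero [simp]: "tr 0 = 0"
  using tr_scl[OF one_closed, of 0] by simp

lemma tr_minus: "a \<in> A \<Longrightarrow> tr (- a) = - tr a"
  using tr_scl[of a "- 1"] by (simp add: scl_minus_left)

lemma tr_diff: "a \<in> A \<Longrightarrow> b \<in> A \<Longrightarrow> tr (a - b) = tr a - tr b"
  using tr_add[of a "- b"] by (simp add: tr_minus)

text \<open>Positivity makes the trace hermitian: reality of its value at
  \<open>star (1 + a) * (1 + a)\<close> settles the imaginary parts, and i a in place of a settles
  the real parts.\<close>

lemma tr_star: assumes "a \<in> A" shows "tr (star a) = cnj (tr a)"
proof -
  have "Im (tr (star (1 + a) * (1 + a))) = 0"
    using tr_pos assms by blast
  then have 1: "Im (tr a) + Im (tr (star a)) = 0"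
    using assms tr_pos[of a] by (simp add: algebra_simps tr_add tr_one)
  define b where "b = scl \<i> a"
  have b: "star b = scl (- \<i>) (star a)" "star b * b = star a * a" "b \<in> A"
    using assms by (simp_all add: b_def)
  have "star (1 + b) * (1 + b) = 1 + (b + (star b + star a * a))"
    by (simp add: distrib_left distrib_right b(2) add_ac)
  moreover have "Im (tr (star (1 + b) * (1 + b))) = 0"
    using tr_pos b by blast
  ultimately have "Im (tr b) + Im (tr (star b)) = 0"
    using assms b(3) tr_pos[of a] by (simp add: tr_add tr_one)
  then have 2: "Re (tr a) - Re (tr (star a)) = 0"
    unfolding b(1) unfolding b_def using assms by (simp add: tr_scl)
  show ?thesis
    using 1 2 by (simp add: complex_eq_iff)
qed

text \<open>Taking the real part gives a real bilinear form, for which the discriminant argument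
  works directly; \<open>norm_tr_le\<close> returns to moduli of complex traces.\<close>

definition ip :: "'a \<Rightarrow> 'a \<Rightarrow> real" where
  "ip a b = Re (tr (star b * a))"

definition n2 :: "'a \<Rightarrow> real" where
  "n2 a = sqrt (ip a a)"

lemma ip_add_left: "a \<in> A \<Longrightarrow> b \<in> A \<Longrightarrow> c \<in> A \<Longrightarrow> ip (a + b) c = ip a c + ip b c"
  by (simp add: ip_def algebra_simps tr_add)

lemma ip_diff_left: "a \<in> A \<Longrightarrow> b \<in> A \<Longrightarrow> c \<in> A \<Longrightarrow> ip (a - b) c = ip a c - ip b c"
  by (simp add: ip_def algebra_simps tr_diff)

lemma ip_commute: "a \<in> A \<Longrightarrow> b \<in> A \<Longrightarrow> ip a b = ip b a"
  using tr_star[of "star b * a"] by (simp add: ip_def)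

lemma ip_add_right: "a \<in> A \<Longrightarrow> b \<in> A \<Longrightarrow> c \<in> A \<Longrightarrow> ip a (b + c) = ip a b + ip a c"
  by (simp add: ip_def algebra_simps tr_add)

lemma ip_diff_right: "a \<in> A \<Longrightarrow> b \<in> A \<Longrightarrow> c \<in> A \<Longrightarrow> ip a (b - c) = ip a b - ip a c"
  by (simp add: ip_def algebra_simps tr_diff)

lemma ip_scl_left: "a \<in> A \<Longrightarrow> b \<in> A \<Longrightarrow> ip (scl (of_real t) a) b = t * ip a b"
  by (simp add: ip_def tr_scl)

lemma ip_scl_right: "a \<in> A \<Longrightarrow> b \<in> A \<Longrightarrow> ip a (scl (of_real t) b) = t * ip a b"
  by (simp add: ip_def tr_scl)

lemma ip_self: "a \<in> A \<Longrightarrow> 0 \<le> ip a a"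
  using tr_pos by (simp add: ip_def)

lemma n2_nonneg [simp]: "a \<in> A \<Longrightarrow> 0 \<le> n2 a"
  by (simp add: n2_def ip_self)

lemma n2_power2: "a \<in> A \<Longrightarrow> (n2 a)\<^sup>2 = ip a a"
  by (simp add: n2_def ip_self)

lemma ip_mult_left: "a \<in> A \<Longrightarrow> b \<in> A \<Longrightarrow> c \<in> A \<Longrightarrow> ip (a * b) c = ip b (star a * c)"
  by (simp add: ip_def mult.assoc)

lemma Cauchy_Schwarz_ip_sq:
  assumes "a \<in> A" "b \<in> A"
  shows "(ip a b)\<^sup>2 \<le> ip a a * ip b b"
proof (rule discriminant_le)
  fix t :: real
  have "0 \<le> ip (a - scl (of_real t) b) (a - scl (of_real t) b)"
    using assms by (intro ip_self) auto
  also have "\<dots> = ip a a - 2 * t * ip a b + t\<^sup>2 * ip b b"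
    using assms ip_commute[of b a]
    by (simp add: ip_diff_left ip_diff_right ip_scl_left ip_scl_right power2_eq_square algebra_simps
        del: of_real_mult)
  finally show "0 \<le> ip a a - 2 * t * ip a b + t\<^sup>2 * ip b b" .
qed (use assms in \<open>simp add: ip_self\<close>)

lemma Cauchy_Schwarz_ip:
  assumes "a \<in> A" "b \<in> A"
  shows "\<bar>ip a b\<bar> \<le> n2 a * n2 b"
proof (rule power2_le_imp_le)
  show "\<bar>ip a b\<bar>\<^sup>2 \<le> (n2 a * n2 b)\<^sup>2"
    using Cauchy_Schwarz_ip_sq[OF assms] assms by (simp add: power_mult_distrib n2_power2)
qed (use assms in simp)

lemma n2_zero [simp]: "n2 0 = 0"
  by (simp add: n2_def ip_def)

lemma n2_one [simp]: "n2 1 = 1"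
  by (simp add: n2_def ip_def tr_one)

lemma n2_triangle:
  assumes "a \<in> A" "b \<in> A"
  shows "n2 (a + b) \<le> n2 a + n2 b"
proof (rule power2_le_imp_le)
  have "(n2 (a + b))\<^sup>2 = (n2 a)\<^sup>2 + 2 * ip a b + (n2 b)\<^sup>2"
    using assms ip_commute[of a b] by (simp add: n2_power2 ip_add_left ip_add_right)
  also have "\<dots> \<le> (n2 a + n2 b)\<^sup>2"
    using Cauchy_Schwarz_ip[OF assms] by (simp add: power2_sum)
  finally show "(n2 (a + b))\<^sup>2 \<le> (n2 a + n2 b)\<^sup>2" .
qed (use assms in auto)

lemma n2_scl: 
  assumes "a \<in> A"
  shows "n2 (scl c a) = cmod c * n2 a"
proof -
  have "tr (star (scl c a) * scl c a) = (c * cnj c) * tr (star a * a)"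
    using assms by (simp add: tr_scl mult.commute)
  also have "\<dots> = of_real ((cmod c)\<^sup>2) * tr (star a * a)"
    by (simp only: complex_norm_square)
  finally have "ip (scl c a) (scl c a) = (cmod c)\<^sup>2 * ip a a"
    by (simp add: ip_def)
  then show ?thesis
    by (simp add: n2_def real_sqrt_mult)
qed

lemma n2_minus: "a \<in> A \<Longrightarrow> n2 (- a) = n2 a"
  using n2_scl[of a "- 1"] by (simp add: scl_minus_left)

lemma n2_diff: "a \<in> A \<Longrightarrow> b \<in> A \<Longrightarrow> n2 (a - b) \<le> n2 a + n2 b"
  using n2_triangle[of a "- b"] by (simp add: n2_minus)

lemma n2_diff_commute: "a \<in> A \<Longrightarrow> b \<in> A \<Longrightarrow> n2 (a - b) = n2 (b - a)"
  using n2_minus[of "a - b"] by simp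

lemma n2_diff_trans:
  assumes "a \<in> A" "b \<in> A" "c \<in> A"
  shows "n2 (a - c) \<le> n2 (a - b) + n2 (b - c)"
  using n2_triangle[of "a - b" "b - c"] assms by simp

lemma n2_star: "a \<in> A \<Longrightarrow> n2 (star a) = n2 a"
  using tr_comm[of a "star a"] by (simp add: n2_def ip_def)

lemma norm_tr_le: assumes "a \<in> A" shows "cmod (tr a) \<le> n2 a"
proof (cases "tr a = 0")
  case False
  \<comment> \<open>The phase that turns \<open>tr a\<close> into its modulus, which is then a real
    part.\<close>
  define u where "u = cnj (tr a) / of_real (cmod (tr a))"
  have u: "cmod u = 1"
    using False by (simp add: u_def norm_divide)
  have "u * tr a = of_real (cmod (tr a))"
    using False by (simp add: u_def complex_norm_square[symmetric] power2_eq_square mult.commute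
        nonzero_divide_eq_eq flip: of_real_mult)
  then have "cmod (tr a) = Re (tr (scl u a))"
    using assms by (simp add: tr_scl)
  also have "\<dots> = ip (scl u a) 1"
    by (simp add: ip_def)
  also have "\<dots> \<le> n2 (scl u a) * n2 1"
    using Cauchy_Schwarz_ip[of "scl u a" 1] assms by simp
  finally show ?thesis
    using u assms by (simp add: n2_scl)
qed (use assms in simp)

text \<open>An operator norm bound, read off from left multiplication on the algebra itself (the GNS space).\<close>

definition bnd :: "'a \<Rightarrow> real \<Rightarrow> bool" where
  "bnd a K \<longleftrightarrow> a \<in> A \<and> 0 \<le> K \<and> (\<forall>b\<in>A. n2 (a * b) \<le> K * n2 b)"

lemma bndD: "bnd a K \<Longrightarrow> b \<in> A \<Longrightarrow> n2 (a * b) \<le> K * n2 b"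
  unfolding bnd_def by blast

lemma bnd_closed [simp]: "bnd a K \<Longrightarrow> a \<in> A"
  unfolding bnd_def by blast

lemma bnd_nonneg: "bnd a K \<Longrightarrow> 0 \<le> K"
  unfolding bnd_def by blast

lemma bndI: "a \<in> A \<Longrightarrow> 0 \<le> K \<Longrightarrow> (\<And>b. b \<in> A \<Longrightarrow> n2 (a * b) \<le> K * n2 b) \<Longrightarrow> bnd a K"
  unfolding bnd_def by blast

lemma bnd_mono: 
  assumes "bnd a K" "K \<le> L" shows "bnd a L"
proof (rule bndI)
  fix b assume b: "b \<in> A"
  have "n2 (a * b) \<le> K * n2 b"
    using assms b by (intro bndD)
  also have "\<dots> \<le> L * n2 b"
    using assms b by (intro mult_right_mono) auto
  finally show "n2 (a * b) \<le> L * n2 b" .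
qed (use assms bnd_nonneg[OF assms(1)] in auto)

lemma bnd_one: "bnd 1 1"
  by (rule bndI) auto

lemma bnd_zero: "0 \<le> K \<Longrightarrow> bnd 0 K"
  by (rule bndI) auto

lemma bnd_add: 
  assumes "bnd a K" "bnd b L" shows "bnd (a + b) (K + L)"
  unfolding bnd_def
proof (intro conjI ballI)
  fix c assume "c \<in> A"
  then have "n2 ((a + b) * c) \<le> n2 (a * c) + n2 (b * c)"
    using n2_triangle[of "a * c" "b * c"] assms by (simp add: distrib_right)
  also have "\<dots> \<le> K * n2 c + L * n2 c"
    using assms \<open>c \<in> A\<close> by (intro add_mono bndD)
  finally show "n2 ((a + b) * c) \<le> (K + L) * n2 c"
    by (simp add: distrib_right)
qed (use assms bnd_nonneg[OF assms(1)] bnd_nonneg[OF assms(2)] in auto)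

lemma bnd_scl: 
  assumes "bnd a K" shows "bnd (scl c a) (cmod c * K)"
proof (rule bndI)
  fix b assume "b \<in> A"
  then show "n2 (scl c a * b) \<le> cmod c * K * n2 b"
    using bndD[OF assms, of b] assms by (simp add: n2_scl mult.assoc mult_left_mono)
qed (use assms bnd_nonneg[OF assms] in auto)

lemma bnd_minus: "bnd a K \<Longrightarrow> bnd (- a) K"
  using bnd_scl[of a K "- 1"] by (simp add: scl_minus_left)

lemma bnd_diff: "bnd a K \<Longrightarrow> bnd b L \<Longrightarrow> bnd (a - b) (K + L)"
  using bnd_add[of a K "- b" L] by (simp add: bnd_minus)

lemma bnd_mult: 
  assumes "bnd a K" "bnd b L" shows "bnd (a * b) (K * L)"
  unfolding bnd_def
proof (intro conjI ballI)
  fix c assume "c \<in> A"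
  then have "n2 (a * b * c) \<le> K * n2 (b * c)"
    using bndD[OF assms(1), of "b * c"] assms by (simp add: mult.assoc)
  also have "\<dots> \<le> K * (L * n2 c)"
    using assms \<open>c \<in> A\<close> by (intro mult_left_mono bndD bnd_nonneg)
  finally show "n2 (a * b * c) \<le> (K * L) * n2 c"
    by (simp add: mult.assoc)
qed (use assms bnd_nonneg[OF assms(1)] bnd_nonneg[OF assms(2)] in auto)

lemma bnd_power: "bnd a K \<Longrightarrow> bnd (a ^ n) (K ^ n)"
  by (induction n) (auto intro: bnd_one bnd_mult)

text \<open>The square of \<open>n2 (star a * c)\<close> is the inner product of
  \<open>a * (star a * c)\<close> with c. Cauchy-Schwarz bounds it by
  \<open>K * n2 (star a * c) * n2 c\<close>, and one factor cancels.\<close>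

lemma bnd_star: 
  assumes "bnd a K" shows "bnd (star a) K"
  unfolding bnd_def
proof (intro conjI ballI)
  fix c assume c: "c \<in> A"
  have "(n2 (star a * c))\<^sup>2 = ip (a * (star a * c)) c"
    using assms c by (simp add: n2_power2 ip_mult_left)
  also have "\<dots> \<le> n2 (a * (star a * c)) * n2 c"
    using Cauchy_Schwarz_ip[of "a * (star a * c)" c] assms c by simp
  also have "\<dots> \<le> (K * n2 (star a * c)) * n2 c"
    using assms c by (intro mult_right_mono bndD) auto
  finally have "n2 (star a * c) * n2 (star a * c) \<le> n2 (star a * c) * (K * n2 c)"
    by (simp add: power2_eq_square mult_ac)
  then show "n2 (star a * c) \<le> K * n2 c"
    using assms c bnd_nonneg[OF assms] n2_nonneg[of "star a * c"] n2_nonneg[of c]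
    by (cases "n2 (star a * c) = 0") (auto simp del: n2_nonneg)
qed (use assms bnd_nonneg[OF assms(1)] in auto)

text \<open>By the trace property the star is isometric for \<open>n2\<close>, which exchanges right
  and left multiplication. Products can then be estimated with the small factor on either
  side.\<close>

lemma n2_mult_right:
  assumes "bnd a K" "b \<in> A" shows "n2 (b * a) \<le> K * n2 b"
proof -
  have "n2 (b * a) = n2 (star a * star b)"
    using n2_star[of "b * a"] assms by simp
  also have "\<dots> \<le> K * n2 b"
    using bndD[OF bnd_star[OF assms(1)], of "star b"] assms by (simp add: n2_star)
  finally show ?thesis .
qed

lemma n2_le_bnd: "bnd a K \<Longrightarrow> n2 a \<le> K"
  using bndD[of a K 1] by simp

end

text \<open>Partial sums of a geometric series for \<open>(1 + S\<^sup>2)\<^sup>-\<^sup>1\<close> that converges when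
  \<open>\<parallel>S\<parallel> \<le> K\<close>: \<open>cutoff\<close> is a polynomial version of \<open>2 S / (1 + S\<^sup>2)\<close>.\<close>

primrec smooth_sum :: "'a::star_algebra \<Rightarrow> real \<Rightarrow> nat \<Rightarrow> 'a" where
  "smooth_sum S K 0 = 0"
| "smooth_sum S K (Suc N) =
     scl (of_real (1 / (1 + K\<^sup>2))) 1 +
     (1 - scl (of_real (1 / (1 + K\<^sup>2))) (1 + S * S)) * smooth_sum S K N"

definition cutoff :: "'a::star_algebra \<Rightarrow> real \<Rightarrow> nat \<Rightarrow> 'a" where
  "cutoff S K N = scl 2 (smooth_sum S K N * S)"

lemma commute_smooth_sum: "T * S = S * T \<Longrightarrow> T * smooth_sum S K N = smooth_sum S K N * T"
proof (induction N)
  case (Suc N)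
  have 1: "T * (S * (S * x)) = S * (S * (T * x))" for x
    using Suc.prems by (metis mult.assoc)
  show ?case
    using Suc by (simp add: algebra_simps scl_add_right mult.assoc 1)
qed simp

section \<open>Norm bounds and accuracy of the cutoff\<close>

context tracial_algebra
begin

context
  fixes S K
  assumes S: "star S = S" "bnd S K"
begin

lemma smooth_sum_closed [simp]: "smooth_sum S K N \<in> A"
  using S by (induction N) auto

lemma star_smooth_sum: "star (smooth_sum S K N) = smooth_sum S K N"
proof (induction N)
  case (Suc N)
  have "S * S * smooth_sum S K N = smooth_sum S K N * (S * S)"
    using commute_smooth_sum[of S S K N] by (metis mult.assoc)
  then show ?case
    using Suc S by (simp add: algebra_simps scl_add_right)
qed simp

text \<open>The element is K^2 - S^2 divided by 1 + K^2, where S^2 should lie between 0 and K^2. In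
  terms of 2-norms: when the square of \<open>n2\<close> of (K^2 - S^2) b is expanded, the term with
  S^2 b is at most K^2 times that with S b, which leaves \<open>K ^ 4 * ip b b\<close> minus a
  nonnegative quantity.\<close>

lemma bnd_gap:
  "bnd (1 - scl (of_real (1 / (1 + K\<^sup>2))) (1 + S * S)) (K\<^sup>2 / (1 + K\<^sup>2))"
proof -
  have SS: "bnd (scl (of_real (K\<^sup>2)) 1 - S * S) (K\<^sup>2)"
    unfolding bnd_def
  proof (intro conjI ballI)
    fix b assume b: "b \<in> A"
    have n: "n2 (S * c) \<le> K * n2 c" if "c \<in> A" for c
      using bndD[OF S(2) that] .
    have "(n2 (S * (S * b)))\<^sup>2 \<le> (K * n2 (S * b))\<^sup>2"
      using S b by (intro power_mono n) auto
    then have 1: "ip (S * S * b) (S * S * b) \<le> K\<^sup>2 * ip (S * b) (S * b)"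
      using S b by (simp add: power_mult_distrib n2_power2 mult.assoc)
    have e: "ip (S * S * b) b = ip (S * b) (S * b)"
      using S b by (simp add: ip_mult_left mult.assoc)
    have c: "ip b (S * S * b) = ip (S * S * b) b"
      using S b by (intro ip_commute) auto
    have "ip ((scl (of_real (K\<^sup>2)) 1 - S * S) * b) ((scl (of_real (K\<^sup>2)) 1 - S * S) * b)
      = ip (scl (of_real (K\<^sup>2)) b - S * S * b) (scl (of_real (K\<^sup>2)) b - S * S * b)"
      by (simp add: algebra_simps)
    also have "\<dots> = K ^ 4 * ip b b - 2 * K\<^sup>2 * ip (S * b) (S * b) + ip (S * S * b) (S * S * b)"
      using S b
      by (simp add: ip_diff_left ip_diff_right ip_scl_left ip_scl_right c e
          del: of_real_power) (simp add: algebra_simps power2_eq_square power4_eq_xxxx)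
    also have "\<dots> \<le> K ^ 4 * ip b b - K\<^sup>2 * ip (S * b) (S * b)"
      using 1 by simp
    also have "\<dots> \<le> K ^ 4 * ip b b"
      using S b by (simp add: ip_self)
    also have "\<dots> = (K\<^sup>2 * n2 b)\<^sup>2"
      using b by (simp add: power_mult_distrib n2_power2)
    finally have "(n2 ((scl (of_real (K\<^sup>2)) 1 - S * S) * b))\<^sup>2 \<le> (K\<^sup>2 * n2 b)\<^sup>2"
      using S b by (subst n2_power2) auto
    then show "n2 ((scl (of_real (K\<^sup>2)) 1 - S * S) * b) \<le> K\<^sup>2 * n2 b"
      by (rule power2_le_imp_le) (use b in simp)
  qed (use S in auto)
  have 0: "1 + K\<^sup>2 \<noteq> 0"
    using zero_le_power2[of K] by linarith
  have "complex_of_real (1 / (1 + K\<^sup>2)) * of_real (1 + K\<^sup>2) = 1"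
    unfolding of_real_mult[symmetric] using 0 by simp
  then have 1: "(1::'a) = scl (of_real (1 / (1 + K\<^sup>2))) (scl (of_real (1 + K\<^sup>2)) 1)"
    by (simp only: scl_scl scl_one)
  have "1 - scl (of_real (1 / (1 + K\<^sup>2))) (1 + S * S)
      = scl (of_real (1 / (1 + K\<^sup>2))) (scl (of_real (K\<^sup>2)) 1 - S * S)"
    by (subst (1) 1, simp only: scl_diff_right[symmetric] of_real_add scl_add_left of_real_1 scl_one)
      (simp add: algebra_simps)
  moreover have "cmod (of_real (1 / (1 + K\<^sup>2))) * K\<^sup>2 = K\<^sup>2 / (1 + K\<^sup>2)"
    by (simp only: norm_of_real) (simp add: abs_of_nonneg)
  ultimately show ?thesis
    using bnd_scl[OF SS, of "of_real (1 / (1 + K\<^sup>2))"] by presburger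
qed

text \<open>Telescoping of the geometric series with ratio \<open>D\<close>: the scaled
  \<open>1 + S * S\<close> is \<open>1 - D\<close>.\<close>

lemma smooth_sum_inverse:
  "smooth_sum S K N * (1 + S * S) = 1 - (1 - scl (of_real (1 / (1 + K\<^sup>2))) (1 + S * S)) ^ N"
proof (induction N)
  case (Suc N)
  define D where "D = 1 - scl (of_real (1 / (1 + K\<^sup>2))) (1 + S * S)"
  have "smooth_sum S K (Suc N) * (1 + S * S)
      = scl (of_real (1 / (1 + K\<^sup>2))) (1 + S * S) + D * (smooth_sum S K N * (1 + S * S))"
    by (simp only: smooth_sum.simps distrib_right D_def[symmetric] mult.assoc scl_mult_left mult_1_left)
  also have "\<dots> = (1 - D) + D * (1 - D ^ N)"
    using Suc by (simp add: D_def)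
  also have "\<dots> = 1 - D ^ Suc N"
    by (simp add: algebra_simps)
  finally show ?case
    by (simp add: D_def)
qed simp

lemma bnd_smooth_sum: "bnd (smooth_sum S K N) 1"
proof -
  define d where "d = K\<^sup>2 / (1 + K\<^sup>2)"
  have "0 < 1 + K\<^sup>2"
    by (simp add: add_pos_nonneg)
  \<comment> \<open>The added constant and the ratio sum to 1, so the bounds of the partial sums
    stay below 1 for all K and N.\<close>
  then have d: "1 / (1 + K\<^sup>2) = 1 - d" "0 \<le> d" "d \<le> 1"
    by (auto simp: d_def field_simps)
  have "bnd (smooth_sum S K N) (1 - d ^ N)"
  proof (induction N)
    case (Suc N)
    have "bnd (smooth_sum S K (Suc N)) (cmod (of_real (1 / (1 + K\<^sup>2))) * 1 + d * (1 - d ^ N))"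
      unfolding smooth_sum.simps d_def
      by (intro bnd_add bnd_scl bnd_one bnd_mult bnd_gap Suc[unfolded d_def])
    moreover have "cmod (of_real (1 / (1 + K\<^sup>2))) * 1 + d * (1 - d ^ N) = 1 - d ^ Suc N"
      by (simp only: norm_of_real) (use d in \<open>simp add: algebra_simps\<close>)
    ultimately show ?case by simp
  qed (simp add: bnd_zero)
  then show ?thesis
    by (rule bnd_mono) (use d in simp)
qed

text \<open>With Q the partial sum and E the remainder, adding the square of Q b to that of S Q b
  produces \<open>ip (Q * (1 + S * S) * (Q * b)) b\<close>, in which
  \<open>Q * (1 + S * S) = 1 - E\<close> has bound 2. The resulting constant, the square root of 2,
  is rounded up to 3/2; the point is that it does not involve K or N.\<close>

lemma bnd_smooth_sum_mult: "bnd (smooth_sum S K N * S) (3/2)"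
  unfolding bnd_def
proof (intro conjI ballI)
  define Q where "Q = smooth_sum S K N"
  define E where "E = (1 - scl (of_real (1 / (1 + K\<^sup>2))) (1 + S * S)) ^ N"
  have Q: "bnd Q 1" "star Q = Q" "Q * (1 + S * S) = 1 - E" "S * Q = Q * S"
    unfolding Q_def E_def by (intro bnd_smooth_sum star_smooth_sum smooth_sum_inverse commute_smooth_sum refl)+
  have "bnd E ((K\<^sup>2 / (1 + K\<^sup>2)) ^ N)"
    unfolding E_def by (intro bnd_power bnd_gap)
  moreover have "(K\<^sup>2 / (1 + K\<^sup>2)) ^ N \<le> 1"
    by (intro power_le_one) (auto simp: divide_le_eq_1 add_pos_nonneg)
  ultimately have "bnd E 1"
    by (rule bnd_mono)
  then have E: "bnd (1 - E) 2"
    using bnd_diff[OF bnd_one] by force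
  fix b assume b: "b \<in> A"
  have A: "Q \<in> A" "S \<in> A" "E \<in> A"
    using Q S \<open>bnd E 1\<close> by auto
  have "S * (Q * (Q * (S * b))) = Q * (S * (S * (Q * b)))"
    using Q(4) by (metis mult.assoc)
  then have "ip (S * Q * b) (S * Q * b) + ip (Q * b) (Q * b) = ip (Q * (1 + S * S) * (Q * b)) b"
    using A b Q(2,4) S
    by (simp add: ip_mult_left ip_add_left distrib_left distrib_right mult.assoc ip_add_right)
  moreover have "(n2 (Q * S * b))\<^sup>2 \<le> ip (S * Q * b) (S * Q * b) + ip (Q * b) (Q * b)"
    using A b Q by (simp add: n2_power2 ip_self)
  ultimately have "(n2 (Q * S * b))\<^sup>2 \<le> ip ((1 - E) * (Q * b)) b"
    by (simp add: Q(3))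
  also have "\<dots> \<le> n2 ((1 - E) * (Q * b)) * n2 b"
    using Cauchy_Schwarz_ip[of "(1 - E) * (Q * b)" b] A b by simp
  also have "\<dots> \<le> (2 * (1 * n2 b)) * n2 b"
    using b A by (intro mult_right_mono order_trans[OF bndD[OF E]] mult_left_mono bndD[OF Q(1)]) auto
  also have "\<dots> \<le> (3/2 * n2 b)\<^sup>2"
    using b by (simp add: power2_eq_square)
  finally show "n2 (smooth_sum S K N * S * b) \<le> 3/2 * n2 b"
    unfolding Q_def by (rule power2_le_imp_le) (use b in simp)
qed (use S in auto)

lemma bnd_cutoff: "bnd (cutoff S K N) 3"
  using bnd_scl[OF bnd_smooth_sum_mult, of 2] by (simp add: cutoff_def)

text \<open>The identity behind Kaplansky's density theorem: multiplied by \<open>1 - E\<close> on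
  the left and \<open>1 + X * X\<close> on the right, the difference of the cutoff and T becomes a
  sum of terms that each contain S - X or E. Both multipliers shrink 2-norms by a factor of 3/4 at
  worst. S enters through its 2-norm distance from X, however large its bound K is; K only affects
  E, which a large N makes small.\<close>

lemma cutoff_close:
  assumes T: "T \<in> A" "bnd X (1/2)" "T * (1 + X * X) = scl 2 X"
    and N: "(K\<^sup>2 / (1 + K\<^sup>2)) ^ N \<le> 1/4"
  shows "n2 (cutoff S K N - T) \<le> 8 * n2 (S - X) + 8 * (K\<^sup>2 / (1 + K\<^sup>2)) ^ N"
proof -
  define Q where "Q = smooth_sum S K N"
  define E where "E = (1 - scl (of_real (1 / (1 + K\<^sup>2))) (1 + S * S)) ^ N"
  define e where "e = (K\<^sup>2 / (1 + K\<^sup>2)) ^ N"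
  define f where "f = cutoff S K N"
  have Q: "bnd Q 1" "star Q = Q" "Q * (1 + S * S) = 1 - E" "S * Q = Q * S" "bnd (Q * S) (3/2)"
    unfolding Q_def E_def by (intro bnd_smooth_sum star_smooth_sum smooth_sum_inverse commute_smooth_sum
       bnd_smooth_sum_mult refl)+
  have E: "bnd E e"
    unfolding E_def e_def by (intro bnd_power bnd_gap)
  have f: "f = scl 2 (Q * S)"
    by (simp add: f_def cutoff_def Q_def)
  have A [simp]: "Q \<in> A" "S \<in> A" "E \<in> A" "X \<in> A" "f \<in> A" "T \<in> A"
    using Q S E T f by auto
  have X2: "bnd (X * X) (1/4)"
    using bnd_mult[OF T(2) T(2)] by simp
  have c1: "(1 - E) * (Q * S) = Q * S * (1 - E)"
    unfolding Q(3)[symmetric] using Q(4) by (simp add: algebra_simps) (metis mult.assoc)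
  have "(1 - E) * (f - T) * (1 + X * X) = (1 - E) * f * (1 + X * X) - (1 - E) * (T * (1 + X * X))"
    by (simp only: left_diff_distrib right_diff_distrib mult.assoc)
  also have "\<dots> = scl 2 (Q * S * (1 - E) * (1 + X * X)) - scl 2 (Q * (1 + S * S) * X)"
    unfolding T(3) f using c1 Q(3) by (simp add: mult.assoc)
  also have "\<dots> = scl 2 (Q * (S - X) + Q * S * ((X - S) * X) - Q * S * E * (1 + X * X))"
    by (simp add: algebra_simps scl_add_right scl_diff_right)
  finally have eq: "(1 - E) * (f - T) * (1 + X * X) = \<dots>" .
  have "n2 (Q * (S - X) + Q * S * ((X - S) * X) - Q * S * E * (1 + X * X))
     \<le> n2 (Q * (S - X)) + n2 (Q * S * ((X - S) * X)) + n2 (Q * S * E * (1 + X * X))"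
    by (intro order_trans[OF n2_diff] add_mono n2_triangle order_refl) auto
  also have "n2 (Q * (S - X)) \<le> 1 * n2 (S - X)"
    by (intro bndD Q) auto
  also have "n2 (Q * S * ((X - S) * X)) \<le> 3/2 * (1/2 * n2 (S - X))"
    by (subst n2_diff_commute[of S X]) 
      (auto intro!: order_trans[OF bndD[OF Q(5)]] mult_left_mono n2_mult_right[OF T(2)] simp del: times_divide_eq_left)
  also have "n2 (Q * S * E * (1 + X * X)) \<le> 3/2 * e * (1 + 1/4)"
    by (intro n2_le_bnd bnd_mult bnd_add Q E X2 bnd_one)
  finally have "n2 ((1 - E) * (f - T) * (1 + X * X)) \<le> 2 * (7/4 * n2 (S - X) + 15/8 * e)"
    unfolding eq by (subst n2_scl) auto
  moreover have "3/4 * n2 ((1 - E) * (f - T)) \<le> n2 ((1 - E) * (f - T) * (1 + X * X))"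
  proof -
    define Z where "Z = (1 - E) * (f - T)"
    have "Z \<in> A" by (simp add: Z_def)
    have "n2 (Z * (1 + X * X) - Z * (X * X)) \<le> n2 (Z * (1 + X * X)) + n2 (Z * (X * X))"
      using \<open>Z \<in> A\<close> by (intro n2_diff) auto
    moreover have "n2 (Z * (X * X)) \<le> 1/4 * n2 Z"
      using \<open>Z \<in> A\<close> by (intro n2_mult_right X2)
    ultimately show ?thesis
      unfolding Z_def[symmetric] by (simp add: distrib_left)
  qed
  moreover have "3/4 * n2 (f - T) \<le> n2 ((1 - E) * (f - T))"
  proof -
    have "n2 ((1 - E) * (f - T) + E * (f - T)) \<le> n2 ((1 - E) * (f - T)) + n2 (E * (f - T))"
      by (intro n2_triangle) auto
    moreover have "n2 (E * (f - T)) \<le> 1/4 * n2 (f - T)"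
      using N by (intro bndD bnd_mono[OF E]) (auto simp: e_def)
    ultimately show ?thesis
      by (simp add: left_diff_distrib)
  qed
  moreover have "0 \<le> e" "0 \<le> n2 (S - X)"
    using E bnd_nonneg by auto
  \<comment> \<open>Dividing by (3/4)^2 gives the constants 56/9 and 60/9, rounded up to 8.\<close>
  ultimately have "n2 (f - T) \<le> 8 * n2 (S - X) + 8 * e"
    by argo
  then show ?thesis
    by (simp add: f_def e_def)
qed

end

end

section \<open>Star-polynomials and moments\<close>

text \<open>Polynomials are syntax, so that one polynomial can be evaluated in M and at matrices
  while its bounds and its words are computed by recursion.\<close>

datatype star_poly =
  Gen nat | Const complex | Plus star_poly star_poly | Times star_poly star_poly | Adj star_poly

primrec eval :: "(nat \<Rightarrow> 'a::star_algebra) \<Rightarrow> star_poly \<Rightarrow> 'a" where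
  "eval v (Gen i) = v i"
| "eval v (Const c) = scl c 1"
| "eval v (Plus p q) = eval v p + eval v q"
| "eval v (Times p q) = eval v p * eval v q"
| "eval v (Adj p) = star (eval v p)"

primrec gens :: "star_poly \<Rightarrow> nat set" where
  "gens (Gen i) = {i}"
| "gens (Const c) = {}"
| "gens (Plus p q) = gens p \<union> gens q"
| "gens (Times p q) = gens p \<union> gens q"
| "gens (Adj p) = gens p"

primrec subst_poly :: "(nat \<Rightarrow> star_poly) \<Rightarrow> star_poly \<Rightarrow> star_poly" where
  "subst_poly \<phi> (Gen i) = \<phi> i"
| "subst_poly \<phi> (Const c) = Const c"
| "subst_poly \<phi> (Plus p q) = Plus (subst_poly \<phi> p) (subst_poly \<phi> q)"
| "subst_poly \<phi> (Times p q) = Times (subst_poly \<phi> p) (subst_poly \<phi> q)"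
| "subst_poly \<phi> (Adj p) = Adj (subst_poly \<phi> p)"

lemma eval_subst_poly: "eval v (subst_poly \<phi> p) = eval (\<lambda>i. eval v (\<phi> i)) p"
  by (induction p) auto

lemma gens_subst_poly: "gens (subst_poly \<phi> p) = (\<Union>i\<in>gens p. gens (\<phi> i))"
  by (induction p) auto

definition word_value :: "(nat \<Rightarrow> 'a::star_algebra) \<Rightarrow> (nat \<times> bool) list \<Rightarrow> 'a" where
  "word_value v w = foldr (\<lambda>(i, s) T. (if s then star (v i) else v i) * T) w 1"

lemma word_value_Nil [simp]: "word_value v [] = 1"
  and word_value_Cons [simp]:
    "word_value v ((i, s) # w) = (if s then star (v i) else v i) * word_value v w"
  by (simp_all add: word_value_def)

lemma word_value_append: "word_value v (w @ w') = word_value v w * word_value v w'"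
  by (induction w) (auto simp: mult.assoc)

primrec adjoint_word :: "(nat \<times> bool) list \<Rightarrow> (nat \<times> bool) list" where
  "adjoint_word [] = []"
| "adjoint_word (a # w) = adjoint_word w @ [(fst a, \<not> snd a)]"

lemma word_value_adjoint: "word_value v (adjoint_word w) = star (word_value v w)"
  by (induction w) (auto simp: word_value_append)

lemma set_adjoint_word: "set (adjoint_word w) = (\<lambda>(i, s). (i, \<not> s)) ` set w"
  by (induction w) auto

primrec word_poly :: "(nat \<times> bool) list \<Rightarrow> star_poly" where
  "word_poly [] = Const 1"
| "word_poly (a # w) = Times (if snd a then Adj (Gen (fst a)) else Gen (fst a)) (word_poly w)"

lemma eval_word_poly: "eval v (word_poly w) = word_value v w"
  by (induction w) auto

text \<open>Microstates control traces of words only; this normal form reduces the trace of a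
  polynomial to those.\<close>

primrec expand :: "star_poly \<Rightarrow> (complex \<times> (nat \<times> bool) list) list" where
  "expand (Gen i) = [(1, [(i, False)])]"
| "expand (Const c) = [(c, [])]"
| "expand (Plus p q) = expand p @ expand q"
| "expand (Times p q) =
     concat (map (\<lambda>(c, w). map (\<lambda>(d, w'). (c * d, w @ w')) (expand q)) (expand p))"
| "expand (Adj p) = map (\<lambda>(c, w). (cnj c, adjoint_word w)) (expand p)"

lemma eval_expand: "eval v p = (\<Sum>(c, w)\<leftarrow>expand p. scl c (word_value v w))"
proof (induction p)
  case (Times p q)
  have *: "(\<Sum>x\<leftarrow>ds. scl (c * fst x) (word_value v (w @ snd x))) =
      scl c (word_value v w * (\<Sum>x\<leftarrow>ds. scl (fst x) (word_value v (snd x))))" for c w ds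
    by (induction ds) (auto simp: word_value_append distrib_left scl_add_right mult.commute)
  have "(\<Sum>(c, w)\<leftarrow>concat (map (\<lambda>(c, w). map (\<lambda>(d, w'). (c * d, w @ w')) ds) cs).
        scl c (word_value v w)) =
      (\<Sum>(c, w)\<leftarrow>cs. scl c (word_value v w)) * (\<Sum>(d, w')\<leftarrow>ds. scl d (word_value v w'))" for cs ds
    by (induction cs) (auto simp: distrib_right * comp_def case_prod_unfold)
  then show ?case
    using Times by simp
next
  case (Adj p)
  have "(\<Sum>(c, w)\<leftarrow>map (\<lambda>(c, w). (cnj c, adjoint_word w)) cs. scl c (word_value v w)) =
      star (\<Sum>(c, w)\<leftarrow>cs. scl c (word_value v w))" for cs
    by (induction cs) (auto simp: word_value_adjoint)
  then show ?case
    using Adj by simp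
qed auto

lemma expand_gens: "(c, w) \<in> set (expand p) \<Longrightarrow> fst ` set w \<subseteq> gens p"
proof (induction p arbitrary: c w)
  case (Times p q)
  then obtain c1 w1 c2 w2 where w: "(c1, w1) \<in> set (expand p)" "(c2, w2) \<in> set (expand q)" "w = w1 @ w2"
    by auto
  then show ?case
    using Times.IH(1)[OF w(1)] Times.IH(2)[OF w(2)] by (auto simp: image_Un)
next
  case (Plus p q)
  then consider "(c, w) \<in> set (expand p)" | "(c, w) \<in> set (expand q)"
    by auto
  then show ?case
    using Plus.IH by cases force+
next
  case (Adj p)
  then show ?case by (fastforce simp: set_adjoint_word)
qed auto

section \<open>Norm and Lipschitz bounds of star-polynomials\<close>

primrec poly_bound :: "real \<Rightarrow> star_poly \<Rightarrow> real" where
  "poly_bound R (Gen i) = R"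
| "poly_bound R (Const c) = cmod c"
| "poly_bound R (Plus p q) = poly_bound R p + poly_bound R q"
| "poly_bound R (Times p q) = poly_bound R p * poly_bound R q"
| "poly_bound R (Adj p) = poly_bound R p"

primrec poly_lipschitz :: "real \<Rightarrow> star_poly \<Rightarrow> real" where
  "poly_lipschitz R (Gen i) = 1"
| "poly_lipschitz R (Const c) = 0"
| "poly_lipschitz R (Plus p q) = poly_lipschitz R p + poly_lipschitz R q"
| "poly_lipschitz R (Times p q) =
     poly_bound R p * poly_lipschitz R q + poly_bound R q * poly_lipschitz R p"
| "poly_lipschitz R (Adj p) = poly_lipschitz R p"

lemma poly_bound_nonneg: "0 \<le> R \<Longrightarrow> 0 \<le> poly_bound R p"
  by (induction p) auto

lemma poly_lipschitz_nonneg: "0 \<le> R \<Longrightarrow> 0 \<le> poly_lipschitz R p"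
  by (induction p) (auto simp: poly_bound_nonneg)

context tracial_algebra
begin

lemma eval_closed: "(\<And>i. v i \<in> A) \<Longrightarrow> eval v p \<in> A"
  by (induction p) auto

lemma word_value_closed: "(\<And>i. v i \<in> A) \<Longrightarrow> word_value v w \<in> A"
  unfolding eval_word_poly[symmetric] by (rule eval_closed)

lemma bnd_eval: 
  assumes "\<And>i. bnd (v i) R" shows "bnd (eval v p) (poly_bound R p)"
proof (induction p)
  case (Const c)
  then show ?case using bnd_scl[OF bnd_one, of c] by simp
qed (use assms in \<open>auto intro: bnd_add bnd_mult bnd_star\<close>)

text \<open>Sizes are operator bounds, distances are 2-norms. In each term of the product rule one
  factor is bounded and the other is small in 2-norm; \<open>bndD\<close> serves when the small
  factor is on the right, \<open>n2_mult_right\<close> when it is on the left.\<close>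

lemma eval_lipschitz:
  assumes v: "\<And>i. bnd (v i) R" and u: "\<And>i. bnd (u i) R"
    and d: "\<And>i. n2 (v i - u i) \<le> d"
  shows "n2 (eval v p - eval u p) \<le> poly_lipschitz R p * d"
proof -
  have ev [simp]: "eval v p \<in> A" "eval u p \<in> A" for p
    using bnd_closed[OF bnd_eval[of v R, OF v]] bnd_closed[OF bnd_eval[of u R, OF u]] by blast+
  show ?thesis
  proof (induction p)
    case (Const c)
    then show ?case by simp
  next
    case (Plus p q)
    have "n2 (eval v p - eval u p + (eval v q - eval u q))
        \<le> n2 (eval v p - eval u p) + n2 (eval v q - eval u q)"
      by (intro n2_triangle) auto
    then show ?case
      using Plus by (simp add: algebra_simps)
  next
    case (Times p q)
    have R: "0 \<le> R"
      using v bnd_nonneg by blast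
    have "eval v (Times p q) - eval u (Times p q) =
        eval v p * (eval v q - eval u q) + (eval v p - eval u p) * eval u q"
      by (simp add: algebra_simps)
    then have "n2 (eval v (Times p q) - eval u (Times p q))
        \<le> n2 (eval v p * (eval v q - eval u q)) + n2 ((eval v p - eval u p) * eval u q)"
      by (simp only:) (intro n2_triangle; simp)
    also have "\<dots> \<le> poly_bound R p * n2 (eval v q - eval u q)
        + poly_bound R q * n2 (eval v p - eval u p)"
      by (intro add_mono bndD n2_mult_right bnd_eval v u) auto
    also have "\<dots> \<le> poly_bound R p * (poly_lipschitz R q * d) + poly_bound R q * (poly_lipschitz R p * d)"
      using Times R by (intro add_mono mult_left_mono poly_bound_nonneg) auto
    finally show ?case
      by (simp add: algebra_simps)
  next
    case (Adj p)
    then show ?case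
      using Adj n2_star[of "eval v p - eval u p"] by simp
  qed (use d in auto)
qed

lemma tr_eval:
  assumes v: "\<And>i. v i \<in> A"
  shows "tr (eval v p) = (\<Sum>(c, w)\<leftarrow>expand p. c * tr (word_value v w))"
proof -
  have "tr (\<Sum>(c, w)\<leftarrow>cs. scl c (word_value v w)) = (\<Sum>(c, w)\<leftarrow>cs. c * tr (word_value v w)) \<and>
      (\<Sum>(c, w)\<leftarrow>cs. scl c (word_value v w)) \<in> A" for cs
    using word_value_closed[OF v] by (induction cs) (auto simp: tr_add tr_scl)
  then show ?thesis
    by (simp add: eval_expand)
qed

end

section \<open>Comparison of moments between two tracial algebras\<close>

lemma sum_list_diff_bound:
  fixes f g :: "'a \<Rightarrow> complex"
  assumes "\<And>x. x \<in> set xs \<Longrightarrow> cmod (f x - g x) \<le> h x"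
  shows "cmod ((\<Sum>x\<leftarrow>xs. f x) - (\<Sum>x\<leftarrow>xs. g x)) \<le> (\<Sum>x\<leftarrow>xs. h x)"
  using assms
proof (induction xs)
  case (Cons x xs)
  have "(f x + (\<Sum>x\<leftarrow>xs. f x)) - (g x + (\<Sum>x\<leftarrow>xs. g x)) = (f x - g x) + ((\<Sum>x\<leftarrow>xs. f x) - (\<Sum>x\<leftarrow>xs. g x))"
    by simp
  then have "cmod ((f x + (\<Sum>x\<leftarrow>xs. f x)) - (g x + (\<Sum>x\<leftarrow>xs. g x)))
     \<le> cmod (f x - g x) + cmod ((\<Sum>x\<leftarrow>xs. f x) - (\<Sum>x\<leftarrow>xs. g x))"
    by (metis norm_triangle_ineq)
  also have "\<dots> \<le> h x + (\<Sum>x\<leftarrow>xs. h x)"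
    using Cons by (intro add_mono) auto
  finally show ?case by simp
qed simp

text \<open>The pair m, \<epsilon> is chosen before the algebras, from the words and coefficients of
  p, and so serves all matrix sizes at once.\<close>

lemma moments_determine_trace:
  fixes p :: star_poly
  assumes "gens p \<subseteq> {..<n}" "0 < \<delta>"
  shows "\<exists>m \<epsilon>. 0 < \<epsilon> \<and> (\<forall>(A :: 'a::star_algebra set) tr v (B :: 'b::star_algebra set) tr' u.
    tracial_algebra A tr \<longrightarrow> tracial_algebra B tr' \<longrightarrow> (\<forall>i. v i \<in> A) \<longrightarrow> (\<forall>i. u i \<in> B) \<longrightarrow>
    (\<forall>w\<in>star_words n m. cmod (tr (word_value v w) - tr' (word_value u w)) < \<epsilon>) \<longrightarrow>
    cmod (tr (eval v p) - tr' (eval u p)) < \<delta>)"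
proof -
  define C where "C = (\<Sum>(c, w)\<leftarrow>expand p. cmod c)"
  \<comment> \<open>The summand 1 keeps the denominator positive and the final inequality
    strict.\<close>
  define \<epsilon> where "\<epsilon> = \<delta> / (C + 1)"
  define m where "m = Max (insert 0 ((length \<circ> snd) ` set (expand p)))"
  have C: "0 \<le> C"
    unfolding C_def by (rule sum_list_nonneg) auto
  then have \<epsilon>: "0 < \<epsilon>" "\<epsilon> * C < \<delta>"
    using assms by (auto simp: \<epsilon>_def field_simps)
  have "cmod (tr (eval v p) - tr' (eval u p)) < \<delta>"
    if "tracial_algebra A tr" "tracial_algebra B tr'" and v: "\<forall>i. v i \<in> A" and u: "\<forall>i. u i \<in> B"
      and w: "\<forall>w\<in>star_words n m. cmod (tr (word_value v w) - tr' (word_value u w)) < \<epsilon>"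
    for A :: "'a set" and tr v and B :: "'b set" and tr' u
  proof -
    interpret A: tracial_algebra A tr by fact
    interpret B: tracial_algebra B tr' by fact
    have "cmod (tr (eval v p) - tr' (eval u p)) \<le> (\<Sum>(c, w)\<leftarrow>expand p. \<epsilon> * cmod c)"
      using v u
    proof (simp only: A.tr_eval B.tr_eval, intro sum_list_diff_bound, safe)
      fix c w' assume cw: "(c, w') \<in> set (expand p)"
      have "cmod (tr (word_value v w') - tr' (word_value u w')) \<le> \<epsilon>"
      \<comment> \<open>\<open>star_words\<close> omits the empty word, whose trace is 1 in both
        algebras.\<close>
      proof (cases "w' = []")
        case False
        have "length w' \<le> m"
          unfolding m_def using cw by (intro Max_ge) force+
        moreover have "i < n" if "(i, s) \<in> set w'" for i s
          using expand_gens[OF cw] assms(1) that by force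
        ultimately have "w' \<in> star_words n m"
          using False by (auto simp: star_words_def Suc_le_eq)
        then show ?thesis using w by force
      qed (use \<epsilon> in \<open>simp add: A.tr_one B.tr_one\<close>)
      then have "cmod c * cmod (tr (word_value v w') - tr' (word_value u w')) \<le> cmod c * \<epsilon>"
        by (rule mult_left_mono) simp
      then show "cmod (c * tr (word_value v w') - c * tr' (word_value u w')) \<le> \<epsilon> * cmod c"
        by (simp add: right_diff_distrib[symmetric] norm_mult mult.commute)
    qed
    also have "\<dots> = \<epsilon> * C"
      by (simp add: C_def sum_list_const_mult case_prod_unfold)
    finally show ?thesis
      using \<epsilon> by simp
  qed
  then show ?thesis
    using \<epsilon> by blast
qed

lemma star_words_mono: "m \<le> m' \<Longrightarrow> star_words n m \<subseteq> star_words n m'"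
  by (auto simp: star_words_def)

text \<open>Closeness of moments gets stronger as m grows and \<epsilon> shrinks, so finitely many
  polynomials can share a maximum and a minimum.\<close>

lemma moments_determine_traces:
  assumes "finite P" "\<And>p. p \<in> P \<Longrightarrow> gens p \<subseteq> {..<n}" "0 < \<delta>"
  shows "\<exists>m \<epsilon>. 0 < \<epsilon> \<and> (\<forall>(A :: 'a::star_algebra set) tr v (B :: 'b::star_algebra set) tr' u.
    tracial_algebra A tr \<longrightarrow> tracial_algebra B tr' \<longrightarrow> (\<forall>i. v i \<in> A) \<longrightarrow> (\<forall>i. u i \<in> B) \<longrightarrow>
    (\<forall>w\<in>star_words n m. cmod (tr (word_value v w) - tr' (word_value u w)) < \<epsilon>) \<longrightarrow>
    (\<forall>p\<in>P. cmod (tr (eval v p) - tr' (eval u p)) < \<delta>))"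
proof -
  define close where "close m \<epsilon> A tr v B tr' u \<longleftrightarrow>
      tracial_algebra A tr \<and> tracial_algebra B tr' \<and> (\<forall>i. v i \<in> A) \<and> (\<forall>i. u i \<in> B) \<and>
      (\<forall>w\<in>star_words n m. cmod (tr (word_value v w) - tr' (word_value u w)) < \<epsilon>)"
    for m \<epsilon> and A :: "'a set" and tr v and B :: "'b set" and tr' u
  define ctrl where "ctrl P m \<epsilon> \<longleftrightarrow> (\<forall>(A :: 'a set) tr v (B :: 'b set) tr' u.
      close m \<epsilon> A tr v B tr' u \<longrightarrow> (\<forall>p\<in>P. cmod (tr (eval v p) - tr' (eval u p)) < \<delta>))" for P m \<epsilon>
  have mono: "ctrl P m \<epsilon> \<Longrightarrow> m \<le> m' \<Longrightarrow> \<epsilon>' \<le> \<epsilon> \<Longrightarrow> ctrl P m' \<epsilon>'" for P m m' \<epsilon> \<epsilon>'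
  proof -
    assume "m \<le> m'" "\<epsilon>' \<le> \<epsilon>"
    then have "close m' \<epsilon>' A tr v B tr' u \<Longrightarrow> close m \<epsilon> A tr v B tr' u"
      for A :: "'a set" and tr v and B :: "'b set" and tr' u
      using star_words_mono[of m m' n] unfolding close_def by (meson less_le_trans subsetD)
    then show "ctrl P m \<epsilon> \<Longrightarrow> ctrl P m' \<epsilon>'"
      unfolding ctrl_def by blast
  qed
  have "\<exists>m \<epsilon>. 0 < \<epsilon> \<and> ctrl P m \<epsilon>"
    using assms(1,2)
  proof (induction P)
    case empty
    show ?case by (intro exI[of _ 0] exI[of _ 1]) (simp add: ctrl_def)
  next
    case (insert p P)
    obtain m \<epsilon> where 1: "0 < \<epsilon>" "ctrl P m \<epsilon>"
      using insert by auto
    have "\<exists>m \<epsilon>. 0 < \<epsilon> \<and> ctrl {p} m \<epsilon>"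
      using moments_determine_trace[of p n \<delta>, where ?'a = 'a and ?'b = 'b] insert.prems[of p] assms(3)
      by (simp add: ctrl_def close_def imp_conjL)
    then obtain m' \<epsilon>' where 2: "0 < \<epsilon>'" "ctrl {p} m' \<epsilon>'"
      by blast
    have "ctrl P (max m m') (min \<epsilon> \<epsilon>')" "ctrl {p} (max m m') (min \<epsilon> \<epsilon>')"
      using mono[OF 1(2)] mono[OF 2(2)] by simp_all
    then have "ctrl (insert p P) (max m m') (min \<epsilon> \<epsilon>')"
      unfolding ctrl_def by blast
    then show ?case
      using 1(1) 2(1) by (intro exI[of _ "max m m'"] exI[of _ "min \<epsilon> \<epsilon>'"]) simp
  qed
  then show ?thesis
    by (simp add: ctrl_def close_def imp_conjL)
qed

section \<open>The cutoff as a star-polynomial\<close>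

definition real_part_poly :: "star_poly \<Rightarrow> star_poly" where
  "real_part_poly p = Times (Const (1/2)) (Plus p (Adj p))"

text \<open>K and N are constants of the syntax here: a cutoff designed for operators can be
  evaluated unchanged at matrices.\<close>

primrec smooth_sum_poly :: "star_poly \<Rightarrow> real \<Rightarrow> nat \<Rightarrow> star_poly" where
  "smooth_sum_poly p K 0 = Const 0"
| "smooth_sum_poly p K (Suc N) =
     Plus (Const (of_real (1 / (1 + K\<^sup>2))))
       (Times
         (Plus (Const 1)
           (Times (Const (- of_real (1 / (1 + K\<^sup>2)))) (Plus (Const 1) (Times p p))))
         (smooth_sum_poly p K N))"

definition cutoff_poly :: "star_poly \<Rightarrow> real \<Rightarrow> nat \<Rightarrow> star_poly" where
  "cutoff_poly p K N = Times (Const 2) (Times (smooth_sum_poly p K N) p)"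

lemma eval_smooth_sum_poly: "eval v (smooth_sum_poly p K N) = smooth_sum (eval v p) K N"
  by (induction N) (simp_all add: scl_minus_left)

lemma eval_cutoff_poly: "eval v (cutoff_poly p K N) = cutoff (eval v p) K N"
  by (simp add: cutoff_poly_def cutoff_def eval_smooth_sum_poly)

lemma gens_cutoff_poly: "gens (cutoff_poly p K N) \<subseteq> gens p"
proof -
  have "gens (smooth_sum_poly p K N) \<subseteq> gens p"
    by (induction N) auto
  then show ?thesis by (simp add: cutoff_poly_def)
qed

lemma gens_real_part_poly [simp]: "gens (real_part_poly p) = gens p"
  by (simp add: real_part_poly_def)

lemma eval_real_part_poly: "eval v (real_part_poly p) = scl (1/2) (eval v p + star (eval v p))"
  by (simp add: real_part_poly_def)

lemma star_eval_real_part_poly: "star (eval v (real_part_poly p)) = eval v (real_part_poly p)"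
  by (simp add: eval_real_part_poly add.commute)

section \<open>Hilbert spaces and amplification\<close>

text \<open>The projection and representation theorems below are real. For complex-linear operators
  the imaginary part follows from the real part at \<open>(- \<i>) *\<^sub>C x\<close>.\<close>

definition rip :: "'h::complex_hilbert_space \<Rightarrow> 'h \<Rightarrow> real" where
  "rip x y = Re (cinner x y)"

lemma rip_commute: "rip x y = rip y x"
  by (subst rip_def, subst cinner_commute) (simp add: rip_def)

lemma rip_add_left: "rip (x + y) z = rip x z + rip y z"
  by (simp add: rip_def cinner_add_left)

lemma rip_add_right: "rip x (y + z) = rip x y + rip x z"
  using rip_add_left[of y z x] by (simp add: rip_commute)

lemma rip_scaleR_left: "rip (r *\<^sub>R x) y = r * rip x y"
  by (simp add: rip_def scaleR_scaleC cinner_scaleC_left)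

lemma rip_scaleR_right: "rip x (r *\<^sub>R y) = r * rip x y"
  using rip_scaleR_left[of r y x] by (simp add: rip_commute)

lemma rip_zero_left: "rip 0 y = 0"
  using rip_scaleR_left[of 0 0 y] by simp

lemma rip_minus_left: "rip (- x) y = - rip x y"
  using rip_scaleR_left[of "- 1" x y] by simp

lemma rip_minus_right: "rip x (- y) = - rip x y"
  using rip_scaleR_right[of x "- 1" y] by simp

lemma rip_diff_right: "rip x (y - z) = rip x y - rip x z"
  using rip_add_right[of x y "- z"] by (simp add: rip_minus_right)

lemma rip_self: "rip x x = (norm x)\<^sup>2"
  by (simp add: rip_def cinner_self)

lemma rip_le: "rip x y \<le> norm x * norm y"
proof -
  have "(norm (x + y))\<^sup>2 \<le> (norm x + norm y)\<^sup>2"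
    by (intro power_mono norm_triangle_ineq) auto
  moreover have "(norm (x + y))\<^sup>2 = (norm x)\<^sup>2 + 2 * rip x y + (norm y)\<^sup>2"
    by (simp add: rip_self[symmetric] rip_add_left rip_add_right rip_commute)
  ultimately show ?thesis
    by (simp add: power2_sum)
qed

lemma abs_rip_le: "\<bar>rip x y\<bar> \<le> norm x * norm y"
  using rip_le[of x y] rip_le[of "- x" y] by (simp add: rip_minus_left abs_le_iff)

lemma bounded_linear_rip_left: "bounded_linear (\<lambda>x. rip x y)"
  by (rule bounded_linear_intro[where K = "norm y"])
    (simp_all add: rip_add_left rip_scaleR_left abs_rip_le)

lemma bounded_linear_rip_right: "bounded_linear (\<lambda>y. rip x y)"
  using bounded_linear_rip_left[of x] by (simp add: rip_commute[of x])

lemma Im_cinner: "Im (cinner x y) = rip ((- \<i>) *\<^sub>C x) y"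
  by (simp add: rip_def cinner_scaleC_left)

lemma cinner_add_right: "cinner x (y + z) = cinner x y + cinner x z"
  by (metis cinner_commute cinner_add_left complex_cnj_add)

lemma cinner_scaleC_right: "cinner x (c *\<^sub>C y) = cnj c * cinner x y"
  by (metis cinner_commute cinner_scaleC_left complex_cnj_mult)

lemma norm_cinner_le: "cmod (cinner x y) \<le> 2 * (norm x * norm y)"
proof -
  have "cmod (cinner x y) \<le> \<bar>Re (cinner x y)\<bar> + \<bar>Im (cinner x y)\<bar>"
    by (rule cmod_le)
  also have "\<dots> \<le> norm x * norm y + norm ((- \<i>) *\<^sub>C x) * norm y"
    unfolding Im_cinner unfolding rip_def[symmetric] by (intro add_mono abs_rip_le)
  finally show ?thesis by (simp add: norm_scaleC)
qed

lemma cinner_eqI: "(\<And>x. cinner x y = cinner x z) \<Longrightarrow> y = z"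
proof -
  assume "\<And>x. cinner x y = cinner x z"
  then have "rip (y - z) y = rip (y - z) z"
    by (simp add: rip_def)
  then have "rip (y - z) (y - z) = 0"
    by (simp only: rip_diff_right)
  then show ?thesis by (simp add: rip_self)
qed

lemma rip_eqI: "(\<And>x. rip x y = rip x z) \<Longrightarrow> y = z"
  using rip_diff_right[of "y - z" y z] rip_self[of "y - z"] by simp

lemma orthogonal_projection:
  fixes V :: "'a::{real_inner, complete_space} set"
  assumes V: "closed V" "0 \<in> V" "\<And>v w. v \<in> V \<Longrightarrow> w \<in> V \<Longrightarrow> v + w \<in> V"
    "\<And>r v. v \<in> V \<Longrightarrow> r *\<^sub>R v \<in> V"
  shows "\<exists>p\<in>V. \<forall>v\<in>V. inner (x - p) v = 0"
proof -
  define d where "d = infdist x V"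
  have ne: "V \<noteq> {}"
    using V by blast
  have d: "d \<le> norm (x - v)" if "v \<in> V" for v
    using infdist_le[OF that, of x] by (simp add: d_def dist_norm)
  have d0: "0 \<le> d"
    by (simp add: d_def infdist_nonneg)
  have "\<exists>p\<in>V. norm (x - p) < d + 1 / Suc n" for n
  proof -
    have "\<exists>p\<in>V. dist x p < d + 1 / Suc n"
    proof (rule ccontr)
      assume "\<not> ?thesis"
      then have "d + 1 / Suc n \<le> infdist x V"
        unfolding infdist_def using ne by (auto intro!: cINF_greatest simp: not_less)
      then show False by (simp add: d_def)
    qed
    then show ?thesis by (simp add: dist_norm)
  qed
  then obtain p where p: "\<And>n. p n \<in> V" "\<And>n. norm (x - p n) < d + 1 / Suc n"
    by metis
  \<comment> \<open>Parallelogram law: the midpoint of \<open>p m\<close> and \<open>p n\<close>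
    lies in V, hence at distance at least d from x.\<close>
  have par: "(norm (p m - p n))\<^sup>2 \<le> 2 * (norm (x - p m))\<^sup>2 + 2 * (norm (x - p n))\<^sup>2 - 4 * d\<^sup>2" for m n
  proof -
    have "(1/2) *\<^sub>R (p m + p n) \<in> V"
      using V p by simp
    then have "d\<^sup>2 \<le> (norm (x - (1/2) *\<^sub>R (p m + p n)))\<^sup>2"
      using d d0 by (intro power_mono) auto
    then show ?thesis
      by (simp add: power2_norm_eq_inner inner_diff_left inner_diff_right inner_add_left
          inner_add_right inner_commute algebra_simps)
  qed
  have lim: "(\<lambda>n. 4 * ((d + 1 / Suc n)\<^sup>2 - d\<^sup>2)) \<longlonglongrightarrow> 4 * ((d + 0)\<^sup>2 - d\<^sup>2)"
    by (intro tendsto_intros LIMSEQ_inverse_real_of_nat[unfolded inverse_eq_divide])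
  have "Cauchy p"
  proof (rule metric_CauchyI)
    fix e :: real assume "0 < e"
    then have "eventually (\<lambda>n. 4 * ((d + 1 / Suc n)\<^sup>2 - d\<^sup>2) < e\<^sup>2) sequentially"
      using lim by (intro order_tendstoD) auto
    then obtain M where M: "\<And>n. M \<le> n \<Longrightarrow> 4 * ((d + 1 / Suc n)\<^sup>2 - d\<^sup>2) < e\<^sup>2"
      by (auto simp: eventually_sequentially)
    have "dist (p m) (p n) < e" if "M \<le> m" "M \<le> n" for m n
    proof -
      have *: "(norm (x - p k))\<^sup>2 \<le> (d + 1 / Suc k)\<^sup>2" for k
        using p(2)[of k] by (intro power_mono) auto
      have "(norm (p m - p n))\<^sup>2 < e\<^sup>2"
        using par[of m n] *[of m] *[of n] M[OF that(1)] M[OF that(2)] by argo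
      then show ?thesis
        using \<open>0 < e\<close> by (simp add: dist_norm power_less_imp_less_base)
    qed
    then show "\<exists>M. \<forall>m\<ge>M. \<forall>n\<ge>M. dist (p m) (p n) < e"
      by blast
  qed
  then obtain q where q: "p \<longlonglongrightarrow> q"
    using Cauchy_convergent_iff convergent_def by blast
  have qV: "q \<in> V"
    using closed_sequentially[OF V(1) _ q] p by blast
  have "(\<lambda>n. norm (x - p n)) \<longlonglongrightarrow> norm (x - q)"
    by (intro tendsto_intros q)
  moreover have "(\<lambda>n. d + 1 / Suc n) \<longlonglongrightarrow> d + 0"
    by (intro tendsto_intros LIMSEQ_inverse_real_of_nat[unfolded inverse_eq_divide])
  ultimately have "norm (x - q) \<le> d"
    using p(2) by (intro LIMSEQ_le[of _ _ "\<lambda>n. d + 1 / Suc n"]) (auto intro: less_imp_le exI[of _ 0])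
  then have nq: "norm (x - q) \<le> norm (x - v)" if "v \<in> V" for v
    using d[OF that] by simp
  have "inner (x - q) v = 0" if v: "v \<in> V" for v
  proof -
    \<comment> \<open>Minimality on the line through q in direction v; the constant term 0 lets the
      discriminant bound force the inner product to vanish.\<close>
    have "(inner (x - q) v)\<^sup>2 \<le> 0 * inner v v"
    proof (rule discriminant_le)
      fix t :: real
      have "q + t *\<^sub>R v \<in> V"
        using V qV v by simp
      then have "(norm (x - q))\<^sup>2 \<le> (norm (x - (q + t *\<^sub>R v)))\<^sup>2"
        using nq by (intro power_mono) auto
      also have "x - (q + t *\<^sub>R v) = (x - q) - t *\<^sub>R v"
        by simp
      also have "(norm ((x - q) - t *\<^sub>R v))\<^sup>2 = (norm (x - q))\<^sup>2 - 2 * t * inner (x - q) v + t\<^sup>2 * inner v v"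
        by (simp only: power2_norm_eq_inner inner_diff_left[of "x - q"] inner_diff_right[of _ "x - q"]
            inner_scaleR_left inner_scaleR_right) (simp add: inner_commute power2_eq_square algebra_simps)
      finally show "0 \<le> 0 - 2 * t * inner (x - q) v + t\<^sup>2 * inner v v"
        by simp
    qed simp
    then show ?thesis by simp
  qed
  then show ?thesis
    using qV by blast
qed

lemma Riesz_representation:
  fixes f :: "'a::{real_inner, complete_space} \<Rightarrow> real"
  assumes "bounded_linear f"
  shows "\<exists>z. \<forall>x. f x = inner x z"
proof (cases "\<forall>x. f x = 0")
  case True
  then show ?thesis by (intro exI[of _ 0]) simp
next
  case False
  interpret f: bounded_linear f by fact
  obtain x where x: "f x \<noteq> 0" using False by blast
  define V where "V = {x. f x = 0}"
  have "closed V"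
    unfolding V_def by (intro closed_Collect_eq f.continuous_on continuous_on_id continuous_on_const)
  then obtain p where p: "p \<in> V" "\<forall>v\<in>V. inner (x - p) v = 0"
    using orthogonal_projection[of V x] by (auto simp: V_def f.zero f.add f.scaleR)
  define u where "u = x - p"
  have fu: "f u \<noteq> 0"
    using x p by (simp add: u_def V_def f.diff)
  then have u0: "u \<noteq> 0"
    using f.zero by auto
  have "f y = inner y ((f u / inner u u) *\<^sub>R u)" for y
  proof -
    have "y - (f y / f u) *\<^sub>R u \<in> V"
      using fu by (simp add: V_def f.diff f.scaleR)
    then have "inner u y = (f y / f u) * inner u u"
      using p(2) unfolding u_def[symmetric] by (auto simp: inner_diff_right)
    then show ?thesis
      using fu u0 by (simp add: inner_commute)
  qed
  then show ?thesis by blast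
qed

section \<open>Square-summable sequences of vectors as a Hilbert space\<close>

lemma summable_norm_mult:
  fixes f g :: "nat \<Rightarrow> 'h::real_normed_vector"
  assumes "summable (\<lambda>n. (norm (f n))\<^sup>2)" "summable (\<lambda>n. (norm (g n))\<^sup>2)"
  shows "summable (\<lambda>n. norm (f n) * norm (g n))"
proof (rule summable_comparison_test_ev)
  show "summable (\<lambda>n. (norm (f n))\<^sup>2 + (norm (g n))\<^sup>2)"
    using assms by (rule summable_add)
  have "norm (f n) * norm (g n) \<le> (norm (f n))\<^sup>2 + (norm (g n))\<^sup>2" for n
    using sum_squares_bound[of "norm (f n)" "norm (g n)"]
      mult_nonneg_nonneg[OF norm_ge_zero[of "f n"] norm_ge_zero[of "g n"]]
    unfolding mult.assoc by linarith
  then show "\<forall>\<^sub>F n in sequentially. norm (norm (f n) * norm (g n)) \<le> (norm (f n))\<^sup>2 + (norm (g n))\<^sup>2"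
    by (simp add: abs_mult)
qed

lemma summable_norm_add_sq:
  fixes f g :: "nat \<Rightarrow> 'h::real_normed_vector"
  assumes "summable (\<lambda>n. (norm (f n))\<^sup>2)" "summable (\<lambda>n. (norm (g n))\<^sup>2)"
  shows "summable (\<lambda>n. (norm (f n + g n))\<^sup>2)"
proof (rule summable_comparison_test_ev)
  show "summable (\<lambda>n. (norm (f n))\<^sup>2 + 2 * (norm (f n) * norm (g n)) + (norm (g n))\<^sup>2)"
    using assms by (intro summable_add summable_mult summable_norm_mult)
  have "(norm (f n + g n))\<^sup>2 \<le> (norm (f n) + norm (g n))\<^sup>2" for n
    by (intro power_mono norm_triangle_ineq) auto
  then have "(norm (f n + g n))\<^sup>2 \<le> (norm (f n))\<^sup>2 + 2 * (norm (f n) * norm (g n)) + (norm (g n))\<^sup>2" for n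
    unfolding power2_sum by (simp add: mult.assoc add_ac)
  then show "\<forall>\<^sub>F n in sequentially. norm ((norm (f n + g n))\<^sup>2) 
      \<le> (norm (f n))\<^sup>2 + 2 * (norm (f n) * norm (g n)) + (norm (g n))\<^sup>2"
    by simp
qed

text \<open>Strong neighbourhoods test finitely many vectors, ultraweakly continuous functionals
  test square-summable sequences. The passage from the former to the latter takes place in this
  space.\<close>

typedef (overloaded) ('h::complex_hilbert_space) ell2 = "{f :: nat \<Rightarrow> 'h. summable (\<lambda>n. (norm (f n))\<^sup>2)}"
  morphisms coord Abs_ell2
  by (rule exI[of _ "\<lambda>_. 0"]) simp

setup_lifting type_definition_ell2

lemma summable_coord: "summable (\<lambda>n. (norm (coord x n))\<^sup>2)"
  using coord[of x] by simp

lemma ell2_eqI: "(\<And>n. coord x n = coord y n) \<Longrightarrow> x = y"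
  by (simp add: coord_inject[symmetric] fun_eq_iff)

lemma summable_rip: "summable (\<lambda>n. rip (coord x n) (coord y n))"
  by (rule summable_comparison_test_ev[OF _ summable_norm_mult[OF summable_coord[of x] summable_coord[of y]]])
    (simp add: abs_rip_le)

instantiation ell2 :: (complex_hilbert_space) real_vector
begin

lift_definition zero_ell2 :: "'a ell2" is "\<lambda>_. 0" by simp
lift_definition plus_ell2 :: "'a ell2 \<Rightarrow> 'a ell2 \<Rightarrow> 'a ell2" is "\<lambda>f g n. f n + g n"
  by (rule summable_norm_add_sq)
lift_definition uminus_ell2 :: "'a ell2 \<Rightarrow> 'a ell2" is "\<lambda>f n. - f n" by simp
lift_definition minus_ell2 :: "'a ell2 \<Rightarrow> 'a ell2 \<Rightarrow> 'a ell2" is "\<lambda>f g n. f n - g n"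
  subgoal for f g
    using summable_norm_add_sq[of f "\<lambda>n. - g n"] by simp
  done
lift_definition scaleR_ell2 :: "real \<Rightarrow> 'a ell2 \<Rightarrow> 'a ell2" is "\<lambda>r f n. r *\<^sub>R f n"
  by (simp add: power_mult_distrib summable_mult)

instance
  by standard (transfer; simp add: algebra_simps)+

end

instantiation ell2 :: (complex_hilbert_space) real_inner
begin

definition inner_ell2 :: "'a ell2 \<Rightarrow> 'a ell2 \<Rightarrow> real" where
  "inner_ell2 x y = (\<Sum>n. rip (coord x n) (coord y n))"
definition norm_ell2 :: "'a ell2 \<Rightarrow> real" where "norm_ell2 x = sqrt (inner x x)"
definition sgn_ell2 :: "'a ell2 \<Rightarrow> 'a ell2" where "sgn_ell2 x = x /\<^sub>R norm x"
definition dist_ell2 :: "'a ell2 \<Rightarrow> 'a ell2 \<Rightarrow> real" where "dist_ell2 x y = norm (x - y)"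
definition uniformity_ell2 :: "('a ell2 \<times> 'a ell2) filter" where
  "uniformity_ell2 = (INF e\<in>{0<..}. principal {(x, y). dist x y < e})"
definition open_ell2 :: "'a ell2 set \<Rightarrow> bool" where
  "open_ell2 U = (\<forall>x\<in>U. eventually (\<lambda>(x', y). x' = x \<longrightarrow> y \<in> U) uniformity)"

instance
proof
  fix x y z :: "'a ell2" and r :: real
  show "inner x y = inner y x"
    by (simp add: inner_ell2_def rip_commute)
  show "inner (x + y) z = inner x z + inner y z"
    unfolding inner_ell2_def using suminf_add[OF summable_rip[of x z] summable_rip[of y z]]
    by (simp add: plus_ell2.rep_eq rip_add_left)
  show "inner (r *\<^sub>R x) y = r * inner x y"
    unfolding inner_ell2_def using suminf_mult[OF summable_rip[of x y], of r]
    by (simp add: scaleR_ell2.rep_eq rip_scaleR_left)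
  show "0 \<le> inner x x"
    unfolding inner_ell2_def by (simp add: rip_self suminf_nonneg summable_coord)
  show "inner x x = 0 \<longleftrightarrow> x = 0"
    unfolding inner_ell2_def
    by (simp add: rip_self suminf_eq_zero_iff summable_coord)
      (metis ell2_eqI zero_ell2.rep_eq)
qed (simp_all add: norm_ell2_def sgn_ell2_def dist_ell2_def uniformity_ell2_def open_ell2_def)

end

lemma norm_ell2_sq: "(norm x)\<^sup>2 = (\<Sum>n. (norm (coord x n))\<^sup>2)" for x :: "'h::complex_hilbert_space ell2"
  by (simp add: power2_norm_eq_inner inner_ell2_def rip_self)

lemma norm_coord_le: "norm (coord x n) \<le> norm x" for x :: "'h::complex_hilbert_space ell2"
proof (rule power2_le_imp_le)
  show "(norm (coord x n))\<^sup>2 \<le> (norm x)\<^sup>2"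
    unfolding norm_ell2_sq using sum_le_suminf[OF summable_coord, of "{n}" x] by simp
qed simp

lemma bounded_linear_coord: "bounded_linear (\<lambda>x. coord x n)"
  by (rule bounded_linear_intro[where K = 1])
    (simp_all add: plus_ell2.rep_eq scaleR_ell2.rep_eq norm_coord_le)

text \<open>Coordinates converge by completeness of \<open>'h\<close>. The Cauchy estimate is taken
  on the first N coordinates, where it survives the limit, and its bound does not depend on
  N.\<close>

instance ell2 :: (complex_hilbert_space) complete_space
proof
  fix X :: "nat \<Rightarrow> 'a ell2" assume X: "Cauchy X"
  have "Cauchy (\<lambda>m. coord (X m) n)" for n
    using bounded_linear.Cauchy[OF bounded_linear_coord X] .
  then have "\<exists>l. (\<lambda>m. coord (X m) n) \<longlonglongrightarrow> l" for n
    by (simp add: Cauchy_convergent_iff convergent_def)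
  then obtain g where g: "\<And>n. (\<lambda>m. coord (X m) n) \<longlonglongrightarrow> g n"
    by metis
  have tail: "\<exists>M. \<forall>m\<ge>M. \<forall>N. (\<Sum>n<N. (norm (coord (X m) n - g n))\<^sup>2) \<le> e\<^sup>2" if "0 < e" for e
  proof -
    obtain M where M: "\<And>m k. M \<le> m \<Longrightarrow> M \<le> k \<Longrightarrow> dist (X m) (X k) < e"
      using metric_CauchyD[OF X \<open>0 < e\<close>] by metis
    have "(\<Sum>n<N. (norm (coord (X m) n - g n))\<^sup>2) \<le> e\<^sup>2" if "M \<le> m" for m N
    proof (rule LIMSEQ_le_const2)
      show "(\<lambda>k. \<Sum>n<N. (norm (coord (X m) n - coord (X k) n))\<^sup>2) \<longlonglongrightarrow> (\<Sum>n<N. (norm (coord (X m) n - g n))\<^sup>2)"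
        by (intro tendsto_intros g)
      have "(\<Sum>n<N. (norm (coord (X m) n - coord (X k) n))\<^sup>2) \<le> e\<^sup>2" if "M \<le> k" for k
      proof -
        have "(\<Sum>n<N. (norm (coord (X m - X k) n))\<^sup>2) \<le> (norm (X m - X k))\<^sup>2"
          unfolding norm_ell2_sq by (intro sum_le_suminf summable_coord) auto
        also have "\<dots> \<le> e\<^sup>2"
          using M[OF \<open>M \<le> m\<close> that] by (intro power_mono) (auto simp: dist_norm)
        finally show ?thesis by (simp add: minus_ell2.rep_eq)
      qed
      then show "\<exists>K. \<forall>k\<ge>K. (\<Sum>n<N. (norm (coord (X m) n - coord (X k) n))\<^sup>2) \<le> e\<^sup>2"
        by blast
    qed
    then show ?thesis by blast
  qed
  have summ: "summable (\<lambda>n. (norm (coord (X m) n - g n))\<^sup>2)"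
    if "\<forall>N. (\<Sum>n<N. (norm (coord (X m) n - g n))\<^sup>2) \<le> e" for m e
    using that by (intro summableI_nonneg_bounded[where x = e]) auto
  obtain M where M: "\<forall>N. (\<Sum>n<N. (norm (coord (X M) n - g n))\<^sup>2) \<le> 1\<^sup>2"
    using tail[of 1] by auto
  \<comment> \<open>Square summability of g, written as \<open>X M\<close> minus a square-summable
    difference.\<close>
  have "summable (\<lambda>n. (norm (coord (X M) n + (- (coord (X M) n - g n))))\<^sup>2)"
    using summ[OF M] by (intro summable_norm_add_sq summable_coord) (simp add: norm_minus_commute)
  then have "summable (\<lambda>n. (norm (g n))\<^sup>2)"
    by simp
  then have cg: "coord (Abs_ell2 g) = g"
    by (simp add: Abs_ell2_inverse)
  have "X \<longlonglongrightarrow> Abs_ell2 g"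
  proof (rule metric_LIMSEQ_I)
    fix r :: real assume "0 < r"
    then obtain M where M: "\<And>m N. M \<le> m \<Longrightarrow> (\<Sum>n<N. (norm (coord (X m) n - g n))\<^sup>2) \<le> (r/2)\<^sup>2"
      using tail[of "r/2"] by auto
    have "dist (X m) (Abs_ell2 g) < r" if "M \<le> m" for m
    proof -
      have "(norm (X m - Abs_ell2 g))\<^sup>2 \<le> (r/2)\<^sup>2"
        unfolding norm_ell2_sq minus_ell2.rep_eq cg using M[OF that] summ[of m "(r/2)\<^sup>2"]
        by (intro suminf_le_const) auto
      then have "norm (X m - Abs_ell2 g) \<le> r/2"
        by (rule power2_le_imp_le) (use \<open>0 < r\<close> in simp)
      then show ?thesis
        using \<open>0 < r\<close> by (simp add: dist_norm)
    qed
    then show "\<exists>M. \<forall>m\<ge>M. dist (X m) (Abs_ell2 g) < r"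
      by blast
  qed
  then show "convergent X"
    by (rule convergentI)
qed

lift_definition single :: "nat \<Rightarrow> 'h::complex_hilbert_space \<Rightarrow> 'h ell2" is "\<lambda>j h n. if n = j then h else 0"
proof -
  fix j :: nat and h :: 'h
  have "summable (\<lambda>n. if n = j then (norm h)\<^sup>2 else 0)"
    using sums_single[of j "\<lambda>_. (norm h)\<^sup>2"] by (simp add: sums_iff)
  then show "summable (\<lambda>n. (norm (if n = j then h else 0))\<^sup>2)"
    by (rule summable_cong[THEN iffD1, rotated]) auto
qed

lemma inner_single: "inner (single j h) x = rip h (coord x j)"
proof -
  have "(\<lambda>n. rip (coord (single j h) n) (coord x n)) = (\<lambda>n. if n = j then rip h (coord x j) else 0)"
    by (rule ext) (simp add: single.rep_eq rip_zero_left)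
  then show ?thesis
    using sums_single[of j "\<lambda>_. rip h (coord x j)"] by (simp add: inner_ell2_def sums_iff)
qed

text \<open>The class of \<open>'h\<close> provides no \<open>inner\<close>, but \<open>'h\<close>
  sits in \<open>'h ell2\<close> as the coordinate 0, and there the representation theorem
  applies.\<close>

lemma Riesz_complex_hilbert_space:
  fixes f :: "'h::complex_hilbert_space \<Rightarrow> real"
  assumes "bounded_linear f"
  shows "\<exists>z. \<forall>x. f x = rip x z"
proof -
  have "bounded_linear (\<lambda>x. f (coord x 0))"
    by (rule bounded_linear_compose[OF assms bounded_linear_coord])
  then obtain z where z: "\<And>x. f (coord x 0) = inner x z"
    using Riesz_representation by blast
  have "f x = rip x (coord z 0)" for x
    using z[of "single 0 x"] by (simp add: inner_single single.rep_eq)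
  then show ?thesis by blast
qed

section \<open>Adjoints of complex-linear operators\<close>

lemma op_adjoint_eqI:
  assumes "\<And>x y. cinner (blinfun_apply T x) y = cinner x (blinfun_apply S y)"
  shows "op_adjoint T = S"
  unfolding op_adjoint_def
proof (rule the_equality)
  fix S' assume "\<forall>x y. cinner (blinfun_apply T x) y = cinner x (blinfun_apply S' y)"
  then show "S' = S"
    using assms by (intro blinfun_eqI cinner_eqI) metis
qed (use assms in blast)

text \<open>Riesz representation settles the real part of the inner product. The imaginary parts
  then agree because T commutes with multiplication by \<open>- \<i>\<close>.\<close>

lemma ex_adjoint:
  fixes T :: "'h::complex_hilbert_space \<Rightarrow>\<^sub>L 'h"
  assumes T: "complex_linear T"
  shows "\<exists>S. \<forall>x y. cinner (blinfun_apply T x) y = cinner x (blinfun_apply S y)"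
proof -
  have "bounded_linear (\<lambda>x. rip (blinfun_apply T x) y)" for y
    by (rule bounded_linear_compose[OF bounded_linear_rip_left blinfun.bounded_linear_right])
  then have "\<exists>z. \<forall>x. rip (blinfun_apply T x) y = rip x z" for y
    by (rule Riesz_complex_hilbert_space)
  then obtain s where s: "\<And>x y. rip (blinfun_apply T x) y = rip x (s y)"
    by metis
  have "bounded_linear s"
  proof (rule bounded_linear_intro[where K = "norm T"])
    show "s (x + y) = s x + s y" for x y
      by (rule rip_eqI) (simp add: s[symmetric] rip_add_right)
    show "s (r *\<^sub>R x) = r *\<^sub>R s x" for r x
      by (rule rip_eqI) (simp add: s[symmetric] rip_scaleR_right)
    show "norm (s x) \<le> norm x * norm T" for x
    proof -
      have "norm (s x) * norm (s x) = rip (blinfun_apply T (s x)) x"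
        by (simp add: s rip_self power2_eq_square)
      also have "\<dots> \<le> norm (blinfun_apply T (s x)) * norm x"
        by (rule rip_le)
      also have "\<dots> \<le> (norm T * norm (s x)) * norm x"
        by (intro mult_right_mono norm_blinfun) auto
      finally have "norm (s x) * norm (s x) \<le> norm (s x) * (norm x * norm T)"
        by (simp add: mult_ac)
      then show ?thesis
        by (cases "norm (s x) = 0") auto
    qed
  qed
  then have S: "blinfun_apply (Blinfun s) = s"
    by (rule bounded_linear_Blinfun_apply)
  have "cinner (blinfun_apply T x) y = cinner x (s y)" for x y
  proof (rule complex_eqI)
    show "Re (cinner (blinfun_apply T x) y) = Re (cinner x (s y))"
      using s by (simp add: rip_def)
    have "(- \<i>) *\<^sub>C blinfun_apply T x = blinfun_apply T ((- \<i>) *\<^sub>C x)"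
      using T by (simp add: complex_linear_def)
    then show "Im (cinner (blinfun_apply T x) y) = Im (cinner x (s y))"
      unfolding Im_cinner by (simp add: s)
  qed
  then show ?thesis
    by (intro exI[of _ "Blinfun s"]) (simp add: S)
qed

lemma cinner_op_adjoint:
  assumes "complex_linear T"
  shows "cinner (blinfun_apply T x) y = cinner x (blinfun_apply (op_adjoint T) y)"
  using ex_adjoint[OF assms] op_adjoint_eqI by metis

lemma complex_linear_op_adjoint:
  assumes "complex_linear T"
  shows "complex_linear (op_adjoint T)"
  unfolding complex_linear_def
proof (intro allI cinner_eqI)
  fix c y x
  show "cinner x (blinfun_apply (op_adjoint T) (c *\<^sub>C y)) = cinner x (c *\<^sub>C blinfun_apply (op_adjoint T) y)"
    unfolding cinner_op_adjoint[OF assms, symmetric] cinner_scaleC_right ..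
qed

lemma op_scaleC_apply: "blinfun_apply (op_scaleC c T) x = c *\<^sub>C blinfun_apply T x"
  by (simp add: op_scaleC.rep_eq)

section \<open>Amplification and the double commutant argument\<close>

lift_definition amp :: "('h::complex_hilbert_space \<Rightarrow>\<^sub>L 'h) \<Rightarrow> 'h ell2 \<Rightarrow> 'h ell2"
  is "\<lambda>T f n. blinfun_apply T (f n)"
proof -
  fix T :: "'h \<Rightarrow>\<^sub>L 'h" and f :: "nat \<Rightarrow> 'h"
  assume f: "summable (\<lambda>n. (norm (f n))\<^sup>2)"
  show "summable (\<lambda>n. (norm (blinfun_apply T (f n)))\<^sup>2)"
  proof (rule summable_comparison_test_ev)
    show "summable (\<lambda>n. (norm T)\<^sup>2 * (norm (f n))\<^sup>2)"
      using f by (rule summable_mult)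
    have "(norm (blinfun_apply T (f n)))\<^sup>2 \<le> (norm T * norm (f n))\<^sup>2" for n
      by (intro power_mono norm_blinfun) auto
    then show "\<forall>\<^sub>F n in sequentially. norm ((norm (blinfun_apply T (f n)))\<^sup>2) \<le> (norm T)\<^sup>2 * (norm (f n))\<^sup>2"
      by (simp add: power_mult_distrib)
  qed
qed

lemma norm_amp_le: "norm (amp T x) \<le> norm x * norm T"
proof (rule power2_le_imp_le)
  have "(norm (blinfun_apply T (coord x n)))\<^sup>2 \<le> (norm T)\<^sup>2 * (norm (coord x n))\<^sup>2" for n
    unfolding power_mult_distrib[symmetric] by (intro power_mono norm_blinfun) auto
  then have "(norm (amp T x))\<^sup>2 \<le> (\<Sum>n. (norm T)\<^sup>2 * (norm (coord x n))\<^sup>2)"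
    unfolding norm_ell2_sq amp.rep_eq
    by (intro suminf_le summable_mult summable_coord summable_coord[of "amp T x", unfolded amp.rep_eq])
  also have "\<dots> = (norm x * norm T)\<^sup>2"
    by (simp add: suminf_mult[OF summable_coord] norm_ell2_sq power_mult_distrib mult.commute)
  finally show "(norm (amp T x))\<^sup>2 \<le> (norm x * norm T)\<^sup>2" .
qed simp

lemma bounded_linear_amp: "bounded_linear (amp T)"
  by (rule bounded_linear_intro[where K = "norm T"])
    (auto intro!: ell2_eqI norm_amp_le simp: amp.rep_eq plus_ell2.rep_eq scaleR_ell2.rep_eq
      blinfun.add_right blinfun.scaleR_right)

lemma coord_zero: "coord 0 n = 0"
  by (simp add: zero_ell2.rep_eq)

lemma coord_sum: "coord (\<Sum>j\<in>J. f j) n = (\<Sum>j\<in>J. coord (f j) n)"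
  by (induction J rule: infinite_finite_induct) (auto simp: coord_zero plus_ell2.rep_eq)

lemma ell2_tendsto_partial: "(\<lambda>N. \<Sum>j<N. single j (coord x j)) \<longlonglongrightarrow> x"
proof -
  have c: "coord (\<Sum>j<N. single j (coord x j)) n = (if n < N then coord x n else 0)" for N n
    by (simp add: coord_sum single.rep_eq sum.delta')
  have "(norm ((\<Sum>j<N. single j (coord x j)) - x))\<^sup>2 = (\<Sum>n. (norm (coord x (n + N)))\<^sup>2)" for N
  proof -
    have s: "summable (\<lambda>n. (norm (coord ((\<Sum>j<N. single j (coord x j)) - x) n))\<^sup>2)"
      by (rule summable_coord)
    have "(norm ((\<Sum>j<N. single j (coord x j)) - x))\<^sup>2 =
        (\<Sum>n. (norm (coord ((\<Sum>j<N. single j (coord x j)) - x) (n + N)))\<^sup>2) +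
        (\<Sum>n<N. (norm (coord ((\<Sum>j<N. single j (coord x j)) - x) n))\<^sup>2)"
      unfolding norm_ell2_sq by (rule suminf_split_initial_segment[OF s])
    then show ?thesis
      by (simp add: minus_ell2.rep_eq c)
  qed
  moreover have "(\<lambda>N. \<Sum>n. (norm (coord x (n + N)))\<^sup>2) \<longlonglongrightarrow> 0"
    by (rule LIMSEQ_I) (use suminf_exist_split[OF _ summable_coord[of x]] in simp)
  ultimately have "(\<lambda>N. (norm ((\<Sum>j<N. single j (coord x j)) - x))\<^sup>2) \<longlonglongrightarrow> 0"
    by simp
  then have "(\<lambda>N. sqrt ((norm ((\<Sum>j<N. single j (coord x j)) - x))\<^sup>2)) \<longlonglongrightarrow> sqrt 0"
    by (rule tendsto_real_sqrt)
  then have "(\<lambda>N. norm ((\<Sum>j<N. single j (coord x j)) - x)) \<longlonglongrightarrow> 0"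
    by simp
  then show ?thesis
    using LIM_zero_iff tendsto_norm_zero_iff by blast
qed

text \<open>The projection P onto the closure V of the orbit of \<xi> commutes with the
  amplification of N, because V is invariant and N has adjoints. The matrix entries of P therefore
  commute with N, hence with the strong limit T, and so P commutes with the amplification of T.
  Since P fixes \<xi>, the amplification of T maps \<xi> into V.\<close>

lemma approximate_amplification:
  fixes N :: "('h::complex_hilbert_space \<Rightarrow>\<^sub>L 'h) set"
  assumes one: "id_blinfun \<in> N"
    and add: "\<And>S S'. S \<in> N \<Longrightarrow> S' \<in> N \<Longrightarrow> S + S' \<in> N"
    and scale: "\<And>r S. S \<in> N \<Longrightarrow> r *\<^sub>R S \<in> N"
    and comp: "\<And>S S'. S \<in> N \<Longrightarrow> S' \<in> N \<Longrightarrow> S o\<^sub>L S' \<in> N"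
    and adj: "\<And>S. S \<in> N \<Longrightarrow> \<exists>S'\<in>N. \<forall>x y. rip (blinfun_apply S x) y = rip x (blinfun_apply S' y)"
    and T: "\<And>x y e. 0 < e \<Longrightarrow> \<exists>S\<in>N. norm (blinfun_apply S x - blinfun_apply T x) < e \<and>
        norm (blinfun_apply S y - blinfun_apply T y) < e"
    and e: "0 < e"
  shows "\<exists>S\<in>N. norm (amp S \<xi> - amp T \<xi>) < e"
proof -
  define V where "V = closure ((\<lambda>S. amp S \<xi>) ` N)"
  have amp_add: "amp (S + S') x = amp S x + amp S' x" for S S' x
    by (rule ell2_eqI) (simp add: amp.rep_eq plus_ell2.rep_eq blinfun.add_left)
  have amp_scale: "amp (r *\<^sub>R S) x = r *\<^sub>R amp S x" for r S x
    by (rule ell2_eqI) (simp add: amp.rep_eq scaleR_ell2.rep_eq blinfun.scaleR_left)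
  have amp_comp: "amp (S o\<^sub>L S') x = amp S (amp S' x)" for S S' x
    by (rule ell2_eqI) (simp add: amp.rep_eq)
  have V0: "0 \<in> V"
  proof -
    have "amp (0 *\<^sub>R id_blinfun) \<xi> \<in> V"
      unfolding V_def by (intro subsetD[OF closure_subset] imageI scale one)
    then show ?thesis
      by (simp only: amp_scale) simp
  qed
  have Vadd: "v + w \<in> V" if vw: "v \<in> V" "w \<in> V" for v w
  proof -
    obtain a where a: "\<And>n. a n \<in> (\<lambda>S. amp S \<xi>) ` N" "a \<longlonglongrightarrow> v"
      using vw unfolding V_def closure_sequential by blast
    obtain b where b: "\<And>n. b n \<in> (\<lambda>S. amp S \<xi>) ` N" "b \<longlonglongrightarrow> w"
      using vw unfolding V_def closure_sequential by blast
    have "a n + b n \<in> (\<lambda>S. amp S \<xi>) ` N" for n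
      using a(1)[of n] b(1)[of n] add by (auto simp: amp_add[symmetric])
    then show ?thesis
      unfolding V_def closure_sequential using tendsto_add[OF a(2) b(2)]
      by (intro exI[of _ "\<lambda>n. a n + b n"]) simp
  qed
  have Vscale: "r *\<^sub>R v \<in> V" if v: "v \<in> V" for r v
  proof -
    obtain a where a: "\<And>n. a n \<in> (\<lambda>S. amp S \<xi>) ` N" "a \<longlonglongrightarrow> v"
      using v unfolding V_def closure_sequential by blast
    have "r *\<^sub>R a n \<in> (\<lambda>S. amp S \<xi>) ` N" for n
      using a(1)[of n] scale by (auto simp: amp_scale[symmetric])
    then show ?thesis
      unfolding V_def closure_sequential using tendsto_scaleR[OF tendsto_const a(2)]
      by (intro exI[of _ "\<lambda>n. r *\<^sub>R a n"]) simp
  qed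
  have Vamp: "amp S v \<in> V" if v: "v \<in> V" and S: "S \<in> N" for S v
  proof -
    obtain a where a: "\<And>n. a n \<in> (\<lambda>S. amp S \<xi>) ` N" "a \<longlonglongrightarrow> v"
      using v unfolding V_def closure_sequential by blast
    have "amp S (a n) \<in> (\<lambda>S. amp S \<xi>) ` N" for n
      using a(1)[of n] comp[OF S] by (auto simp: amp_comp[symmetric])
    then show ?thesis
      unfolding V_def closure_sequential
      using bounded_linear.tendsto[OF bounded_linear_amp a(2), of S]
      by (intro exI[of _ "\<lambda>n. amp S (a n)"]) simp
  qed
  have "\<exists>p\<in>V. \<forall>v\<in>V. inner (x - p) v = 0" for x
    using V0 Vadd Vscale by (intro orthogonal_projection) (auto simp: V_def)
  then obtain P where P: "\<And>x. P x \<in> V" "\<And>x v. v \<in> V \<Longrightarrow> inner (x - P x) v = 0"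
    by metis
  \<comment> \<open>This characterization of projections yields linearity of P, its commutation with
    N, and that it fixes \<xi>.\<close>
  have Punique: "P x = p" if "p \<in> V" "\<And>v. v \<in> V \<Longrightarrow> inner (x - p) v = 0" for x p
  proof -
    have d: "P x + (- 1) *\<^sub>R p \<in> V"
      by (intro Vadd Vscale P that)
    have "inner (P x - p) (P x - p) = inner (x - p) (P x - p) - inner (x - P x) (P x - p)"
      by (simp add: inner_diff_left)
    also have "\<dots> = 0"
      using d P(2) that(2) by simp
    finally show ?thesis by simp
  qed
  have P_add: "P (x + y) = P x + P y" for x y
    by (rule Punique) (use P(2)[of _ x] P(2)[of _ y] in \<open>auto intro!: Vadd P(1) simp: inner_add_left inner_diff_left\<close>)
  have P_scale: "P (r *\<^sub>R x) = r *\<^sub>R P x" for r x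
    by (rule Punique) (use P(2)[of _ x] in \<open>auto intro!: Vscale P(1) simp: inner_diff_left\<close>)
  have "norm (P x) \<le> norm x" for x
  proof (rule power2_le_imp_le)
    have "(norm x)\<^sup>2 = (norm (x - P x))\<^sup>2 + 2 * inner (x - P x) (P x) + (norm (P x))\<^sup>2"
      by (simp add: power2_norm_eq_inner inner_diff_left inner_diff_right inner_commute)
    then show "(norm (P x))\<^sup>2 \<le> (norm x)\<^sup>2"
      using P(2)[OF P(1)[of x], of x] by simp
  qed simp
  then have blP: "bounded_linear P"
    by (intro bounded_linear_intro[where K = 1] P_add P_scale) simp
  \<comment> \<open>Invariance of V under the adjoint S' makes the orthogonal complement of V
    invariant under S.\<close>
  have P_amp: "P (amp S x) = amp S (P x)" if S: "S \<in> N" for S x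
  proof (rule Punique)
    show "amp S (P x) \<in> V"
      by (intro Vamp P S)
    fix v assume v: "v \<in> V"
    obtain S' where S': "S' \<in> N" "\<forall>x y. rip (blinfun_apply S x) y = rip x (blinfun_apply S' y)"
      using adj[OF S] by blast
    have "inner (amp S u) v = inner u (amp S' v)" for u
      by (simp add: inner_ell2_def amp.rep_eq S'(2))
    then have "inner (amp S x - amp S (P x)) v = inner (x - P x) (amp S' v)"
      by (simp add: inner_diff_left)
    then show "inner (amp S x - amp S (P x)) v = 0"
      using P(2) Vamp[OF v S'(1)] by simp
  qed
  have amp_single: "amp S (single j h) = single j (blinfun_apply S h)" for S j h
    by (rule ell2_eqI) (simp add: amp.rep_eq single.rep_eq)
  \<comment> \<open>The entry of P in row i and column j is a map on \<open>'h\<close> that commutes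
    with N. To pass to T, one S must approximate T both at h and at its image z, which is why the
    hypothesis on T has two vectors.\<close>
  have PT_single: "P (amp T (single j h)) = amp T (P (single j h))" for j h
  proof (rule ell2_eqI)
    fix i
    define z where "z = coord (P (single j h)) i"
    have norm_single: "norm (single j k) \<le> norm k" for k :: 'h
    proof -
      have "(norm (single j k))\<^sup>2 = (norm k)\<^sup>2"
        by (simp add: power2_norm_eq_inner inner_single single.rep_eq rip_self)
      then show ?thesis
        by simp
    qed
    have "norm (coord (P (single j (blinfun_apply T h))) i - blinfun_apply T z) \<le> 0 + d" if d: "0 < d" for d
    proof -
      obtain S where S: "S \<in> N" "norm (blinfun_apply S h - blinfun_apply T h) < d/2"
          "norm (blinfun_apply S z - blinfun_apply T z) < d/2"
        using T[of "d/2" h z] d by auto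
      have "coord (P (single j (blinfun_apply S h))) i = blinfun_apply S z"
        using P_amp[OF S(1), of "single j h"] by (simp add: amp_single amp.rep_eq z_def)
      then have "coord (P (single j (blinfun_apply T h))) i - blinfun_apply T z
         = coord (P (single j (blinfun_apply T h)) - P (single j (blinfun_apply S h))) i
           + (blinfun_apply S z - blinfun_apply T z)"
        by (simp add: minus_ell2.rep_eq)
      also have "norm \<dots> \<le> norm (coord (P (single j (blinfun_apply T h)) - P (single j (blinfun_apply S h))) i)
          + norm (blinfun_apply S z - blinfun_apply T z)"
        by (rule norm_triangle_ineq)
      also have "norm (coord (P (single j (blinfun_apply T h)) - P (single j (blinfun_apply S h))) i)
          \<le> norm (P (single j (blinfun_apply T h)) - P (single j (blinfun_apply S h)))"
        by (rule norm_coord_le)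
      also have "P (single j (blinfun_apply T h)) - P (single j (blinfun_apply S h))
          = P (single j (blinfun_apply T h - blinfun_apply S h))"
      proof -
        have "single j (blinfun_apply T h - blinfun_apply S h)
            = single j (blinfun_apply T h) - single j (blinfun_apply S h)"
          by (rule ell2_eqI) (simp add: single.rep_eq minus_ell2.rep_eq)
        then show ?thesis
          using linear_diff[OF bounded_linear.linear[OF blP]] by simp
      qed
      also have "norm \<dots> \<le> norm (blinfun_apply T h - blinfun_apply S h)"
        using \<open>\<And>x. norm (P x) \<le> norm x\<close> norm_single order_trans by blast
      also have "\<dots> < d/2"
        using S by (simp add: norm_minus_commute)
      finally show ?thesis
        using S by simp
    qed
    then have "norm (coord (P (single j (blinfun_apply T h))) i - blinfun_apply T z) \<le> 0"
      by (rule field_le_epsilon)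
    then show "coord (P (amp T (single j h))) i = coord (amp T (P (single j h))) i"
      by (simp add: amp_single amp.rep_eq z_def)
  qed
  have "P (amp T x) = amp T (P x)" for x
  proof -
    have "(\<lambda>N. P (amp T (\<Sum>j<N. single j (coord x j)))) \<longlonglongrightarrow> P (amp T x)"
      by (intro bounded_linear.tendsto[OF blP] bounded_linear.tendsto[OF bounded_linear_amp] ell2_tendsto_partial)
    moreover have "(\<lambda>N. amp T (P (\<Sum>j<N. single j (coord x j)))) \<longlonglongrightarrow> amp T (P x)"
      by (intro bounded_linear.tendsto[OF blP] bounded_linear.tendsto[OF bounded_linear_amp] ell2_tendsto_partial)
    moreover have "P (amp T (\<Sum>j<N. single j (coord x j))) = amp T (P (\<Sum>j<N. single j (coord x j)))" for N
      by (simp add: linear_sum[OF bounded_linear.linear[OF blP]]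
          linear_sum[OF bounded_linear.linear[OF bounded_linear_amp]] PT_single)
    ultimately show ?thesis
      using LIMSEQ_unique by simp
  qed
  moreover have "P \<xi> = \<xi>"
  proof (rule Punique)
    have "amp id_blinfun \<xi> = \<xi>"
      by (rule ell2_eqI) (simp add: amp.rep_eq)
    then show "\<xi> \<in> V"
      unfolding V_def using one closure_subset by (metis (no_types, lifting) image_eqI subsetD)
  qed simp
  ultimately have "amp T \<xi> \<in> V"
    using P(1) by metis
  then obtain v where "v \<in> (\<lambda>S. amp S \<xi>) ` N" "dist v (amp T \<xi>) < e"
    unfolding V_def closure_approachable using e by blast
  then show ?thesis
    by (auto simp: dist_norm)
qed

section \<open>Complex-linear operators as a star-algebra\<close>

lemma cinner_adjointI:
  assumes "complex_linear T" "\<And>x y. rip (blinfun_apply T x) y = rip x (blinfun_apply S y)"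
  shows "cinner (blinfun_apply T x) y = cinner x (blinfun_apply S y)"
proof (rule complex_eqI)
  show "Re (cinner (blinfun_apply T x) y) = Re (cinner x (blinfun_apply S y))"
    using assms(2)[of x y] by (simp add: rip_def)
  have "(- \<i>) *\<^sub>C blinfun_apply T x = blinfun_apply T ((- \<i>) *\<^sub>C x)"
    using assms(1) by (simp add: complex_linear_def)
  then show "Im (cinner (blinfun_apply T x) y) = Im (cinner x (blinfun_apply S y))"
    unfolding Im_cinner by (simp add: assms(2))
qed

lemma cinner_op_adjoint_left:
  assumes "complex_linear T"
  shows "cinner (blinfun_apply (op_adjoint T) x) y = cinner x (blinfun_apply T y)"
  using cinner_op_adjoint[OF assms, of y x] by (metis cinner_commute)

lemma norm_op_adjoint_le:
  assumes "complex_linear T"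
  shows "norm (op_adjoint T) \<le> norm T"
proof (rule norm_blinfun_bound)
  fix x
  let ?s = "blinfun_apply (op_adjoint T) x"
  have "norm ?s * norm ?s = rip (blinfun_apply T ?s) x"
    using cinner_op_adjoint[OF assms, of ?s x] by (simp add: rip_def cinner_self power2_eq_square)
  also have "\<dots> \<le> norm (blinfun_apply T ?s) * norm x"
    by (rule rip_le)
  also have "\<dots> \<le> (norm T * norm ?s) * norm x"
    by (intro mult_right_mono norm_blinfun) auto
  finally have "norm ?s * norm ?s \<le> norm ?s * (norm T * norm x)"
    by (simp add: mult_ac)
  then show "norm ?s \<le> norm T * norm x"
    by (cases "norm ?s = 0") auto
qed simp

text \<open>The maps in \<open>'h \<Rightarrow>\<^sub>L 'h\<close> are only real-linear, and
  \<open>op_adjoint\<close> is meaningful for the complex-linear ones. A type of their own lets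
  these be an instance of \<open>star_algebra\<close>.\<close>

typedef (overloaded) ('h::complex_hilbert_space) cop = "{T :: 'h \<Rightarrow>\<^sub>L 'h. complex_linear T}"
  morphisms op_of Abs_cop
  by (rule exI[of _ 0]) (simp add: complex_linear_def, metis scaleC_add_right add_cancel_right_right)

setup_lifting type_definition_cop

lemma complex_linear_op_of: "complex_linear (op_of a)"
  using op_of[of a] by simp

lemma scaleC_zero_right [simp]: "c *\<^sub>C (0 :: 'h::complex_hilbert_space) = 0"
  by (metis scaleC_add_right add_cancel_right_right)

lemma scaleC_minus_right: "c *\<^sub>C (- x :: 'h::complex_hilbert_space) = - (c *\<^sub>C x)"
  using scaleC_add_right[of c x "- x"] by (simp add: eq_neg_iff_add_eq_0 add.commute)

lemma scaleC_diff_right: "c *\<^sub>C (x - y :: 'h::complex_hilbert_space) = c *\<^sub>C x - c *\<^sub>C y"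
  using scaleC_add_right[of c x "- y"] by (simp add: scaleC_minus_right)

instantiation cop :: (complex_hilbert_space) star_algebra
begin

lift_definition zero_cop :: "'a cop" is 0 by (simp add: complex_linear_def)
lift_definition one_cop :: "'a cop" is id_blinfun by (simp add: complex_linear_def)
lift_definition plus_cop :: "'a cop \<Rightarrow> 'a cop \<Rightarrow> 'a cop" is "(+)"
  by (simp add: complex_linear_def blinfun.add_left scaleC_add_right)
lift_definition uminus_cop :: "'a cop \<Rightarrow> 'a cop" is "uminus"
  by (simp add: complex_linear_def blinfun.minus_left scaleC_minus_right)
lift_definition minus_cop :: "'a cop \<Rightarrow> 'a cop \<Rightarrow> 'a cop" is "(-)"
  by (simp add: complex_linear_def blinfun.diff_left scaleC_diff_right)
lift_definition times_cop :: "'a cop \<Rightarrow> 'a cop \<Rightarrow> 'a cop" is "(o\<^sub>L)"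
  by (simp add: complex_linear_def)
lift_definition scl_cop :: "complex \<Rightarrow> 'a cop \<Rightarrow> 'a cop" is op_scaleC
  by (simp add: complex_linear_def op_scaleC_apply scaleC_scaleC mult.commute)
lift_definition star_cop :: "'a cop \<Rightarrow> 'a cop" is op_adjoint
  by (rule complex_linear_op_adjoint)

instance
proof
  fix a b c :: "'a cop" and r s :: complex
  show "a + b + c = a + (b + c)" by transfer (simp add: add.assoc)
  show "a + b = b + a" by transfer (simp add: add.commute)
  show "0 + a = a" by transfer simp
  show "- a + a = 0" by transfer simp
  show "a - b = a + - b" by transfer simp
  show "a * b * c = a * (b * c)" by transfer (rule blinfun_eqI, simp)
  show "(a + b) * c = a * c + b * c" by transfer (rule blinfun_eqI, simp add: blinfun.add_left)
  show "a * (b + c) = a * b + a * c"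
    by transfer (rule blinfun_eqI, simp add: blinfun.add_left blinfun.add_right)
  show "1 * a = a" by transfer (rule blinfun_eqI, simp)
  show "a * 1 = a" by transfer (rule blinfun_eqI, simp)
  show "scl r (a + b) = scl r a + scl r b"
    by transfer (rule blinfun_eqI, simp add: op_scaleC_apply blinfun.add_left scaleC_add_right)
  show "scl (r + s) a = scl r a + scl s a"
    by transfer (rule blinfun_eqI, simp add: op_scaleC_apply blinfun.add_left scaleC_add_left)
  show "scl r (scl s a) = scl (r * s) a"
    by transfer (rule blinfun_eqI, simp add: op_scaleC_apply scaleC_scaleC)
  show "scl 1 a = a"
  proof transfer
    fix T :: "'a \<Rightarrow>\<^sub>L 'a"
    have "1 *\<^sub>C x = x" for x :: 'a
      using scaleR_scaleC[of 1 x] by simp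
    then show "op_scaleC 1 T = T"
      by (intro blinfun_eqI) (simp add: op_scaleC_apply)
  qed
  show "scl r a * b = scl r (a * b)"
    by transfer (rule blinfun_eqI, simp add: op_scaleC_apply)
  show "a * scl r b = scl r (a * b)"
    by transfer (rule blinfun_eqI, simp add: op_scaleC_apply complex_linear_def)
  show "star (a + b) = star a + star b"
    by transfer (rule op_adjoint_eqI,
      simp add: blinfun.add_left cinner_add_left cinner_add_right cinner_op_adjoint)
  show "star (a * b) = star b * star a"
    by transfer (rule op_adjoint_eqI, simp add: cinner_op_adjoint)
  show "star (scl r a) = scl (cnj r) (star a)"
    by transfer (rule op_adjoint_eqI,
      simp add: op_scaleC_apply cinner_scaleC_left cinner_scaleC_right cinner_op_adjoint)
  show "star (star a) = a"
    by transfer (rule op_adjoint_eqI, simp add: cinner_op_adjoint_left)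
qed

end

context tracial_algebra
begin

text \<open>Iterating Cauchy--Schwarz turns growth of the powers of \<open>a* a\<close> into a norm bound.\<close>

lemma bnd_if_powers:
  assumes a: "a \<in> A" and r: "0 \<le> r"
    and C: "\<And>b. b \<in> A \<Longrightarrow> \<exists>C. \<forall>n. ip ((star a * a) ^ n * b) b \<le> C * (r\<^sup>2) ^ n"
  shows "bnd a r"
proof (rule bndI)
  fix b assume b: "b \<in> A"
  define P where "P = star a * a"
  have P: "P \<in> A" "star P = P" using a by (auto simp: P_def)
  have starP: "star (P ^ n) = P ^ n" for n
    by (induction n) (auto simp: P power_commutes)
  define x where "x n = ip (P ^ n * b) b" for n
  define s where "s = ip b b"
  obtain C where C: "\<And>n. x n \<le> C * (r\<^sup>2) ^ n"
    using C[OF b] unfolding x_def P_def by blast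
  have s0: "0 \<le> s" using b by (simp add: s_def ip_self)
  have sq: "(x n)\<^sup>2 \<le> x (2 * n) * s" for n
  proof -
    have "(x n)\<^sup>2 \<le> ip (P ^ n * b) (P ^ n * b) * ip b b"
      unfolding x_def using b P by (intro Cauchy_Schwarz_ip_sq) auto
    also have "ip (P ^ n * b) (P ^ n * b) = x (2 * n)"
      unfolding x_def using b P ip_mult_left[of "P ^ n" "P ^ n * b" b] starP[of n]
      by (subst ip_commute) (auto simp: mult_2 power_add mult.assoc)
    finally show ?thesis by (simp add: s_def)
  qed
  have "x 1 \<le> r\<^sup>2 * s"
  proof (rule ccontr)
    assume "\<not> ?thesis"
    then have gt: "r\<^sup>2 * s < x 1" by simp
    moreover have "0 \<le> r\<^sup>2 * s" using s0 by simp
    ultimately have x1: "0 < x 1" by linarith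
    have s: "0 < s"
    proof (rule ccontr)
      assume "\<not> 0 < s"
      then have "(x 1)\<^sup>2 \<le> 0" using sq[of 1] s0 by simp
      then show False using x1 by simp
    qed
    \<comment> \<open>Repeated squaring moves the ratio \<open>x 1 / s\<close> to the exponents 2^n,
      where the growth hypothesis can be compared with it.\<close>
    have pw: "(x 1 / s) ^ (2 ^ n) \<le> x (2 ^ n) / s" for n
    proof (induction n)
      case (Suc n)
      have "(x 1 / s) ^ (2 ^ Suc n) = ((x 1 / s) ^ (2 ^ n))\<^sup>2"
        by (simp add: power_mult[symmetric] mult.commute)
      also have "\<dots> \<le> (x (2 ^ n) / s)\<^sup>2"
        using Suc s x1 by (intro power_mono) auto
      also have "\<dots> \<le> x (2 * 2 ^ n) / s"
        using sq[of "2 ^ n"] s by (simp add: power_divide power2_eq_square divide_simps)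
      finally show ?case by simp
    qed simp
    show False
    proof (cases "r = 0")
      case True
      then have "x 1 \<le> 0" using C[of 1] by simp
      then show False using x1 by simp
    next
      case False
      then have r2: "0 < r\<^sup>2" by simp
      \<comment> \<open>If the bound fails, q exceeds 1 and its powers outgrow the constant
        \<open>C / s\<close>.\<close>
      define q where "q = x 1 / s / r\<^sup>2"
      have q: "1 < q"
        using gt s r2 by (simp add: q_def field_simps)
      obtain N where N: "C / s < q ^ N"
        using real_arch_pow[OF q] by blast
      have "q ^ N \<le> q ^ (2 ^ N)"
        using q by (intro power_increasing) (auto intro: less_imp_le less_exp)
      also have "\<dots> = (x 1 / s) ^ (2 ^ N) / (r\<^sup>2) ^ (2 ^ N)"
        unfolding q_def by (rule power_divide)
      also have "\<dots> \<le> (x (2 ^ N) / s) / (r\<^sup>2) ^ (2 ^ N)"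
        using r2 by (intro divide_right_mono pw) auto
      also have "\<dots> \<le> (C * (r\<^sup>2) ^ (2 ^ N) / s) / (r\<^sup>2) ^ (2 ^ N)"
        using r2 s by (intro divide_right_mono C) auto
      also have "\<dots> = C / s"
        using r2 by simp
      finally show False using N by simp
    qed
  qed
  then have "(n2 (a * b))\<^sup>2 \<le> (r * n2 b)\<^sup>2"
    using a b ip_mult_left[of "star a" "a * b" b]
    by (simp add: n2_power2 power_mult_distrib x_def s_def P_def mult.assoc)
  then show "n2 (a * b) \<le> r * n2 b"
    by (rule power2_le_imp_le) (use r b in simp)
qed (use a r in auto)

section \<open>Elements approximated by star-polynomials in 2-norm\<close>

definition limit_poly :: "nat \<Rightarrow> (nat \<Rightarrow> 'a) \<Rightarrow> 'a \<Rightarrow> bool" where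
  "limit_poly n v a \<longleftrightarrow> a \<in> A \<and> (\<forall>\<delta>>0. \<exists>p. gens p \<subseteq> {..<n} \<and> n2 (eval v p - a) < \<delta>)"

lemma limit_polyD: "limit_poly n v a \<Longrightarrow> 0 < \<delta> \<Longrightarrow> \<exists>p. gens p \<subseteq> {..<n} \<and> n2 (eval v p - a) < \<delta>"
  and limit_poly_closed: "limit_poly n v a \<Longrightarrow> a \<in> A"
  unfolding limit_poly_def by blast+

lemma limit_poly_eval:
  assumes "\<And>i. v i \<in> A" "gens p \<subseteq> {..<n}"
  shows "limit_poly n v (eval v p)"
  unfolding limit_poly_def using assms eval_closed[of v p] by (auto intro!: exI[of _ p])

text \<open>Limits of limits are limits. The algebraic closure properties use it with a polynomial
  value as approximant, strong closedness with a general one.\<close>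

lemma limit_poly_closure:
  assumes v: "\<And>i. v i \<in> A" and a: "a \<in> A"
    and *: "\<And>\<delta>. 0 < \<delta> \<Longrightarrow> \<exists>b. limit_poly n v b \<and> n2 (b - a) < \<delta>"
  shows "limit_poly n v a"
  unfolding limit_poly_def
proof (intro conjI allI impI a)
  fix \<delta> :: real assume "0 < \<delta>"
  then obtain b where b: "limit_poly n v b" "n2 (b - a) < \<delta>/2"
    using *[of "\<delta>/2"] by auto
  obtain p where p: "gens p \<subseteq> {..<n}" "n2 (eval v p - b) < \<delta>/2"
    using limit_polyD[OF b(1), of "\<delta>/2"] \<open>0 < \<delta>\<close> by auto
  have "n2 (eval v p - a) \<le> n2 (eval v p - b) + n2 (b - a)"
    using a b limit_poly_closed eval_closed[of v p, OF v] by (intro n2_diff_trans) auto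
  then show "\<exists>p. gens p \<subseteq> {..<n} \<and> n2 (eval v p - a) < \<delta>"
    using b(2) p by (intro exI[of _ p]) auto
qed

context
  fixes n :: nat and v :: "nat \<Rightarrow> 'a" and R
  assumes v: "\<And>i. bnd (v i) R"
begin

lemma v_closed: "v i \<in> A"
  using bnd_closed[OF v] .

lemma limit_poly_add:
  assumes "limit_poly n v a" "limit_poly n v b"
  shows "limit_poly n v (a + b)"
proof (rule limit_poly_closure[OF v_closed])
  fix \<delta> :: real assume "0 < \<delta>"
  obtain p where p: "gens p \<subseteq> {..<n}" "n2 (eval v p - a) < \<delta>/2"
    using limit_polyD[OF assms(1), of "\<delta>/2"] \<open>0 < \<delta>\<close> by auto
  obtain q where q: "gens q \<subseteq> {..<n}" "n2 (eval v q - b) < \<delta>/2"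
    using limit_polyD[OF assms(2), of "\<delta>/2"] \<open>0 < \<delta>\<close> by auto
  have "n2 ((eval v p - a) + (eval v q - b)) \<le> n2 (eval v p - a) + n2 (eval v q - b)"
    using assms limit_poly_closed eval_closed[OF v_closed] by (intro n2_triangle) auto
  then have "n2 (eval v (Plus p q) - (a + b)) < \<delta>"
    using p q by (simp add: algebra_simps)
  then show "\<exists>b'. limit_poly n v b' \<and> n2 (b' - (a + b)) < \<delta>"
    using p q by (intro exI[of _ "eval v (Plus p q)"] conjI limit_poly_eval v_closed) auto
qed (use assms limit_poly_closed in auto)

lemma limit_poly_scl:
  assumes "limit_poly n v a"
  shows "limit_poly n v (scl c a)"
proof (rule limit_poly_closure[OF v_closed])
  fix \<delta> :: real assume "0 < \<delta>"
  obtain p where p: "gens p \<subseteq> {..<n}" "n2 (eval v p - a) < \<delta> / (cmod c + 1)"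
    using limit_polyD[OF assms, of "\<delta> / (cmod c + 1)"] \<open>0 < \<delta>\<close> by (auto simp: add_nonneg_pos)
  have "n2 (scl c (eval v p - a)) = cmod c * n2 (eval v p - a)"
    using assms limit_poly_closed eval_closed[OF v_closed] by (intro n2_scl) auto
  also have "\<dots> \<le> cmod c * (\<delta> / (cmod c + 1))"
    using p by (intro mult_left_mono) auto
  also have "\<dots> < \<delta>"
    using \<open>0 < \<delta>\<close> by (simp add: divide_simps add_nonneg_pos)
  finally have "n2 (eval v (Times (Const c) p) - scl c a) < \<delta>"
    by (simp add: scl_diff_right)
  then show "\<exists>b'. limit_poly n v b' \<and> n2 (b' - scl c a) < \<delta>"
    using p by (intro exI[of _ "eval v (Times (Const c) p)"] conjI limit_poly_eval v_closed) auto
qed (use assms limit_poly_closed in auto)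

lemma limit_poly_star:
  assumes "limit_poly n v a"
  shows "limit_poly n v (star a)"
proof (rule limit_poly_closure[OF v_closed])
  fix \<delta> :: real assume "0 < \<delta>"
  obtain p where p: "gens p \<subseteq> {..<n}" "n2 (eval v p - a) < \<delta>"
    using limit_polyD[OF assms, of "\<delta>"] \<open>0 < \<delta>\<close> by auto
  have "n2 (star (eval v p - a)) = n2 (eval v p - a)"
    using assms limit_poly_closed eval_closed[OF v_closed] by (intro n2_star) auto
  then have "n2 (eval v (Adj p) - star a) < \<delta>"
    using p by simp
  then show "\<exists>b'. limit_poly n v b' \<and> n2 (b' - star a) < \<delta>"
    using p by (intro exI[of _ "eval v (Adj p)"] conjI limit_poly_eval v_closed) auto
qed (use assms limit_poly_closed in auto)

text \<open>The polynomial approximating \<open>b\<close> is chosen after the one for \<open>a\<close>, so only the norm bounds of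
  \<open>b\<close> and of the first polynomial enter; no uniform bound on the approximants is needed.\<close>

lemma limit_poly_mult:
  assumes "limit_poly n v a" "limit_poly n v b" "bnd b L"
  shows "limit_poly n v (a * b)"
proof (rule limit_poly_closure[OF v_closed])
  fix \<delta> :: real assume "0 < \<delta>"
  have L: "0 \<le> L" using assms(3) bnd_nonneg by blast
  obtain p where p: "gens p \<subseteq> {..<n}" "n2 (eval v p - a) < \<delta> / 2 / (L + 1)"
    using limit_polyD[OF assms(1), of "\<delta> / 2 / (L + 1)"] \<open>0 < \<delta>\<close> L by auto
  define B where "B = poly_bound R p"
  have B: "bnd (eval v p) B" 
    unfolding B_def by (intro bnd_eval v)
  then have B0: "0 \<le> B" by (rule bnd_nonneg)
  obtain q where q: "gens q \<subseteq> {..<n}" "n2 (eval v q - b) < \<delta> / 2 / (B + 1)"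
    using limit_polyD[OF assms(2), of "\<delta> / 2 / (B + 1)"] \<open>0 < \<delta>\<close> B0 by auto
  have A [simp]: "a \<in> A" "b \<in> A" "eval v p \<in> A" "eval v q \<in> A"
    using assms limit_poly_closed eval_closed[OF v_closed] by auto
  have frac: "x * (\<delta> / 2 / (x + 1)) < \<delta> / 2" if "0 \<le> x" for x
    using that \<open>0 < \<delta>\<close> by (simp add: field_simps add_nonneg_pos)
  have "eval v (Times p q) - a * b = eval v p * (eval v q - b) + (eval v p - a) * b"
    by (simp add: algebra_simps)
  then have "n2 (eval v (Times p q) - a * b) \<le> n2 (eval v p * (eval v q - b)) + n2 ((eval v p - a) * b)"
    by (simp only:) (intro n2_triangle; simp)
  also have "\<dots> \<le> B * n2 (eval v q - b) + L * n2 (eval v p - a)"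
    by (intro add_mono bndD[OF B] n2_mult_right assms) auto
  also have "\<dots> \<le> B * (\<delta> / 2 / (B + 1)) + L * (\<delta> / 2 / (L + 1))"
    using p q B0 L by (intro add_mono mult_left_mono) auto
  also have "\<dots> < \<delta>"
    using frac[OF B0] frac[OF L] by linarith
  finally show "\<exists>b'. limit_poly n v b' \<and> n2 (b' - a * b) < \<delta>"
    using p q by (intro exI[of _ "eval v (Times p q)"] conjI limit_poly_eval v_closed) auto
qed (use assms limit_poly_closed in auto)

end

end

section \<open>Normal traces\<close>

text \<open>Preimages of open sets under these functionals, for square-summable sequences, form the
  subbasis of \<open>ultraweak_topology\<close>.\<close>

definition vector_sum :: "(nat \<Rightarrow> 'h) \<Rightarrow> (nat \<Rightarrow> 'h) \<Rightarrow> ('h::complex_hilbert_space \<Rightarrow>\<^sub>L 'h) \<Rightarrow> complex" where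
  "vector_sum \<xi> \<eta> T = (\<Sum>j. cinner (blinfun_apply T (\<xi> j)) (\<eta> j))"

definition square_summable :: "(nat \<Rightarrow> 'h::real_normed_vector) \<Rightarrow> bool" where
  "square_summable \<xi> \<longleftrightarrow> summable (\<lambda>j. (norm (\<xi> j))\<^sup>2)"

lemma square_summable_apply:
  "square_summable \<xi> \<Longrightarrow> square_summable (\<lambda>j. blinfun_apply (T :: 'h::complex_hilbert_space \<Rightarrow>\<^sub>L 'h) (\<xi> j))"
  using summable_coord[of "amp T (Abs_ell2 \<xi>)"]
  by (simp add: square_summable_def amp.rep_eq Abs_ell2_inverse)

lemma summable_vector_sum:
  fixes \<xi> \<eta> :: "nat \<Rightarrow> 'h::complex_hilbert_space"
  assumes "square_summable \<xi>" "square_summable \<eta>"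
  shows "summable (\<lambda>j. cinner (blinfun_apply T (\<xi> j)) (\<eta> j))"
proof (rule summable_comparison_test_ev)
  show "summable (\<lambda>j. 2 * (norm (blinfun_apply T (\<xi> j)) * norm (\<eta> j)))"
    using assms square_summable_apply[of \<xi> T] unfolding square_summable_def
    by (intro summable_mult summable_norm_mult)
qed (simp add: norm_cinner_le)

lemma op_scaleC_zero: "op_scaleC 0 T = 0"
  by (rule blinfun_eqI) (use scaleR_scaleC[of 0] in \<open>simp add: op_scaleC_apply\<close>)

lemma vector_sum_scaleC:
  assumes "square_summable \<xi>" "square_summable \<eta>"
  shows "vector_sum \<xi> \<eta> (op_scaleC c T) = c * vector_sum \<xi> \<eta> T"
  unfolding vector_sum_def op_scaleC_apply cinner_scaleC_left
  by (rule suminf_mult[OF summable_vector_sum[OF assms]])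

lemma norm_vector_sum_le:
  assumes "square_summable \<xi>" "square_summable \<eta>"
  shows "cmod (vector_sum \<xi> \<eta> T) \<le> (\<Sum>j. 2 * (norm (\<xi> j) * norm (\<eta> j))) * norm T"
proof -
  have s: "summable (\<lambda>j. 2 * (norm (\<xi> j) * norm (\<eta> j)))"
    using assms unfolding square_summable_def by (intro summable_mult summable_norm_mult)
  have le: "cmod (cinner (blinfun_apply T (\<xi> j)) (\<eta> j)) \<le> 2 * (norm (\<xi> j) * norm (\<eta> j)) * norm T" for j
  proof -
    have "cmod (cinner (blinfun_apply T (\<xi> j)) (\<eta> j)) \<le> 2 * (norm (blinfun_apply T (\<xi> j)) * norm (\<eta> j))"
      by (rule norm_cinner_le)
    also have "\<dots> \<le> 2 * ((norm T * norm (\<xi> j)) * norm (\<eta> j))"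
      by (intro mult_left_mono mult_right_mono norm_blinfun) auto
    finally show ?thesis by (simp add: mult_ac)
  qed
  have s': "summable (\<lambda>j. 2 * (norm (\<xi> j) * norm (\<eta> j)) * norm T)"
    by (rule summable_mult2[OF s])
  have "cmod (vector_sum \<xi> \<eta> T) \<le> (\<Sum>j. 2 * (norm (\<xi> j) * norm (\<eta> j)) * norm T)"
    unfolding vector_sum_def by (rule norm_suminf_le[OF le s']) 
  also have "\<dots> = (\<Sum>j. 2 * (norm (\<xi> j) * norm (\<eta> j))) * norm T"
    by (rule suminf_mult2[OF s, symmetric])
  finally show ?thesis .
qed

text \<open>Moving \<open>op_adjoint T\<close> across the inner product leaves T on both vectors.
  The bound is quadratic in T and becomes a squared norm in the amplified space.\<close>

lemma norm_vector_sum_adjoint_le: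
  assumes "square_summable \<xi>" "square_summable \<eta>" "complex_linear T"
  shows "cmod (vector_sum \<xi> \<eta> (op_adjoint T o\<^sub>L T))
    \<le> (\<Sum>j. (norm (blinfun_apply T (\<xi> j)))\<^sup>2) + (\<Sum>j. (norm (blinfun_apply T (\<eta> j)))\<^sup>2)"
proof -
  have s: "summable (\<lambda>j. (norm (blinfun_apply T (\<xi> j)))\<^sup>2)" "summable (\<lambda>j. (norm (blinfun_apply T (\<eta> j)))\<^sup>2)"
    using assms square_summable_apply[of _ T] by (auto simp: square_summable_def)
  have le: "cmod (cinner (blinfun_apply (op_adjoint T o\<^sub>L T) (\<xi> j)) (\<eta> j))
     \<le> (norm (blinfun_apply T (\<xi> j)))\<^sup>2 + (norm (blinfun_apply T (\<eta> j)))\<^sup>2" for j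
  proof -
    have "cinner (blinfun_apply (op_adjoint T o\<^sub>L T) (\<xi> j)) (\<eta> j)
        = cinner (blinfun_apply T (\<xi> j)) (blinfun_apply T (\<eta> j))"
      by (simp add: cinner_op_adjoint_left[OF assms(3)])
    also have "cmod \<dots> \<le> 2 * (norm (blinfun_apply T (\<xi> j)) * norm (blinfun_apply T (\<eta> j)))"
      by (rule norm_cinner_le)
    also have "\<dots> \<le> (norm (blinfun_apply T (\<xi> j)))\<^sup>2 + (norm (blinfun_apply T (\<eta> j)))\<^sup>2"
      using sum_squares_bound by (simp add: mult.assoc)
    finally show ?thesis .
  qed
  have "cmod (vector_sum \<xi> \<eta> (op_adjoint T o\<^sub>L T))
      \<le> (\<Sum>j. (norm (blinfun_apply T (\<xi> j)))\<^sup>2 + (norm (blinfun_apply T (\<eta> j)))\<^sup>2)"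
    unfolding vector_sum_def by (rule norm_suminf_le[OF le summable_add[OF s]])
  then show ?thesis
    by (simp add: suminf_add[OF s])
qed

text \<open>Says that W contains a basic ultraweak neighbourhood of 0. A common e for all pairs
  leaves a single number for the scaling argument in \<open>normal_functional_bound\<close>.\<close>

definition zero_neighbourhood ::
    "((nat \<Rightarrow> 'h::complex_hilbert_space) \<times> (nat \<Rightarrow> 'h)) set \<Rightarrow> real \<Rightarrow> ('h \<Rightarrow>\<^sub>L 'h) set \<Rightarrow> bool" where
  "zero_neighbourhood F e W \<longleftrightarrow> finite F \<and> 0 < e \<and>
     (\<forall>(\<xi>, \<eta>)\<in>F. square_summable \<xi> \<and> square_summable \<eta>) \<and>
     (\<forall>T. (\<forall>(\<xi>, \<eta>)\<in>F. cmod (vector_sum \<xi> \<eta> T) < e) \<longrightarrow> T \<in> W)"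

lemma ultraweak_neighbourhood_zero:
  fixes W :: "('h::complex_hilbert_space \<Rightarrow>\<^sub>L 'h) set"
  assumes "openin ultraweak_topology W" "0 \<in> W"
  shows "\<exists>F e. zero_neighbourhood F e W"
  using assms unfolding ultraweak_topology_def openin_topology_generated_by_iff
proof (induction rule: generate_topology_on.induct)
  case (Int a b)
  then obtain F e F' e' where "zero_neighbourhood F e a" "zero_neighbourhood F' e' b"
    by auto
  then have "zero_neighbourhood (F \<union> F') (min e e') (a \<inter> b)"
    unfolding zero_neighbourhood_def ball_Un case_prod_unfold by auto
  then show ?case by blast
next
  case (UN K)
  then obtain k where "k \<in> K" "0 \<in> k" by blast
  then show ?case
    using UN.IH[of k] unfolding zero_neighbourhood_def by (meson UnionI)
next
  case (Basis s)
  then obtain \<xi> \<eta> :: "nat \<Rightarrow> 'h" and U where s: "s = {T. vector_sum \<xi> \<eta> T \<in> U}" "open U"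
      "square_summable \<xi>" "square_summable \<eta>"
    by (auto simp: vector_sum_def square_summable_def)
  have "vector_sum \<xi> \<eta> 0 = 0"
    using vector_sum_scaleC[OF s(3,4), of 0 0] by (simp add: op_scaleC_zero)
  then have "0 \<in> U"
    using Basis.prems s(1) by simp
  then obtain e where "0 < e" "ball 0 e \<subseteq> U"
    using s(2) openE by blast
  then show ?case
    using s by (intro exI[of _ "{(\<xi>, \<eta>)}"] exI[of _ e]) (auto simp: zero_neighbourhood_def)
qed simp

text \<open>Continuity at 0 keeps \<tau> inside the unit disc on a basic neighbourhood, and
  homogeneity turns this into a bound by the seminorms that define the neighbourhood.\<close>

lemma normal_functional_bound:
  fixes M :: "('h::complex_hilbert_space \<Rightarrow>\<^sub>L 'h) set"
  assumes M: "0 \<in> M" "\<And>c T. T \<in> M \<Longrightarrow> op_scaleC c T \<in> M"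
    and \<tau>: "normal_functional M \<tau>" "\<And>c T. T \<in> M \<Longrightarrow> \<tau> (op_scaleC c T) = c * \<tau> T"
  shows "\<exists>F e. finite F \<and> 0 < e \<and> (\<forall>(\<xi>, \<eta>)\<in>F. square_summable \<xi> \<and> square_summable \<eta>) \<and>
    (\<forall>T\<in>M. cmod (\<tau> T) \<le> (\<Sum>(\<xi>, \<eta>)\<in>F. cmod (vector_sum \<xi> \<eta> T)) / e)"
proof -
  have \<tau>0: "\<tau> 0 = 0"
    using \<tau>(2)[OF M(1), of 0] by (simp add: op_scaleC_zero)
  \<comment> \<open>A subbasic set that contains every operator, which identifies the underlying
    space of the topology.\<close>
  have "openin ultraweak_topology {T. vector_sum (\<lambda>_. 0) (\<lambda>_. 0) T \<in> (UNIV :: complex set)}"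
    unfolding ultraweak_topology_def vector_sum_def
    by (rule topology_generated_by_Basis) (intro CollectI exI conjI, rule refl, auto)
  then have top: "topspace ultraweak_topology = (UNIV :: ('h \<Rightarrow>\<^sub>L 'h) set)"
    using openin_subset by fastforce
  have "openin (subtopology ultraweak_topology M) {T \<in> topspace (subtopology ultraweak_topology M). \<tau> T \<in> ball 0 1}"
    using \<tau>(1) unfolding normal_functional_def by (intro openin_continuous_map_preimage) auto
  then obtain W where W: "openin ultraweak_topology W" "{T \<in> M. \<tau> T \<in> ball 0 1} = W \<inter> M"
    by (auto simp: openin_subtopology top)
  have "0 \<in> {T \<in> M. \<tau> T \<in> ball 0 1}"
    using M(1) \<tau>0 by simp
  then have "0 \<in> W"
    unfolding W(2) by (rule IntD1)
  then obtain F e where z: "zero_neighbourhood F e W"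
    using ultraweak_neighbourhood_zero[OF W(1)] by blast
  then have F: "finite F" "0 < e" "\<forall>(\<xi>, \<eta>)\<in>F. square_summable \<xi> \<and> square_summable \<eta>"
    by (simp_all add: zero_neighbourhood_def)
  have FW: "T \<in> W" if "\<forall>(\<xi>, \<eta>)\<in>F. cmod (vector_sum \<xi> \<eta> T) < e" for T
    using z that by (simp add: zero_neighbourhood_def)
  have "cmod (\<tau> T) \<le> (\<Sum>(\<xi>, \<eta>)\<in>F. cmod (vector_sum \<xi> \<eta> T)) / e" if T: "T \<in> M" for T
  proof -
    define s where "s = (\<Sum>(\<xi>, \<eta>)\<in>F. cmod (vector_sum \<xi> \<eta> T))"
    have s0: "0 \<le> s" unfolding s_def by (intro sum_nonneg) auto
    have "cmod (\<tau> T) \<le> s / e + d" if d: "0 < d" for d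
    proof -
      \<comment> \<open>The summand d keeps the scaling factor finite when all the seminorms of T
        vanish.\<close>
      define c where "c = 1 / (s / e + d)"
      have c: "0 < c" using s0 F(2) d by (simp add: c_def add_nonneg_pos)
      have "cmod (vector_sum \<xi> \<eta> (op_scaleC (of_real c) T)) < e" if "(\<xi>, \<eta>) \<in> F" for \<xi> \<eta>
      proof -
        have "cmod (vector_sum \<xi> \<eta> T) \<le> s"
          unfolding s_def using member_le_sum[OF that, of "\<lambda>(\<xi>, \<eta>). cmod (vector_sum \<xi> \<eta> T)"] F(1) by auto
        then have "c * cmod (vector_sum \<xi> \<eta> T) \<le> c * s"
          using c by simp
        also have "\<dots> < e"
          using s0 F(2) d by (simp add: c_def field_simps add_nonneg_pos)
        finally show ?thesis
          using F(3) that c by (auto simp: vector_sum_scaleC norm_mult)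
      qed
      then have "op_scaleC (of_real c) T \<in> W"
        by (intro FW) auto
      then have "\<tau> (op_scaleC (of_real c) T) \<in> ball 0 1"
        using W(2) M(2)[OF T] by blast
      then have "c * cmod (\<tau> T) < 1"
        using \<tau>(2)[OF T] c by (simp add: norm_mult)
      then show ?thesis
        using c s0 F(2) d by (simp add: c_def divide_simps add_nonneg_pos mult.commute split: if_splits)
    qed
    then show ?thesis
      unfolding s_def[symmetric] by (rule field_le_epsilon)
  qed
  then show ?thesis
    using F(1-3) by (intro exI[of _ F] exI[of _ e] conjI) simp_all
qed

text \<open>Interleaving merges finitely many sequences into one, so that a single vector of
  \<open>'h ell2\<close> carries the whole seminorm.\<close>

lemma combine_square_summable:
  fixes F :: "((nat \<Rightarrow> 'h::complex_hilbert_space) \<times> (nat \<Rightarrow> 'h)) set"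
  assumes "finite F" "\<forall>(\<xi>, \<eta>)\<in>F. square_summable \<xi> \<and> square_summable \<eta>"
  shows "\<exists>\<zeta> :: 'h ell2. \<forall>T. (\<Sum>(\<xi>, \<eta>)\<in>F.
      (\<Sum>j. (norm (blinfun_apply T (\<xi> j)))\<^sup>2) + (\<Sum>j. (norm (blinfun_apply T (\<eta> j)))\<^sup>2)) = (norm (amp T \<zeta>))\<^sup>2"
proof -
  have merge: "\<exists>\<zeta> :: 'h ell2. \<forall>T. (norm (amp T x))\<^sup>2 + (norm (amp T y))\<^sup>2 = (norm (amp T \<zeta>))\<^sup>2" for x y
  proof -
    define f where "f n = (if even n then coord x (n div 2) else coord y ((n - 1) div 2))" for n
    have s: "(\<lambda>n. (norm (blinfun_apply T (f n)))\<^sup>2) sums ((norm (amp T x))\<^sup>2 + (norm (amp T y))\<^sup>2)" for T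
    proof -
      have "(\<lambda>n. (norm (blinfun_apply T (coord x n)))\<^sup>2) sums (norm (amp T x))\<^sup>2"
        "(\<lambda>n. (norm (blinfun_apply T (coord y n)))\<^sup>2) sums (norm (amp T y))\<^sup>2"
        using summable_sums[OF summable_coord[of "amp T x"]] summable_sums[OF summable_coord[of "amp T y"]]
        by (simp_all add: norm_ell2_sq amp.rep_eq)
      from sums_if[OF this(2) this(1)]
      have "(\<lambda>n. if even n then (norm (blinfun_apply T (coord x (n div 2))))\<^sup>2
          else (norm (blinfun_apply T (coord y ((n - 1) div 2))))\<^sup>2) sums ((norm (amp T x))\<^sup>2 + (norm (amp T y))\<^sup>2)"
        by (simp add: add.commute)
      also have "(\<lambda>n. if even n then (norm (blinfun_apply T (coord x (n div 2))))\<^sup>2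
          else (norm (blinfun_apply T (coord y ((n - 1) div 2))))\<^sup>2) = (\<lambda>n. (norm (blinfun_apply T (f n)))\<^sup>2)"
        by (rule ext) (simp add: f_def)
      finally show ?thesis .
    qed
    have "summable (\<lambda>n. (norm (f n))\<^sup>2)"
      using sums_summable[OF s[of id_blinfun]] by simp
    then have "coord (Abs_ell2 f) = f"
      by (simp add: Abs_ell2_inverse)
    then show ?thesis
      using s by (intro exI[of _ "Abs_ell2 f"]) (simp add: norm_ell2_sq amp.rep_eq sums_iff)
  qed
  show ?thesis
    using assms
  proof (induction F)
    case empty
    show ?case
      by (intro exI[of _ 0]) (simp add: norm_ell2_sq amp.rep_eq coord_zero)
  next
    case (insert a F)
    obtain \<xi> \<eta> where a: "a = (\<xi>, \<eta>)" by force
    have sq: "(\<Sum>j. (norm (blinfun_apply T (f j)))\<^sup>2) = (norm (amp T (Abs_ell2 f)))\<^sup>2"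
      if "square_summable f" for f and T :: "'h \<Rightarrow>\<^sub>L 'h"
      using that by (simp add: norm_ell2_sq amp.rep_eq Abs_ell2_inverse square_summable_def)
    obtain \<zeta> :: "'h ell2" where \<zeta>: "\<And>T. (\<Sum>(\<xi>, \<eta>)\<in>F. (\<Sum>j. (norm (blinfun_apply T (\<xi> j)))\<^sup>2) +
        (\<Sum>j. (norm (blinfun_apply T (\<eta> j)))\<^sup>2)) = (norm (amp T \<zeta>))\<^sup>2"
      using insert by auto
    obtain \<zeta>1 :: "'h ell2" where \<zeta>1: "\<And>T. (norm (amp T (Abs_ell2 \<xi>)))\<^sup>2 + (norm (amp T (Abs_ell2 \<eta>)))\<^sup>2 = (norm (amp T \<zeta>1))\<^sup>2"
      using merge by blast
    obtain \<zeta>2 :: "'h ell2" where \<zeta>2: "\<And>T. (norm (amp T \<zeta>1))\<^sup>2 + (norm (amp T \<zeta>))\<^sup>2 = (norm (amp T \<zeta>2))\<^sup>2"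
      using merge by blast
    show ?case
      using insert a by (intro exI[of _ \<zeta>2]) (simp add: \<zeta> \<zeta>1 sq flip: \<zeta>2)
  qed
qed

section \<open>Density and bounded approximation in a von Neumann algebra with normal trace\<close>

definition op_algebra :: "('h::complex_hilbert_space \<Rightarrow>\<^sub>L 'h) set \<Rightarrow> 'h cop set" where
  "op_algebra M = {a. op_of a \<in> M}"

definition op_trace :: "(('h::complex_hilbert_space \<Rightarrow>\<^sub>L 'h) \<Rightarrow> complex) \<Rightarrow> 'h cop \<Rightarrow> complex" where
  "op_trace \<tau> a = \<tau> (op_of a)"

lemma op_algebra_iff: "a \<in> op_algebra M \<longleftrightarrow> op_of a \<in> M"
  by (simp add: op_algebra_def)

lemma op_of_Abs: "complex_linear T \<Longrightarrow> op_of (Abs_cop T) = T"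
  by (simp add: Abs_cop_inverse)

lemma op_of_eqI: "op_of a = op_of b \<Longrightarrow> a = b"
  by (simp add: op_of_inject)

lemma blinfun_compose_mono: "norm a \<le> K \<Longrightarrow> norm b \<le> L \<Longrightarrow> norm (a o\<^sub>L b) \<le> K * L"
  by (rule order_trans[OF norm_blinfun_compose mult_mono]) (auto intro: order_trans[OF norm_ge_zero])

locale normal_trace =
  fixes M :: "('h::complex_hilbert_space \<Rightarrow>\<^sub>L 'h) set" and \<tau> :: "('h \<Rightarrow>\<^sub>L 'h) \<Rightarrow> complex"
  assumes vN: "von_neumann_algebra M" and trace: "tracial_state M \<tau>" and normal: "normal_functional M \<tau>"
begin

lemma linear: "T \<in> M \<Longrightarrow> complex_linear T"
  and id_mem: "id_blinfun \<in> M"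
  and add_mem: "S \<in> M \<Longrightarrow> T \<in> M \<Longrightarrow> S + T \<in> M"
  and scale_mem: "T \<in> M \<Longrightarrow> op_scaleC c T \<in> M"
  and comp_mem: "S \<in> M \<Longrightarrow> T \<in> M \<Longrightarrow> S o\<^sub>L T \<in> M"
  and adjoint_mem: "T \<in> M \<Longrightarrow> op_adjoint T \<in> M"
  and closed_mem: "closedin strong_operator_topology M"
  using vN unfolding von_neumann_algebra_def by blast+

sublocale tracial_algebra "op_algebra M" "op_trace \<tau>"
proof
  fix a :: "'h cop" assume "a \<in> op_algebra M"
  then have "Im (\<tau> (op_adjoint (op_of a) o\<^sub>L op_of a)) = 0 \<and> 0 \<le> Re (\<tau> (op_adjoint (op_of a) o\<^sub>L op_of a))"
    using trace unfolding tracial_state_def op_algebra_iff by blast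
  then show "Im (op_trace \<tau> (star a * a)) = 0 \<and> 0 \<le> Re (op_trace \<tau> (star a * a))"
    by (simp add: op_trace_def star_cop.rep_eq times_cop.rep_eq)
qed (use trace id_mem add_mem scale_mem comp_mem adjoint_mem in
    \<open>simp_all add: op_algebra_iff op_trace_def one_cop.rep_eq plus_cop.rep_eq times_cop.rep_eq
      scl_cop.rep_eq star_cop.rep_eq tracial_state_def\<close>)

lemma zero_mem: "0 \<in> M"
  using zero_closed by (simp add: op_algebra_iff zero_cop.rep_eq)

text \<open>Two readings of one seminorm bound: norm continuity feeds \<open>bnd_if_norm_le\<close>,
  the vector \<zeta> feeds strong closedness in \<open>dense_polynomials\<close>.\<close>

lemma trace_bounds:
  "\<exists>(\<zeta> :: 'h ell2) C. 0 \<le> C \<and> (\<forall>T\<in>M. cmod (\<tau> T) \<le> C * norm T) \<and>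
     (\<forall>T\<in>M. Re (\<tau> (op_adjoint T o\<^sub>L T)) \<le> (norm (amp T \<zeta>))\<^sup>2)"
proof -
  have "\<tau> (op_scaleC c T) = c * \<tau> T" if "T \<in> M" for c T
    using trace that by (simp add: tracial_state_def)
  then obtain F :: "((nat \<Rightarrow> 'h) \<times> (nat \<Rightarrow> 'h)) set" and e where
    F: "finite F" "0 < e" "\<forall>(\<xi>, \<eta>)\<in>F. square_summable \<xi> \<and> square_summable \<eta>" and
    b: "\<forall>T\<in>M. cmod (\<tau> T) \<le> (\<Sum>(\<xi>, \<eta>)\<in>F. cmod (vector_sum \<xi> \<eta> T)) / e"
    using normal_functional_bound[OF zero_mem scale_mem normal] by blast
  obtain \<zeta> :: "'h ell2" where \<zeta>: "\<And>T. (\<Sum>(\<xi>, \<eta>)\<in>F. (\<Sum>j. (norm (blinfun_apply T (\<xi> j)))\<^sup>2) +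
        (\<Sum>j. (norm (blinfun_apply T (\<eta> j)))\<^sup>2)) = (norm (amp T \<zeta>))\<^sup>2"
    using combine_square_summable[OF F(1,3)] by blast
  define C where "C = (\<Sum>(\<xi>, \<eta>)\<in>F. \<Sum>j. 2 * (norm (\<xi> j) * norm (\<eta> j))) / e"
  have "0 \<le> C"
    unfolding C_def using F(2,3)
    by (intro divide_nonneg_pos sum_nonneg)
      (auto intro!: suminf_nonneg summable_mult summable_norm_mult simp: square_summable_def)
  moreover have "cmod (\<tau> T) \<le> C * norm T" if "T \<in> M" for T
  proof -
    have "(\<Sum>(\<xi>, \<eta>)\<in>F. cmod (vector_sum \<xi> \<eta> T)) \<le>
        (\<Sum>(\<xi>, \<eta>)\<in>F. (\<Sum>j. 2 * (norm (\<xi> j) * norm (\<eta> j))) * norm T)"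
      using F(3) by (intro sum_mono) (auto intro!: norm_vector_sum_le)
    also have "\<dots> = C * e * norm T"
    proof -
      have "C * e = (\<Sum>(\<xi>, \<eta>)\<in>F. \<Sum>j. 2 * (norm (\<xi> j) * norm (\<eta> j)))"
        using F(2) by (simp add: C_def)
      then show ?thesis
        by (simp only: sum_distrib_right case_prod_unfold)
    qed
    finally have "(\<Sum>(\<xi>, \<eta>)\<in>F. cmod (vector_sum \<xi> \<eta> T)) / e \<le> C * norm T"
      using F(2) by (simp add: divide_simps mult_ac)
    then show ?thesis
      using b that by force
  qed
  moreover have "Re (\<tau> (op_adjoint T o\<^sub>L T)) \<le> (norm (amp T ((1 / sqrt e) *\<^sub>R \<zeta>)))\<^sup>2" if T: "T \<in> M" for T
  proof -
    have "Re (\<tau> (op_adjoint T o\<^sub>L T)) \<le> cmod (\<tau> (op_adjoint T o\<^sub>L T))"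
      by (rule complex_Re_le_cmod)
    also have "\<dots> \<le> (\<Sum>(\<xi>, \<eta>)\<in>F. cmod (vector_sum \<xi> \<eta> (op_adjoint T o\<^sub>L T))) / e"
      using b comp_mem[OF adjoint_mem[OF T] T] by blast
    also have "\<dots> \<le> (norm (amp T \<zeta>))\<^sup>2 / e"
      unfolding \<zeta>[symmetric] using F(2,3)
      by (intro divide_right_mono sum_mono) (auto intro!: norm_vector_sum_adjoint_le linear T)
    also have "\<dots> = (norm (amp T ((1 / sqrt e) *\<^sub>R \<zeta>)))\<^sup>2"
      using F(2) by (simp add: linear_cmul[OF bounded_linear.linear[OF bounded_linear_amp]]
          power_mult_distrib power_divide)
    finally show ?thesis .
  qed
  ultimately show ?thesis
    by (intro exI[of _ "(1 / sqrt e) *\<^sub>R \<zeta>"] exI[of _ C] conjI ballI)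
qed

text \<open>\<open>bnd\<close> refers to the 2-norm and not to the action on \<open>'h\<close>. By
  norm continuity of the trace, \<open>ip ((star a * a) ^ n * b) b\<close> grows at most like a
  constant times r^(2n), and \<open>bnd_if_powers\<close> removes the constant. This avoids a square
  root of r^2 - \<open>star a * a\<close>.\<close>

lemma bnd_if_norm_le:
  assumes a: "a \<in> op_algebra M" and r: "norm (op_of a) \<le> r"
  shows "bnd a r"
proof (rule bnd_if_powers[OF a])
  show r0: "0 \<le> r"
    using r norm_ge_zero order_trans by blast
  obtain C where C: "0 \<le> C" "\<And>T. T \<in> M \<Longrightarrow> cmod (\<tau> T) \<le> C * norm T"
    using trace_bounds by blast
  have starnorm: "norm (op_of (star c)) \<le> norm (op_of c)" for c :: "'h cop"
    by (simp add: star_cop.rep_eq norm_op_adjoint_le complex_linear_op_of)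
  have multnorm: "norm (op_of (c * d)) \<le> norm (op_of c) * norm (op_of d)" for c d :: "'h cop"
    by (simp add: times_cop.rep_eq norm_blinfun_compose)
  fix b assume b: "b \<in> op_algebra M"
  define P where "P = star a * a"
  have P: "P \<in> op_algebra M" using a by (simp add: P_def)
  have "norm (op_of P) \<le> norm (op_of (star a)) * norm (op_of a)"
    unfolding P_def by (rule multnorm)
  also have "\<dots> \<le> r * r"
    using r starnorm[of a] r0 by (intro mult_mono) auto
  finally have P': "norm (op_of P) \<le> r\<^sup>2"
    by (simp add: power2_eq_square)
  have Pn: "norm (op_of (P ^ n * b)) \<le> (r\<^sup>2) ^ n * norm (op_of b)" for n
  proof (induction n)
    case (Suc n)
    have "norm (op_of (P ^ Suc n * b)) \<le> norm (op_of P) * norm (op_of (P ^ n * b))"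
      using multnorm[of P "P ^ n * b"] by (simp add: mult.assoc)
    also have "\<dots> \<le> r\<^sup>2 * ((r\<^sup>2) ^ n * norm (op_of b))"
      using P' Suc by (intro mult_mono) auto
    finally show ?case by (simp add: mult.assoc)
  qed simp
  have "ip (P ^ n * b) b \<le> (C * norm (op_of (star b)) * norm (op_of b)) * (r\<^sup>2) ^ n" for n
  proof -
    have "ip (P ^ n * b) b \<le> cmod (\<tau> (op_of (star b * (P ^ n * b))))"
      unfolding ip_def op_trace_def by (rule complex_Re_le_cmod)
    also have "\<dots> \<le> C * norm (op_of (star b * (P ^ n * b)))"
      using P b by (intro C(2)) (simp add: op_algebra_iff[symmetric])
    also have "\<dots> \<le> C * (norm (op_of (star b)) * ((r\<^sup>2) ^ n * norm (op_of b)))"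
      by (intro mult_left_mono order_trans[OF multnorm] Pn C) auto
    finally show ?thesis by (simp add: mult_ac)
  qed
  then show "\<exists>C. \<forall>n. ip ((star a * a) ^ n * b) b \<le> C * (r\<^sup>2) ^ n"
    unfolding P_def by blast
qed

text \<open>The value 0 beyond the length of ys only completes the assignment: the approximating
  polynomials have their variables below that length.\<close>

lemma dense_polynomials:
  fixes ys :: "('h \<Rightarrow>\<^sub>L 'h) list"
  defines "v \<equiv> \<lambda>i. if i < length ys then Abs_cop (ys ! i) else 0"
  assumes gen: "generates ys M" and a: "a \<in> op_algebra M"
  shows "limit_poly (length ys) v a"
proof -
  have ysM: "set ys \<subseteq> M"
    using gen hull_subset[of "set ys" von_neumann_algebra] unfolding generates_def by simp
  define R where "R = (\<Sum>T\<leftarrow>ys. norm T)"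
  have R0: "0 \<le> R" unfolding R_def by (intro sum_list_nonneg) auto
  have v: "bnd (v i) R" for i
  proof (cases "i < length ys")
    case True
    then have "ys ! i \<in> M" using ysM by auto
    moreover have "norm (ys ! i) \<le> R"
      unfolding R_def using True by (intro member_le_sum_list) auto
    ultimately show ?thesis
      using True by (intro bnd_if_norm_le) (auto simp: v_def op_algebra_iff op_of_Abs linear)
  qed (use R0 in \<open>simp add: v_def bnd_zero\<close>)
  have vA: "v i \<in> op_algebra M" for i
    using bnd_closed[OF v] .
  define L where "L = {a. limit_poly (length ys) v a}"
  define N where "N = op_of ` L"
  have LA: "a \<in> op_algebra M" if "a \<in> L" for a
    using that limit_poly_closed by (simp add: L_def)
  \<comment> \<open>Limits stay in M and therefore have a norm bound, which
    \<open>limit_poly_mult\<close> requires of its right factor.\<close>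
  have bndL: "bnd a (norm (op_of a))" if "a \<in> L" for a
    using LA[OF that] by (intro bnd_if_norm_le) auto
  have NM: "N \<subseteq> M"
    using LA by (auto simp: N_def op_algebra_iff)
  have oneL: "1 \<in> L"
    using limit_poly_eval[OF vA, of "Const 1" "length ys"] by (simp add: L_def)
  have addL: "a + b \<in> L" if "a \<in> L" "b \<in> L" for a b
    using that limit_poly_add[OF v] by (simp add: L_def)
  have sclL: "scl c a \<in> L" if "a \<in> L" for a c
    using that limit_poly_scl[OF v] by (simp add: L_def)
  have starL: "star a \<in> L" if "a \<in> L" for a
    using that limit_poly_star[OF v] by (simp add: L_def)
  have multL: "a * b \<in> L" if "a \<in> L" "b \<in> L" for a b
    using that limit_poly_mult[OF v _ _ bndL[OF that(2)]] by (simp add: L_def)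
  have N_one: "id_blinfun \<in> N"
    unfolding N_def using oneL one_cop.rep_eq by (metis image_eqI)
  have N_add: "S + T \<in> N" if "S \<in> N" "T \<in> N" for S T
    using that addL unfolding N_def by (force simp: plus_cop.rep_eq[symmetric])
  have N_scl: "op_scaleC c T \<in> N" if "T \<in> N" for c T
    using that sclL unfolding N_def by (force simp: scl_cop.rep_eq[symmetric])
  have N_comp: "S o\<^sub>L T \<in> N" if "S \<in> N" "T \<in> N" for S T
    using that multL unfolding N_def by (force simp: times_cop.rep_eq[symmetric])
  have N_adj: "op_adjoint T \<in> N" if "T \<in> N" for T
    using that starL unfolding N_def by (force simp: star_cop.rep_eq[symmetric])
  have "strong_operator_topology closure_of N \<subseteq> N"
  proof
    fix T assume T: "T \<in> strong_operator_topology closure_of N"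
    have "strong_operator_topology closure_of N \<subseteq> M"
      by (rule closure_of_minimal[OF NM closed_mem])
    then have TM: "T \<in> M" using T by blast
    \<comment> \<open>A strong neighbourhood of T for two vectors, indexed by the booleans.\<close>
    have near: "\<exists>S\<in>N. norm (blinfun_apply S x - blinfun_apply T x) < e \<and>
        norm (blinfun_apply S y - blinfun_apply T y) < e" if e: "0 < e" for x y e
    proof -
      define U where "U = {S. \<forall>b\<in>UNIV. blinfun_apply S (if b then x else y) \<in>
          ball (blinfun_apply T (if b then x else y)) e}"
      have "openin strong_operator_topology U"
        unfolding U_def by (rule strong_operator_topology_basis) auto
      moreover have "T \<in> U"
        using e by (simp add: U_def)
      ultimately obtain S where "S \<in> N" "S \<in> U"
        using T unfolding in_closure_of by blast
      then show ?thesis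
        by (intro bexI[of _ S]) (auto simp: U_def dist_norm norm_minus_commute all_bool_eq split: if_splits)
    qed
    obtain \<zeta> :: "'h ell2" where \<zeta>: "\<And>T. T \<in> M \<Longrightarrow> Re (\<tau> (op_adjoint T o\<^sub>L T)) \<le> (norm (amp T \<zeta>))\<^sup>2"
      using trace_bounds by blast
    have scaleR: "r *\<^sub>R S = op_scaleC (of_real r) S" for r and S :: "'h \<Rightarrow>\<^sub>L 'h"
      by (rule blinfun_eqI) (simp add: op_scaleC_apply scaleR_scaleC blinfun.scaleR_left)
    have "limit_poly (length ys) v (Abs_cop T)"
    proof (rule limit_poly_closure[OF vA])
      show "Abs_cop T \<in> op_algebra M"
        using TM by (simp add: op_algebra_iff op_of_Abs linear)
      fix \<delta> :: real assume \<delta>: "0 < \<delta>"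
      \<comment> \<open>T is matched at \<zeta>, which dominates the trace, so a small error there
        is a small 2-norm.\<close>
      have "\<exists>S\<in>N. norm (amp S \<zeta> - amp T \<zeta>) < \<delta>"
      proof (rule approximate_amplification[OF N_one N_add _ N_comp _ near \<delta>])
        fix S assume S: "S \<in> N"
        show "r *\<^sub>R S \<in> N" for r
          unfolding scaleR using N_scl[OF S] .
        have "rip (blinfun_apply S x) y = rip x (blinfun_apply (op_adjoint S) y)" for x y
          using cinner_op_adjoint[OF linear, of S x y] S NM by (auto simp: rip_def)
        then show "\<exists>S'\<in>N. \<forall>x y. rip (blinfun_apply S x) y = rip x (blinfun_apply S' y)"
          using N_adj[OF S] by blast
      qed
      then obtain S where S: "S \<in> N" "norm (amp S \<zeta> - amp T \<zeta>) < \<delta>" by blast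
      obtain b where b: "b \<in> L" "S = op_of b"
        using S(1) by (auto simp: N_def)
      have d: "op_of (b - Abs_cop T) = S - T"
        using TM by (simp add: minus_cop.rep_eq op_of_Abs linear b(2))
      have dA: "b - Abs_cop T \<in> op_algebra M"
        using LA[OF b(1)] TM by (intro diff_closed) (auto simp: op_algebra_iff op_of_Abs linear)
      have "amp (S - T) \<zeta> = amp S \<zeta> - amp T \<zeta>"
        by (rule ell2_eqI) (simp add: amp.rep_eq minus_ell2.rep_eq blinfun.diff_left)
      then have "Re (\<tau> (op_adjoint (S - T) o\<^sub>L (S - T))) \<le> (norm (amp S \<zeta> - amp T \<zeta>))\<^sup>2"
        using \<zeta>[of "S - T"] dA d by (simp add: op_algebra_iff)
      also have "\<dots> < \<delta>\<^sup>2"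
        using S(2) by (intro power_strict_mono) auto
      finally have "(n2 (b - Abs_cop T))\<^sup>2 < \<delta>\<^sup>2"
        using dA by (simp add: n2_power2 ip_def op_trace_def times_cop.rep_eq star_cop.rep_eq d
            del: star_diff)
      then have "n2 (b - Abs_cop T) < \<delta>"
        by (rule power_less_imp_less_base) (use \<delta> in simp)
      then show "\<exists>b. limit_poly (length ys) v b \<and> n2 (b - Abs_cop T) < \<delta>"
        using b(1) by (auto simp: L_def)
    qed
    then show "T \<in> N"
      unfolding N_def L_def using TM by (auto simp: op_of_Abs linear intro!: image_eqI[of _ _ "Abs_cop T"])
  qed
  then have N_closed: "closedin strong_operator_topology N"
    using closure_of_subset_eq[of N strong_operator_topology]
    by (simp add: strong_operator_topology_topspace)
  have "von_neumann_algebra N"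
    unfolding von_neumann_algebra_def using NM
    by (intro conjI ballI allI N_one N_add N_scl N_comp N_adj N_closed linear) auto
  moreover have "set ys \<subseteq> N"
  proof
    fix T assume T: "T \<in> set ys"
    then obtain i where i: "i < length ys" "T = ys ! i"
      by (metis in_set_conv_nth)
    have "v i \<in> L"
      using limit_poly_eval[OF vA, of "Gen i" "length ys"] i by (simp add: L_def)
    moreover have "T \<in> M" using T ysM by blast
    then have "op_of (v i) = T"
      using i linear[of T] by (simp add: v_def op_of_Abs)
    ultimately show "T \<in> N"
      unfolding N_def by blast
  qed
  ultimately have "M \<subseteq> N"
    using gen hull_minimal[of "set ys" N von_neumann_algebra] by (simp add: generates_def)
  then obtain b where "b \<in> L" "op_of a = op_of b"
    using a by (auto simp: N_def op_algebra_iff)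
  then show ?thesis
    using op_of_eqI[of a b] by (simp add: L_def)
qed

text \<open>The fixed point \<open>X\<close> of \<open>X \<mapsto> T (1 + X\<^sup>2) / 2\<close> is the preimage of \<open>T\<close> under
  \<open>t \<mapsto> 2 t / (1 + t\<^sup>2)\<close>.\<close>

lemma inverse_cutoff:
  assumes a: "a \<in> op_algebra M" "star a = a" "norm (op_of a) \<le> 1/2"
  shows "\<exists>X\<in>op_algebra M. star X = X \<and> bnd X (1/2) \<and> a * (1 + X * X) = scl 2 X"
proof -
  define T where "T = op_of a"
  have T: "T \<in> M" "norm T \<le> 1/2"
    using a by (simp_all add: T_def op_algebra_iff)
  have Tadj: "rip (blinfun_apply T x) y = rip x (blinfun_apply T y)" for x y
  proof -
    have "op_adjoint T = T"
      using a(2) unfolding T_def by (metis star_cop.rep_eq)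
    then show ?thesis
      using cinner_op_adjoint[OF linear[OF T(1)], of x y] by (simp add: rip_def)
  qed
  \<comment> \<open>Commutation with T is included because it makes T (1 + X^2) self-adjoint for
    self-adjoint X, so that f preserves D. Self-adjointness is phrased with \<open>rip\<close> to be
    a closed condition.\<close>
  define D where "D = {X \<in> M. norm X \<le> 1/2 \<and> X o\<^sub>L T = T o\<^sub>L X \<and>
      (\<forall>x y. rip (blinfun_apply X x) y = rip x (blinfun_apply X y))}"
  define f where "f X = (1/2) *\<^sub>R (T o\<^sub>L (id_blinfun + (X o\<^sub>L X)))" for X
  have scaleR_mem: "r *\<^sub>R S \<in> M" if "S \<in> M" for r S
  proof -
    have "r *\<^sub>R S = op_scaleC (of_real r) S"
      by (rule blinfun_eqI) (simp add: op_scaleC_apply scaleR_scaleC blinfun.scaleR_left)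
    then show ?thesis using scale_mem[OF that] by simp
  qed
  have ev: "continuous_on UNIV (\<lambda>X :: 'h \<Rightarrow>\<^sub>L 'h. blinfun_apply X x)" for x
    by (intro continuous_intros)
  have "closed {X. norm X \<le> 1/2 \<and> X o\<^sub>L T = T o\<^sub>L X \<and>
      (\<forall>x y. rip (blinfun_apply X x) y = rip x (blinfun_apply X y))}"
  proof (intro closed_Collect_conj closed_Collect_all closed_Collect_le closed_Collect_eq continuous_intros)
    show "continuous_on UNIV (\<lambda>X. rip (blinfun_apply X x) y)" "continuous_on UNIV (\<lambda>X. rip y (blinfun_apply X x))"
      for x y :: 'h
      by (intro bounded_linear.continuous_on[OF bounded_linear_rip_left]
          bounded_linear.continuous_on[OF bounded_linear_rip_right] ev)+
  qed
  moreover have "closed M"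
  proof -
    show ?thesis
      using closedin_continuous_map_preimage[OF strong_operator_topology_weaker_than_euclidean closed_mem]
      by simp
  qed
  ultimately have "closed (M \<inter> {X. norm X \<le> 1/2 \<and> X o\<^sub>L T = T o\<^sub>L X \<and>
      (\<forall>x y. rip (blinfun_apply X x) y = rip x (blinfun_apply X y))})"
    by (rule closed_Int[rotated])
  moreover have "D = M \<inter> {X. norm X \<le> 1/2 \<and> X o\<^sub>L T = T o\<^sub>L X \<and>
      (\<forall>x y. rip (blinfun_apply X x) y = rip x (blinfun_apply X y))}"
    unfolding D_def by blast
  ultimately have "complete D"
    by (simp only: complete_eq_closed)
  moreover have "D \<noteq> {}"
  proof -
    have "0 \<in> D"
      using zero_mem rip_commute[of _ 0]
      by (auto simp: D_def rip_zero_left intro!: blinfun_eqI)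
    then show ?thesis by blast
  qed
  moreover have "f ` D \<subseteq> D"
  proof safe
    fix X assume X: "X \<in> D"
    then have XM: "X \<in> M" and Xn: "norm X \<le> 1/2" and Xc: "X o\<^sub>L T = T o\<^sub>L X"
      and Xa: "\<And>x y. rip (blinfun_apply X x) y = rip x (blinfun_apply X y)"
      by (auto simp: D_def)
    have c: "blinfun_apply X (blinfun_apply T x) = blinfun_apply T (blinfun_apply X x)" for x
      using arg_cong[OF Xc, of "\<lambda>S. blinfun_apply S x"] by simp
    have "f X \<in> M"
      unfolding f_def by (intro scaleR_mem comp_mem add_mem id_mem T XM)
    moreover have "norm (f X) \<le> 1/2"
    proof -
      have "norm (id_blinfun + (X o\<^sub>L X)) \<le> 1 + 1/2 * (1/2)"
        by (intro order_trans[OF norm_triangle_ineq] add_mono norm_blinfun_id_le blinfun_compose_mono Xn)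
      then have "norm (T o\<^sub>L (id_blinfun + (X o\<^sub>L X))) \<le> 1/2 * (1 + 1/2 * (1/2))"
        by (intro blinfun_compose_mono T)
      then show ?thesis by (simp add: f_def)
    qed
    moreover have "f X o\<^sub>L T = T o\<^sub>L f X"
      by (rule blinfun_eqI) (simp add: f_def blinfun.add_left blinfun.add_right blinfun.scaleR_left
          blinfun.scaleR_right c)
    moreover have "rip (blinfun_apply (f X) x) y = rip x (blinfun_apply (f X) y)" for x y
      by (simp add: f_def blinfun.add_left blinfun.add_right blinfun.scaleR_left rip_scaleR_left
          rip_scaleR_right rip_add_left rip_add_right Tadj Xa c)
    ultimately show "f X \<in> D"
      by (simp add: D_def)
  qed
  moreover have "dist (f X) (f Y) \<le> 1/2 * dist X Y" if "X \<in> D" "Y \<in> D" for X Y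
  proof -
    have n: "norm X \<le> 1/2" "norm Y \<le> 1/2" using that by (auto simp: D_def)
    \<comment> \<open>X^2 - Y^2 is split as X (X - Y) + (X - Y) Y; with all norms at most 1/2 the
      contraction factor is even 1/4.\<close>
    have "f X - f Y = (1/2) *\<^sub>R (T o\<^sub>L ((X o\<^sub>L (X - Y)) + ((X - Y) o\<^sub>L Y)))"
      by (rule blinfun_eqI) (simp add: f_def blinfun.add_left blinfun.diff_left blinfun.add_right
          blinfun.diff_right blinfun.scaleR_left scaleR_diff_right[symmetric])
    moreover have "norm (T o\<^sub>L ((X o\<^sub>L (X - Y)) + ((X - Y) o\<^sub>L Y)))
        \<le> 1/2 * (1/2 * norm (X - Y) + norm (X - Y) * (1/2))"
      by (intro blinfun_compose_mono order_trans[OF norm_triangle_ineq] add_mono T n) auto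
    moreover have "0 \<le> norm (X - Y)" by simp
    ultimately show ?thesis
      unfolding dist_norm by (simp del: norm_ge_zero)
  qed
  ultimately obtain X where X: "X \<in> D" "f X = X"
    using Banach_fix[of D "1/2" f] by auto
  define x where "x = Abs_cop X"
  have XM: "X \<in> M" using X by (simp add: D_def)
  have x: "op_of x = X"
    using XM by (simp add: x_def op_of_Abs linear)
  have "op_adjoint X = X"
    using X(1) XM by (intro op_adjoint_eqI cinner_adjointI linear) (auto simp: D_def)
  then have "star x = x"
    by (intro op_of_eqI) (simp add: star_cop.rep_eq x)
  moreover have "x \<in> op_algebra M"
    by (simp add: op_algebra_iff x XM)
  moreover have "bnd x (1/2)"
    using X(1) \<open>x \<in> op_algebra M\<close> by (intro bnd_if_norm_le) (auto simp: x D_def)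
  moreover have "a * (1 + x * x) = scl 2 x"
  proof (rule op_of_eqI, rule blinfun_eqI)
    fix h
    have "2 *\<^sub>C X h = 2 *\<^sub>R blinfun_apply (f X) h"
      using scaleR_scaleC[of 2 "blinfun_apply X h"] X(2) by simp
    also have "\<dots> = blinfun_apply T (h + blinfun_apply X (blinfun_apply X h))"
      unfolding f_def by (simp add: blinfun.scaleR_left blinfun.add_left)
    finally show "blinfun_apply (op_of (a * (1 + x * x))) h = blinfun_apply (op_of (scl 2 x)) h"
      by (simp add: times_cop.rep_eq plus_cop.rep_eq one_cop.rep_eq scl_cop.rep_eq x
          op_scaleC_apply blinfun.add_left T_def)
  qed
  ultimately show ?thesis by blast
qed

text \<open>What is approximated is the preimage X of a under the cutoff function. The self-adjoint
  part of the approximant may have a large bound K, yet its cutoff has bound 3 and is close to a.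
  The bound 3 persists in every tracial algebra whose generators obey R, because K is computed from
  R and the syntax of q.\<close>

lemma uniformly_bounded_approximation_selfadjoint:
  fixes v :: "nat \<Rightarrow> 'h cop" and n :: nat
  assumes dense: "\<And>b. b \<in> op_algebra M \<Longrightarrow> limit_poly n v b"
    and v: "\<And>i. bnd (v i) R"
    and a: "a \<in> op_algebra M" "star a = a" "norm (op_of a) \<le> 1/2" and \<delta>: "0 < \<delta>"
  shows "\<exists>p. gens p \<subseteq> {..<n} \<and> n2 (eval v p - a) < \<delta> \<and> bnd (eval v p) 3 \<and>
    (\<forall>(B :: 'b::star_algebra set) tr u. tracial_algebra B tr \<longrightarrow> (\<forall>i. tracial_algebra.bnd B tr (u i) R) \<longrightarrow>
       tracial_algebra.bnd B tr (eval u p) 3)"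
proof -
  obtain X where X: "X \<in> op_algebra M" "star X = X" "bnd X (1/2)" "a * (1 + X * X) = scl 2 X"
    using inverse_cutoff[OF a] by blast
  \<comment> \<open>\<open>cutoff_close\<close> multiplies the two errors by 8, so that together
    they stay below \<delta> / 2.\<close>
  obtain q where q: "gens q \<subseteq> {..<n}" "n2 (eval v q - X) < \<delta> / 32"
    using limit_polyD[OF dense[OF X(1)], of "\<delta> / 32"] \<delta> by auto
  define K where "K = poly_bound R (real_part_poly q)"
  define S where "S = eval v (real_part_poly q)"
  have S: "star S = S" "bnd S K"
    unfolding S_def K_def by (simp_all add: star_eval_real_part_poly bnd_eval v)
  have "S - X = scl (1/2) ((eval v q - X) + star (eval v q - X))"
  proof -
    have "X = scl (1/2) X + scl (1/2) X"
      by (simp flip: scl_add_left)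
    then show ?thesis
      using X(2) by (simp add: S_def eval_real_part_poly scl_add_right scl_diff_right algebra_simps)
  qed
  moreover have A: "eval v q - X \<in> op_algebra M"
    using X(1) bnd_closed[OF bnd_eval[OF v]] by auto
  ultimately have "n2 (S - X) \<le> 1/2 * (n2 (eval v q - X) + n2 (star (eval v q - X)))"
    using n2_triangle[of "eval v q - X" "star (eval v q - X)"] by (simp add: n2_scl del: star_diff)
  then have SX: "n2 (S - X) < \<delta> / 32"
    using q(2) n2_star[OF A] by (simp del: star_diff)
  have "0 \<le> K\<^sup>2 / (1 + K\<^sup>2)" "K\<^sup>2 / (1 + K\<^sup>2) < 1"
    by (simp_all add: add_pos_nonneg divide_simps)
  then have "(\<lambda>N. (K\<^sup>2 / (1 + K\<^sup>2)) ^ N) \<longlonglongrightarrow> 0"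
    by (intro LIMSEQ_realpow_zero) auto
  then have "eventually (\<lambda>N. (K\<^sup>2 / (1 + K\<^sup>2)) ^ N < min (1/4) (\<delta> / 32)) sequentially"
    using \<delta> by (intro order_tendstoD) auto
  then obtain N where N: "(K\<^sup>2 / (1 + K\<^sup>2)) ^ N < min (1/4) (\<delta> / 32)"
    using eventually_happens'[OF sequentially_bot] by blast
  define p where "p = cutoff_poly (real_part_poly q) K N"
  have "n2 (eval v p - a) \<le> 8 * n2 (S - X) + 8 * (K\<^sup>2 / (1 + K\<^sup>2)) ^ N"
    unfolding p_def eval_cutoff_poly S_def[symmetric]
    using N by (intro cutoff_close[OF S] X a) auto
  then have "n2 (eval v p - a) < \<delta>"
    using N SX \<delta> by auto
  moreover have "bnd (eval v p) 3"
    unfolding p_def eval_cutoff_poly S_def[symmetric] by (rule bnd_cutoff[OF S])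
  moreover have "tracial_algebra.bnd B tr (eval u p) 3"
    if "tracial_algebra B tr" "\<forall>i. tracial_algebra.bnd B tr (u i) R"
    for B :: "'b set" and tr u
  proof -
    interpret B: tracial_algebra B tr by fact
    show ?thesis
      unfolding p_def eval_cutoff_poly K_def
      using that by (intro B.bnd_cutoff star_eval_real_part_poly B.bnd_eval) auto
  qed
  moreover have "gens p \<subseteq> {..<n}"
    using gens_cutoff_poly[of "real_part_poly q" K N] q(1) by (simp add: p_def)
  ultimately show ?thesis
    by (intro exI[of _ p]) auto
qed

text \<open>The bound must depend neither on \<open>R\<close> nor on \<open>\<delta>\<close>, because the radius of the microstates of
  the generators is fixed before the accuracy is chosen.\<close>

lemma uniformly_bounded_approximation:
  fixes v :: "nat \<Rightarrow> 'h cop" and n :: nat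
  assumes dense: "\<And>b. b \<in> op_algebra M \<Longrightarrow> limit_poly n v b"
    and v: "\<And>i. bnd (v i) R"
    and a: "a \<in> op_algebra M" and \<delta>: "0 < \<delta>"
  shows "\<exists>p. gens p \<subseteq> {..<n} \<and> n2 (eval v p - a) < \<delta> \<and> bnd (eval v p) (12 * (norm (op_of a) + 1)) \<and>
    (\<forall>(B :: 'b::star_algebra set) tr u. tracial_algebra B tr \<longrightarrow> (\<forall>i. tracial_algebra.bnd B tr (u i) R) \<longrightarrow>
       tracial_algebra.bnd B tr (eval u p) (12 * (norm (op_of a) + 1)))"
proof -
  \<comment> \<open>Division by c brings the real and imaginary parts of a to norm at most 1/2.
    Recombining costs 3 c for each part, altogether
    \<open>12 * (norm (op_of a) + 1)\<close>.\<close>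
  define c where "c = 2 * (norm (op_of a) + 1)"
  have c: "0 < c"
    by (simp add: c_def add_nonneg_pos)
  have starnorm: "norm (op_of (star a)) \<le> norm (op_of a)"
    by (simp add: star_cop.rep_eq norm_op_adjoint_le complex_linear_op_of)
  have sclnorm: "norm (op_of (scl r b)) \<le> cmod r * norm (op_of b)" for r and b :: "'h cop"
  proof (rule norm_blinfun_bound)
    fix x
    have "norm (blinfun_apply (op_of b) x) \<le> norm (op_of b) * norm x"
      by (rule norm_blinfun)
    then show "norm (blinfun_apply (op_of (scl r b)) x) \<le> cmod r * norm (op_of b) * norm x"
      by (simp add: scl_cop.rep_eq op_scaleC_apply norm_scaleC mult.assoc mult_left_mono)
  qed simp
  have small: "norm (op_of (scl r b)) \<le> 1/2" if "norm (op_of b) \<le> 2 * norm (op_of a)" "cmod r = 1 / (2 * c)"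
    for r and b :: "'h cop"
  proof -
    have "norm (op_of (scl r b)) \<le> 1 / (2 * c) * (2 * norm (op_of a))"
      using sclnorm[of r b] that mult_left_mono[OF that(1), of "1 / (2 * c)"] c by simp
    also have "\<dots> \<le> 1/2"
      using c unfolding c_def by (simp add: divide_simps)
    finally show ?thesis .
  qed
  define a1 where "a1 = scl (1 / (2 * of_real c)) (a + star a)"
  define a2 where "a2 = scl (- \<i> / (2 * of_real c)) (a - star a)"
  have n1: "norm (op_of a1) \<le> 1/2"
    unfolding a1_def using starnorm c norm_triangle_ineq[of "op_of a" "op_of (star a)"]
    by (intro small) (auto simp: plus_cop.rep_eq norm_divide norm_mult)
  have n2': "norm (op_of a2) \<le> 1/2"
    unfolding a2_def using starnorm c norm_triangle_ineq4[of "op_of a" "op_of (star a)"]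
    by (intro small) (auto simp: minus_cop.rep_eq norm_divide norm_mult)
  have s1: "star a1 = a1"
    by (simp add: a1_def add.commute)
  have s2: "star a2 = a2"
    by (simp add: a2_def scl_diff_right scl_minus_left)
  have A: "a1 \<in> op_algebra M" "a2 \<in> op_algebra M"
    using a by (simp_all add: a1_def a2_def)
  have dec: "a = scl (of_real c) a1 + scl (\<i> * of_real c) a2"
  proof -
    have "scl (of_real c) a1 = scl (1/2) (a + star a)" "scl (\<i> * of_real c) a2 = scl (1/2) (a - star a)"
      using c by (simp_all add: a1_def a2_def field_simps)
    then have "scl (of_real c) a1 + scl (\<i> * of_real c) a2 = scl (1/2) a + scl (1/2) a"
      by (simp add: scl_add_right scl_diff_right)
    also have "\<dots> = a" by (simp flip: scl_add_left)
    finally show ?thesis by simp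
  qed
  define \<delta>' where "\<delta>' = \<delta> / (2 * c)"
  have \<delta>': "0 < \<delta>'" using \<delta> c by (simp add: \<delta>'_def)
  obtain p1 where p1: "gens p1 \<subseteq> {..<n}" "n2 (eval v p1 - a1) < \<delta>'" "bnd (eval v p1) 3"
    "\<forall>(B :: 'b set) tr u. tracial_algebra B tr \<longrightarrow> (\<forall>i. tracial_algebra.bnd B tr (u i) R) \<longrightarrow>
       tracial_algebra.bnd B tr (eval u p1) 3"
    using uniformly_bounded_approximation_selfadjoint[OF dense v A(1) s1 n1 \<delta>', where ?'b = 'b] by auto
  obtain p2 where p2: "gens p2 \<subseteq> {..<n}" "n2 (eval v p2 - a2) < \<delta>'" "bnd (eval v p2) 3"
    "\<forall>(B :: 'b set) tr u. tracial_algebra B tr \<longrightarrow> (\<forall>i. tracial_algebra.bnd B tr (u i) R) \<longrightarrow>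
       tracial_algebra.bnd B tr (eval u p2) 3"
    using uniformly_bounded_approximation_selfadjoint[OF dense v A(2) s2 n2' \<delta>', where ?'b = 'b] by auto
  define p where "p = Plus (Times (Const (of_real c)) p1) (Times (Const (\<i> * of_real c)) p2)"
  have ev: "eval u p = scl (of_real c) (eval u p1) + scl (\<i> * of_real c) (eval u p2)"
    for u :: "nat \<Rightarrow> 'z::star_algebra"
    by (simp add: p_def)
  have c6: "12 * (norm (op_of a) + 1) = cmod (of_real c) * 3 + cmod (\<i> * of_real c) * 3"
    using c(1) by (simp add: norm_mult) (simp add: c_def)
  have "bnd (eval v p) (12 * (norm (op_of a) + 1))"
    unfolding ev c6 by (intro bnd_add bnd_scl p1 p2)
  moreover have "tracial_algebra.bnd B tr (eval u p) (12 * (norm (op_of a) + 1))"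
    if "tracial_algebra B tr" "\<forall>i. tracial_algebra.bnd B tr (u i) R"
    for B :: "'b set" and tr u
  proof -
    interpret B: tracial_algebra B tr by fact
    have "B.bnd (eval u p1) 3" "B.bnd (eval u p2) 3"
      using p1(4) p2(4) that by auto
    then show ?thesis
      unfolding ev c6 by (intro B.bnd_add B.bnd_scl)
  qed
  moreover have "n2 (eval v p - a) < \<delta>"
  proof -
    have "eval v p - a = scl (of_real c) (eval v p1 - a1) + scl (\<i> * of_real c) (eval v p2 - a2)"
      unfolding ev by (subst dec) (simp add: scl_diff_right algebra_simps)
    moreover have B: "eval v p1 - a1 \<in> op_algebra M" "eval v p2 - a2 \<in> op_algebra M"
      using p1(3) p2(3) A by auto
    ultimately have "n2 (eval v p - a) \<le> c * n2 (eval v p1 - a1) + c * n2 (eval v p2 - a2)"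
      using n2_triangle[of "scl (of_real c) (eval v p1 - a1)" "scl (\<i> * of_real c) (eval v p2 - a2)"] c
      by (simp add: n2_scl norm_mult)
    also have "\<dots> < c * \<delta>' + c * \<delta>'"
      using c p1(2) p2(2) by (intro add_strict_mono mult_strict_left_mono) auto
    also have "\<dots> = \<delta>" using c by (simp add: \<delta>'_def)
    finally show ?thesis .
  qed
  moreover have "gens p \<subseteq> {..<n}"
    using p1(1) p2(1) by (simp add: p_def)
  ultimately show ?thesis
    by (intro exI[of _ p]) auto
qed

end

section \<open>Matrices and orbit covers\<close>

lemma mat_adjoint_carrier: "A \<in> carrier_mat n m \<Longrightarrow> mat_adjoint A \<in> carrier_mat m n"
  by (auto simp: mat_adjoint_def)

lemma mat_adjoint_index:
  assumes "A \<in> carrier_mat n m" "i < m" "j < n"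
  shows "mat_adjoint A $$ (i, j) = cnj (A $$ (j, i))"
  using assms by (simp add: mat_adjoint_def mat_of_rows_index)

lemma dim_mat_adjoint [simp]:
  "dim_row (mat_adjoint A) = dim_col A" "dim_col (mat_adjoint A) = dim_row A"
  by (simp_all add: mat_adjoint_def)

lemma mult_mat_index:
  assumes "A \<in> carrier_mat n m" "B \<in> carrier_mat m l" "i < n" "j < l"
  shows "(A * B) $$ (i, j) = (\<Sum>k<m. A $$ (i, k) * B $$ (k, j))"
  using assms by (simp add: scalar_prod_def atLeast0LessThan)

lemma mat_adjoint_mult:
  assumes "A \<in> carrier_mat n m" "B \<in> carrier_mat m l"
  shows "mat_adjoint (A * B) = mat_adjoint B * (mat_adjoint A :: complex mat)"
proof (rule eq_matI)
  fix i j assume "i < dim_row (mat_adjoint B * mat_adjoint A)" "j < dim_col (mat_adjoint B * mat_adjoint A)"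
  then have ij: "i < l" "j < n" using assms by auto
  show "mat_adjoint (A * B) $$ (i, j) = (mat_adjoint B * mat_adjoint A) $$ (i, j)"
    using assms ij mult_mat_index[OF assms ij(2,1)]
      mult_mat_index[OF mat_adjoint_carrier[OF assms(2)] mat_adjoint_carrier[OF assms(1)] ij]
    by (simp add: mat_adjoint_index[of "A * B" n l] mat_adjoint_index[of A n m] mat_adjoint_index[of B m l]
        mult.commute del: index_mult_mat)
qed (use assms in auto)

lemma mat_adjoint_adjoint: "mat_adjoint (mat_adjoint A) = (A :: complex mat)"
proof (rule eq_matI)
  fix i j assume ij: "i < dim_row A" "j < dim_col A"
  have A: "A \<in> carrier_mat (dim_row A) (dim_col A)" by simp
  show "mat_adjoint (mat_adjoint A) $$ (i, j) = A $$ (i, j)"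
    using mat_adjoint_index[OF mat_adjoint_carrier[OF A] ij] mat_adjoint_index[OF A ij(2,1)] by simp
qed auto

lemma mat_adjoint_add:
  assumes "A \<in> carrier_mat n m" "B \<in> carrier_mat n m"
  shows "mat_adjoint (A + B) = mat_adjoint A + (mat_adjoint B :: complex mat)"
  using assms by (intro eq_matI) (auto simp: mat_adjoint_index[of _ n m])

lemma mat_adjoint_smult:
  assumes "A \<in> carrier_mat n m"
  shows "mat_adjoint (c \<cdot>\<^sub>m A) = cnj c \<cdot>\<^sub>m (mat_adjoint A :: complex mat)"
  using assms by (intro eq_matI) (auto simp: mat_adjoint_index[of _ n m])

text \<open>Sequences with one square matrix of each size form a single star-algebra type in which the
  matrix algebras of all sizes live.\<close>

typedef mat_family = "{f :: nat \<Rightarrow> complex mat. \<forall>k. f k \<in> carrier_mat k k}"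
  morphisms mat_at Abs_mat_family
  by (rule exI[of _ "\<lambda>k. 0\<^sub>m k k"]) simp

setup_lifting type_definition_mat_family

lemma mat_at_carrier [simp]: "mat_at a k \<in> carrier_mat k k"
  using mat_at[of a] by simp

lemma mat_at_dim [simp]: "dim_row (mat_at a k) = k" "dim_col (mat_at a k) = k"
  using carrier_matD[OF mat_at_carrier[of a k]] by simp_all

lemma mat_family_eqI: "(\<And>k. mat_at a k = mat_at b k) \<Longrightarrow> a = b"
  by (simp add: mat_at_inject[symmetric] fun_eq_iff)

instantiation mat_family :: star_algebra
begin

lift_definition zero_mat_family :: mat_family is "\<lambda>k. 0\<^sub>m k k" by simp
lift_definition one_mat_family :: mat_family is "\<lambda>k. 1\<^sub>m k" by simp
lift_definition plus_mat_family :: "mat_family \<Rightarrow> mat_family \<Rightarrow> mat_family" is "\<lambda>f g k. f k + g k" by simp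
lift_definition uminus_mat_family :: "mat_family \<Rightarrow> mat_family" is "\<lambda>f k. - f k" by simp
lift_definition minus_mat_family :: "mat_family \<Rightarrow> mat_family \<Rightarrow> mat_family" is "\<lambda>f g k. f k - g k"
  by (simp add: minus_carrier_mat)
lift_definition times_mat_family :: "mat_family \<Rightarrow> mat_family \<Rightarrow> mat_family" is "\<lambda>f g k. f k * g k"
  by (meson mult_carrier_mat)
lift_definition scl_mat_family :: "complex \<Rightarrow> mat_family \<Rightarrow> mat_family" is "\<lambda>c f k. c \<cdot>\<^sub>m f k" by simp
lift_definition star_mat_family :: "mat_family \<Rightarrow> mat_family" is "\<lambda>f k. mat_adjoint (f k)"
  by (simp add: mat_adjoint_carrier)

instance
proof
  fix a b c :: mat_family and r s :: complex
  show "a + b + c = a + (b + c)"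
    by (rule mat_family_eqI) (simp add: plus_mat_family.rep_eq assoc_add_mat[OF mat_at_carrier mat_at_carrier mat_at_carrier])
  show "a + b = b + a"
    by (rule mat_family_eqI) (simp add: plus_mat_family.rep_eq comm_add_mat[OF mat_at_carrier mat_at_carrier])
  show "0 + a = a"
    by (rule mat_family_eqI) (simp add: plus_mat_family.rep_eq zero_mat_family.rep_eq)
  show "- a + a = 0"
    by (rule mat_family_eqI)
      (simp add: plus_mat_family.rep_eq zero_mat_family.rep_eq uminus_mat_family.rep_eq uminus_l_inv_mat[OF mat_at_carrier])
  show "a - b = a + - b"
    by (rule mat_family_eqI)
      (simp add: plus_mat_family.rep_eq minus_mat_family.rep_eq uminus_mat_family.rep_eq add_uminus_minus_mat[OF mat_at_carrier mat_at_carrier])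
  show "a * b * c = a * (b * c)"
    by (rule mat_family_eqI) (simp add: times_mat_family.rep_eq assoc_mult_mat[OF mat_at_carrier mat_at_carrier mat_at_carrier])
  show "(a + b) * c = a * c + b * c"
    by (rule mat_family_eqI) (simp add: times_mat_family.rep_eq plus_mat_family.rep_eq
        add_mult_distrib_mat[OF mat_at_carrier mat_at_carrier mat_at_carrier])
  show "a * (b + c) = a * b + a * c"
    by (rule mat_family_eqI) (simp add: times_mat_family.rep_eq plus_mat_family.rep_eq
        mult_add_distrib_mat[OF mat_at_carrier mat_at_carrier mat_at_carrier])
  show "1 * a = a" "a * 1 = a"
    by (rule mat_family_eqI, simp add: times_mat_family.rep_eq one_mat_family.rep_eq
        left_mult_one_mat[OF mat_at_carrier] right_mult_one_mat[OF mat_at_carrier])+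
  show "scl r (a + b) = scl r a + scl r b"
    by (rule mat_family_eqI) (simp add: plus_mat_family.rep_eq scl_mat_family.rep_eq
        add_smult_distrib_left_mat[OF mat_at_carrier mat_at_carrier])
  show "scl (r + s) a = scl r a + scl s a"
    by (rule mat_family_eqI) (simp add: plus_mat_family.rep_eq scl_mat_family.rep_eq
        add_smult_distrib_right_mat[OF mat_at_carrier])
  show "scl r (scl s a) = scl (r * s) a"
    by (rule mat_family_eqI) (auto simp: scl_mat_family.rep_eq intro!: eq_matI)
  show "scl 1 a = a"
    by (rule mat_family_eqI) (auto simp: scl_mat_family.rep_eq intro!: eq_matI)
  show "scl r a * b = scl r (a * b)"
    by (rule mat_family_eqI) (simp add: times_mat_family.rep_eq scl_mat_family.rep_eq
        mult_smult_assoc_mat[OF mat_at_carrier mat_at_carrier])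
  show "a * scl r b = scl r (a * b)"
    by (rule mat_family_eqI) (simp add: times_mat_family.rep_eq scl_mat_family.rep_eq
        mult_smult_distrib[OF mat_at_carrier mat_at_carrier])
  show "star (a + b) = star a + star b"
    by (rule mat_family_eqI) (simp add: plus_mat_family.rep_eq star_mat_family.rep_eq
        mat_adjoint_add[OF mat_at_carrier mat_at_carrier])
  show "star (a * b) = star b * star a"
    by (rule mat_family_eqI) (simp add: times_mat_family.rep_eq star_mat_family.rep_eq
        mat_adjoint_mult[OF mat_at_carrier mat_at_carrier])
  show "star (scl r a) = scl (cnj r) (star a)"
    by (rule mat_family_eqI) (simp add: scl_mat_family.rep_eq star_mat_family.rep_eq
        mat_adjoint_smult[OF mat_at_carrier])
  show "star (star a) = a"
    by (rule mat_family_eqI) (simp add: star_mat_family.rep_eq mat_adjoint_adjoint)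
qed

end

section \<open>Normalized trace and operator norm of matrices of a fixed size\<close>

definition family_trace :: "nat \<Rightarrow> mat_family \<Rightarrow> complex" where
  "family_trace k a = mat_ntrace (mat_at a k)"

lemma mat_ntrace_adjoint_mult:
  assumes "A \<in> carrier_mat k k"
  shows "mat_ntrace (mat_adjoint A * A) = of_real ((\<Sum>i<k. \<Sum>j<k. (cmod (A $$ (i, j)))\<^sup>2) / k)"
proof -
  have "(mat_adjoint A * A) $$ (j, j) = (\<Sum>i<k. of_real ((cmod (A $$ (i, j)))\<^sup>2))" if "j < k" for j
    using mult_mat_index[OF mat_adjoint_carrier[OF assms] assms that that] assms that
    by (simp add: mat_adjoint_index[OF assms] complex_norm_square mult.commute del: index_mult_mat of_real_power)
  then have "(\<Sum>j<k. (mat_adjoint A * A) $$ (j, j)) = (\<Sum>j<k. \<Sum>i<k. of_real ((cmod (A $$ (i, j)))\<^sup>2))"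
    by (intro sum.cong) auto
  also have "\<dots> = (\<Sum>i<k. \<Sum>j<k. of_real ((cmod (A $$ (i, j)))\<^sup>2))"
    by (rule sum.swap)
  finally show ?thesis
    using assms by (simp add: mat_ntrace_def)
qed

lemma mat_ntrace_mult_commute:
  assumes "A \<in> carrier_mat k k" "B \<in> carrier_mat k k"
  shows "mat_ntrace (A * B) = mat_ntrace (B * A)"
proof -
  have "(\<Sum>i<k. (A * B) $$ (i, i)) = (\<Sum>i<k. \<Sum>j<k. A $$ (i, j) * B $$ (j, i))"
    using mult_mat_index[OF assms] by (intro sum.cong) auto
  also have "\<dots> = (\<Sum>j<k. \<Sum>i<k. A $$ (i, j) * B $$ (j, i))"
    by (rule sum.swap)
  also have "\<dots> = (\<Sum>j<k. (B * A) $$ (j, j))"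
    using mult_mat_index[OF assms(2,1)] by (intro sum.cong) (auto simp: mult.commute)
  finally show ?thesis
    using assms by (simp add: mat_ntrace_def)
qed

text \<open>At size 0 the normalized trace of the identity would be 0 and not 1.\<close>

locale matrix_size =
  fixes k :: nat
  assumes k_pos: "0 < k"
begin

sublocale tracial_algebra UNIV "family_trace k"
proof
  fix a b :: mat_family and c
  show "family_trace k (a + b) = family_trace k a + family_trace k b"
    by (simp add: family_trace_def mat_ntrace_def plus_mat_family.rep_eq sum.distrib add_divide_distrib)
  show "family_trace k (scl c a) = c * family_trace k a"
    by (simp add: family_trace_def mat_ntrace_def scl_mat_family.rep_eq sum_distrib_left)
  show "Im (family_trace k (star a * a)) = 0 \<and> 0 \<le> Re (family_trace k (star a * a))"
    unfolding family_trace_def times_mat_family.rep_eq star_mat_family.rep_eq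
      mat_ntrace_adjoint_mult[OF mat_at_carrier] by (simp add: sum_nonneg)
  show "family_trace k 1 = 1"
    using k_pos by (simp add: family_trace_def mat_ntrace_def one_mat_family.rep_eq)
  show "family_trace k (a * b) = family_trace k (b * a)"
    unfolding family_trace_def times_mat_family.rep_eq
    by (rule mat_ntrace_mult_commute[OF mat_at_carrier mat_at_carrier])
qed auto

lemma n2_sq: "(n2 a)\<^sup>2 = Re (mat_ntrace (mat_adjoint (mat_at a k) * mat_at a k))"
  by (simp add: n2_power2 ip_def family_trace_def times_mat_family.rep_eq star_mat_family.rep_eq)

lemma n2_sq_entries: "(n2 a)\<^sup>2 = (\<Sum>i<k. \<Sum>j<k. (cmod (mat_at a k $$ (i, j)))\<^sup>2) / k"
  by (simp add: n2_sq mat_ntrace_adjoint_mult[OF mat_at_carrier])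

lemma n2_cong: "mat_at a k = mat_at b k \<Longrightarrow> n2 a = n2 b"
  using n2_sq[of a] n2_sq[of b] power2_eq_imp_eq[of "n2 a" "n2 b"] by simp

text \<open>Evaluation never mixes sizes, so the members of a family at sizes other than k may be
  arbitrary filler.\<close>

lemma eval_at_cong:
  "(\<And>i. mat_at (v i) k = mat_at (u i) k) \<Longrightarrow> mat_at (eval v p) k = mat_at (eval u p) k"
  by (induction p) (auto simp: scl_mat_family.rep_eq plus_mat_family.rep_eq times_mat_family.rep_eq
      star_mat_family.rep_eq)

lemma vec_l2norm_sq: "(vec_l2norm v)\<^sup>2 = (\<Sum>i<dim_vec v. (cmod (v $ i))\<^sup>2)"
  by (simp add: vec_l2norm_def sum_nonneg)

lemma vec_l2norm_nonneg: "0 \<le> vec_l2norm v"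
  by (simp add: vec_l2norm_def sum_nonneg)

lemma vec_l2norm_smult: "vec_l2norm (c \<cdot>\<^sub>v v) = cmod c * vec_l2norm v"
  by (simp add: vec_l2norm_def norm_mult power_mult_distrib real_sqrt_mult flip: sum_distrib_left)

text \<open>\<open>mat_opnorm\<close> is a supremum of reals and dominates its members only once the
  set is known to be bounded.\<close>

lemma opnorm_bdd_above:
  assumes "A \<in> carrier_mat k k"
  shows "bdd_above ((\<lambda>v. vec_l2norm (A *\<^sub>v v)) ` {v \<in> carrier_vec (dim_col A). vec_l2norm v \<le> 1})"
proof (rule bdd_aboveI2)
  fix v assume "v \<in> {v \<in> carrier_vec (dim_col A). vec_l2norm v \<le> 1}"
  then have v: "v \<in> carrier_vec k" "vec_l2norm v \<le> 1" using assms by auto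
  have v1: "cmod (v $ j) \<le> 1" if "j < k" for j
  proof (rule power2_le_imp_le)
    have "(cmod (v $ j))\<^sup>2 \<le> (vec_l2norm v)\<^sup>2"
      unfolding vec_l2norm_sq using v that by (intro member_le_sum[of j "{..<dim_vec v}" "\<lambda>i. (cmod (v $ i))\<^sup>2"]) auto
    also have "\<dots> \<le> 1\<^sup>2"
      using v vec_l2norm_nonneg by (intro power_mono)
    finally show "(cmod (v $ j))\<^sup>2 \<le> 1\<^sup>2" .
  qed simp
  have "cmod ((A *\<^sub>v v) $ i) \<le> (\<Sum>j<k. cmod (A $$ (i, j)))" if "i < k" for i
  proof -
    have "(A *\<^sub>v v) $ i = (\<Sum>j<k. A $$ (i, j) * v $ j)"
      using assms v that by (simp add: scalar_prod_def atLeast0LessThan)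
    also have "cmod \<dots> \<le> (\<Sum>j<k. cmod (A $$ (i, j)) * 1)"
      by (intro sum_norm_le) (auto simp: norm_mult intro!: mult_left_mono v1 mult_left_le)
    finally show ?thesis by simp
  qed
  then show "vec_l2norm (A *\<^sub>v v) \<le> sqrt (\<Sum>i<k. (\<Sum>j<k. cmod (A $$ (i, j)))\<^sup>2)"
    unfolding vec_l2norm_def using assms by (intro real_sqrt_le_mono) (auto intro!: sum_mono power_mono)
qed

lemma vec_l2norm_mult_le:
  assumes A: "A \<in> carrier_mat k k" and R: "mat_opnorm A \<le> R" and v: "v \<in> carrier_vec k"
  shows "vec_l2norm (A *\<^sub>v v) \<le> R * vec_l2norm v"
proof (cases "vec_l2norm v = 0")
  case True
  then have "(\<Sum>i<k. (cmod (v $ i))\<^sup>2) = 0"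
    using vec_l2norm_sq[of v] v by simp
  then have "v $ i = 0" if "i < k" for i
    using that by (subst (asm) sum_nonneg_eq_0_iff) auto
  then have "v = 0\<^sub>v k"
    using v by (intro eq_vecI) auto
  then have "A *\<^sub>v v = 0\<^sub>v k"
    using A by auto
  then show ?thesis
    using True by (simp add: vec_l2norm_def)
next
  case False
  define r where "r = vec_l2norm v"
  have r: "0 < r" using False vec_l2norm_nonneg[of v] by (simp add: r_def)
  define u where "u = of_real (1 / r) \<cdot>\<^sub>v v"
  have u: "u \<in> carrier_vec k" "vec_l2norm u \<le> 1"
    using v r by (simp_all add: u_def vec_l2norm_smult norm_divide) (simp add: r_def)
  have "vec_l2norm (A *\<^sub>v u) \<le> mat_opnorm A"
    unfolding mat_opnorm_def using u A by (intro cSUP_upper opnorm_bdd_above) auto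
  moreover have "A *\<^sub>v u = of_real (1 / r) \<cdot>\<^sub>v (A *\<^sub>v v)"
    unfolding u_def using A v by (intro mult_mat_vec) auto
  ultimately have "(1 / r) * vec_l2norm (A *\<^sub>v v) \<le> R"
    using R r by (simp add: vec_l2norm_smult norm_divide)
  then show ?thesis
    using r by (simp add: r_def[symmetric] divide_simps mult.commute)
qed

lemma n2_sq_cols: "(n2 b)\<^sup>2 = (\<Sum>j<k. (vec_l2norm (col (mat_at b k) j))\<^sup>2) / k"
proof -
  have "(vec_l2norm (col (mat_at b k) j))\<^sup>2 = (\<Sum>i<k. (cmod (mat_at b k $$ (i, j)))\<^sup>2)" if "j < k" for j
    using that by (simp add: vec_l2norm_sq)
  then have "(\<Sum>j<k. (vec_l2norm (col (mat_at b k) j))\<^sup>2) = (\<Sum>j<k. \<Sum>i<k. (cmod (mat_at b k $$ (i, j)))\<^sup>2)"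
    by (intro sum.cong) auto
  also have "\<dots> = (\<Sum>i<k. \<Sum>j<k. (cmod (mat_at b k $$ (i, j)))\<^sup>2)"
    by (rule sum.swap)
  finally show ?thesis by (simp add: n2_sq_entries)
qed

text \<open>Multiplication acts on each column, and \<open>n2\<close> is the quadratic mean of the
  column norms, so an operator norm bound suffices. Conversely, the matrix with all columns equal to
  v has the length of v as its 2-norm and tests the bound at v.\<close>

lemma bnd_iff_opnorm:
  assumes R: "0 \<le> R"
  shows "bnd a R \<longleftrightarrow> mat_opnorm (mat_at a k) \<le> R"
proof
  assume le: "mat_opnorm (mat_at a k) \<le> R"
  show "bnd a R"
  proof (rule bndI)
    fix b :: mat_family
    have "(vec_l2norm (col (mat_at (a * b) k) j))\<^sup>2 \<le> R\<^sup>2 * (vec_l2norm (col (mat_at b k) j))\<^sup>2" if "j < k" for j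
    proof -
      have "col (mat_at (a * b) k) j = mat_at a k *\<^sub>v col (mat_at b k) j"
        unfolding times_mat_family.rep_eq by (rule col_mult2) (use that in auto)
      then have "vec_l2norm (col (mat_at (a * b) k) j) \<le> R * vec_l2norm (col (mat_at b k) j)"
        using vec_l2norm_mult_le[OF mat_at_carrier le, of "col (mat_at b k) j"]
        by (simp add: carrier_vecI)
      then show ?thesis
        unfolding power_mult_distrib[symmetric] by (intro power_mono vec_l2norm_nonneg)
    qed
    then have "(\<Sum>j<k. (vec_l2norm (col (mat_at (a * b) k) j))\<^sup>2) \<le> (\<Sum>j<k. R\<^sup>2 * (vec_l2norm (col (mat_at b k) j))\<^sup>2)"
      by (intro sum_mono) auto
    then have "(n2 (a * b))\<^sup>2 \<le> (R * n2 b)\<^sup>2"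
      unfolding power_mult_distrib n2_sq_cols
      using divide_right_mono by (fastforce simp: sum_distrib_left[symmetric])
    then show "n2 (a * b) \<le> R * n2 b"
      by (rule power2_le_imp_le) (use R in simp)
  qed (use R in auto)
next
  assume b: "bnd a R"
  show "mat_opnorm (mat_at a k) \<le> R"
    unfolding mat_opnorm_def
  proof (rule cSUP_least)
    have "0\<^sub>v k \<in> {v \<in> carrier_vec (dim_col (mat_at a k)). vec_l2norm v \<le> 1}"
      by (simp add: vec_l2norm_def)
    then show "{v \<in> carrier_vec (dim_col (mat_at a k)). vec_l2norm v \<le> 1} \<noteq> {}"
      by blast
    fix v assume "v \<in> {v \<in> carrier_vec (dim_col (mat_at a k)). vec_l2norm v \<le> 1}"
    then have v: "v \<in> carrier_vec k" "vec_l2norm v \<le> 1" by auto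
    define c where "c = Abs_mat_family (\<lambda>l. if l = k then mat k k (\<lambda>(i, j). v $ i) else 0\<^sub>m l l)"
    have c: "mat_at c k = mat k k (\<lambda>(i, j). v $ i)"
      unfolding c_def by (subst Abs_mat_family_inverse) auto
    have cj: "col (mat_at c k) j = v" if "j < k" for j
      using v that by (intro eq_vecI) (auto simp: c)
    have "(n2 c)\<^sup>2 = (vec_l2norm v)\<^sup>2"
      unfolding n2_sq_cols using cj k_pos by simp
    moreover have "(n2 (a * c))\<^sup>2 = (vec_l2norm (mat_at a k *\<^sub>v v))\<^sup>2"
    proof -
      have "col (mat_at (a * c) k) j = mat_at a k *\<^sub>v v" if "j < k" for j
        unfolding times_mat_family.rep_eq using that cj by (subst col_mult2[of _ k k _ k]) auto
      then show ?thesis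
        unfolding n2_sq_cols using k_pos by simp
    qed
    ultimately have "n2 c = vec_l2norm v" "n2 (a * c) = vec_l2norm (mat_at a k *\<^sub>v v)"
      using vec_l2norm_nonneg by (auto simp: power2_eq_iff_nonneg)
    then have "vec_l2norm (mat_at a k *\<^sub>v v) \<le> R * vec_l2norm v"
      using bndD[OF b, of c] by simp
    also have "\<dots> \<le> R"
      using v(2) R by (simp add: mult_left_le)
    finally show "vec_l2norm (mat_at a k *\<^sub>v v) \<le> R" .
  qed
qed

end

text \<open>The filler is the identity so that a unitary matrix gives a family that is unitary at
  every size.\<close>

definition family_of :: "nat \<Rightarrow> complex mat \<Rightarrow> mat_family" where
  "family_of k A = Abs_mat_family (\<lambda>l. if l = k then A else 1\<^sub>m l)"

lemma mat_at_family_of: "A \<in> carrier_mat k k \<Longrightarrow> mat_at (family_of k A) l = (if l = k then A else 1\<^sub>m l)"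
  unfolding family_of_def by (subst Abs_mat_family_inverse) auto

text \<open>\<open>eval\<close> takes an assignment of all indices; the value 0 beyond the tuple
  obeys every norm bound.\<close>

definition tuple_family :: "nat \<Rightarrow> complex mat list \<Rightarrow> nat \<Rightarrow> mat_family" where
  "tuple_family k As i = (if i < length As then family_of k (As ! i) else 0)"

lemma tuple_family_at:
  assumes "As \<in> mat_tuples n k" "i < n"
  shows "mat_at (tuple_family k As i) k = As ! i"
  using assms by (simp add: tuple_family_def mat_tuples_def mat_at_family_of subset_eq)

lemma mat_word_eq:
  assumes "As \<in> mat_tuples n k" "\<forall>(i, s)\<in>set w. i < n"
  shows "mat_word k As w = mat_at (word_value (tuple_family k As) w) k"
  using assms(2)
proof (induction w)
  case (Cons a w)
  then show ?case
    using assms(1)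
    by (cases a) (auto simp: mat_word_def tuple_family_at times_mat_family.rep_eq star_mat_family.rep_eq)
qed (simp add: mat_word_def one_mat_family.rep_eq)

section \<open>Unitary conjugation and orbit-balls\<close>

definition is_unitary :: "'a::star_algebra \<Rightarrow> bool" where
  "is_unitary w \<longleftrightarrow> w * star w = 1 \<and> star w * w = 1"

lemma is_unitary_mult_cancel:
  assumes "is_unitary w"
  shows "w * (star w * x) = x" "star w * (w * x) = x"
  using assms unfolding is_unitary_def by (metis mult.assoc mult_1_left)+

text \<open>The reason why polynomial maps respect orbit-balls: a unitary that conjugates the
  arguments also conjugates the values.\<close>

lemma eval_conjugate:
  assumes "is_unitary w"
  shows "eval (\<lambda>i. w * v i * star w) p = w * eval v p * star w"
proof (induction p)
  case (Const c)
  show ?case using assms by (simp add: is_unitary_def)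
qed (simp_all add: algebra_simps is_unitary_mult_cancel[OF assms])

lemma (in tracial_algebra) bnd_unitary:
  assumes "is_unitary w" "w \<in> A"
  shows "bnd w 1"
proof (rule bndI)
  fix b assume "b \<in> A"
  then have "ip (w * b) (w * b) = ip b b"
    using assms by (simp add: ip_mult_left is_unitary_mult_cancel)
  then show "n2 (w * b) \<le> 1 * n2 b"
    by (simp add: n2_def)
qed (use assms in auto)

lemma is_unitary_star: "is_unitary w \<Longrightarrow> is_unitary (star w)"
  by (simp add: is_unitary_def)

lemma is_unitary_mult: "is_unitary w \<Longrightarrow> is_unitary u \<Longrightarrow> is_unitary (w * u)"
  by (simp add: is_unitary_def mult.assoc is_unitary_mult_cancel)

lemma (in tracial_algebra) n2_conjugate_le:
  assumes "is_unitary w" "w \<in> A" "a \<in> A"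
  shows "n2 (w * a * star w) \<le> n2 a"
proof -
  have "n2 (w * a * star w) \<le> 1 * n2 (w * a)"
    using assms by (intro n2_mult_right bnd_star bnd_unitary) auto
  also have "n2 (w * a) \<le> 1 * n2 a"
    using assms by (intro bndD bnd_unitary) auto
  finally show ?thesis by simp
qed

context matrix_size
begin

lemma is_unitary_family_of:
  assumes "W \<in> unitary_group k"
  shows "is_unitary (family_of k W)"
  unfolding is_unitary_def
proof (intro conjI mat_family_eqI)
  have W: "W \<in> carrier_mat k k" "W * mat_adjoint W = 1\<^sub>m k" "mat_adjoint W * W = 1\<^sub>m k"
    using assms by (auto simp: unitary_group_def)
  have one: "mat_adjoint (1\<^sub>m l) = (1\<^sub>m l :: complex mat)" for l
    by (rule eq_matI) (auto simp: mat_adjoint_index[of _ l l])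
  fix l
  show "mat_at (family_of k W * star (family_of k W)) l = mat_at 1 l"
    "mat_at (star (family_of k W) * family_of k W) l = mat_at 1 l"
    by (auto simp: times_mat_family.rep_eq star_mat_family.rep_eq one_mat_family.rep_eq mat_at_family_of W one)
qed

lemma unitary_group_mat_at:
  assumes "is_unitary w"
  shows "mat_at w k \<in> unitary_group k"
proof -
  have "mat_at (w * star w) k = mat_at 1 k" "mat_at (star w * w) k = mat_at 1 k"
    using assms by (simp_all add: is_unitary_def)
  then show ?thesis
    by (simp add: unitary_group_def times_mat_family.rep_eq star_mat_family.rep_eq one_mat_family.rep_eq)
qed

lemma tuple_norm2_map2:
  assumes "As \<in> mat_tuples n k" "Bs \<in> mat_tuples n k" "W \<in> carrier_mat k k" "mat_at w k = W"
  shows "tuple_norm2 (map2 (\<lambda>A B. A - W * B * mat_adjoint W) As Bs) =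
    sqrt (\<Sum>i<n. (n2 (tuple_family k As i - w * tuple_family k Bs i * star w))\<^sup>2)"
proof -
  have len: "length As = n" "length Bs = n" using assms by (auto simp: mat_tuples_def)
  have "(\<Sum>A\<leftarrow>map2 (\<lambda>A B. A - W * B * mat_adjoint W) As Bs. Re (mat_ntrace (mat_adjoint A * A)))
    = (\<Sum>i<n. (n2 (tuple_family k As i - w * tuple_family k Bs i * star w))\<^sup>2)"
    using len assms
    by (simp add: sum_list_sum_nth atLeast0LessThan n2_sq minus_mat_family.rep_eq times_mat_family.rep_eq
        star_mat_family.rep_eq tuple_family_at)
  then show ?thesis by (simp add: tuple_norm2_def)
qed

lemma orbit_ballD:
  assumes As: "As \<in> orbit_ball k Bs \<omega>" and Bs: "Bs \<in> mat_tuples n k"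
  shows "\<exists>w. is_unitary w \<and> (\<forall>i. n2 (tuple_family k As i - w * tuple_family k Bs i * star w) \<le> \<omega>)"
proof -
  have len: "length Bs = n" using Bs by (simp add: mat_tuples_def)
  obtain W where W: "W \<in> unitary_group k"
    "tuple_norm2 (map2 (\<lambda>A B. A - W * B * mat_adjoint W) As Bs) < \<omega>" and A: "As \<in> mat_tuples n k"
    using As by (auto simp: orbit_ball_def len)
  define w where "w = family_of k W"
  have w: "mat_at w k = W" "W \<in> carrier_mat k k"
    using W(1) by (auto simp: w_def mat_at_family_of unitary_group_def)
  have lt: "sqrt (\<Sum>i<n. (n2 (tuple_family k As i - w * tuple_family k Bs i * star w))\<^sup>2) < \<omega>"
    using W(2) tuple_norm2_map2[OF A Bs w(2,1)] by simp
  have "n2 (tuple_family k As i - w * tuple_family k Bs i * star w) \<le> \<omega>" for i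
  proof (cases "i < n")
    case True
    have "(n2 (tuple_family k As i - w * tuple_family k Bs i * star w))\<^sup>2
       \<le> (\<Sum>i<n. (n2 (tuple_family k As i - w * tuple_family k Bs i * star w))\<^sup>2)"
      using True by (intro member_le_sum[of i "{..<n}" "\<lambda>i. (n2 (tuple_family k As i - w * tuple_family k Bs i * star w))\<^sup>2"]) auto
    then have "n2 (tuple_family k As i - w * tuple_family k Bs i * star w)
       \<le> sqrt (\<Sum>i<n. (n2 (tuple_family k As i - w * tuple_family k Bs i * star w))\<^sup>2)"
      by (intro real_le_rsqrt)
    then show ?thesis using lt by simp
  next
    case False
    then have "n2 (tuple_family k As i - w * tuple_family k Bs i * star w) = 0"
      using A len by (simp add: tuple_family_def mat_tuples_def)
    moreover have "0 \<le> sqrt (\<Sum>i<n. (n2 (tuple_family k As i - w * tuple_family k Bs i * star w))\<^sup>2)"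
      by (simp add: sum_nonneg)
    ultimately show ?thesis using lt by linarith
  qed
  then show ?thesis
    using is_unitary_family_of[OF W(1)] unfolding w_def by blast
qed

text \<open>Bounding the tuple norm by the sum of the coordinate norms costs the factor n.\<close>

lemma orbit_ballI:
  assumes As: "As \<in> mat_tuples n k" and Bs: "Bs \<in> mat_tuples n k" and w: "is_unitary w"
    and le: "\<And>i. i < n \<Longrightarrow> n2 (tuple_family k As i - w * tuple_family k Bs i * star w) \<le> d"
    and d: "real n * d < \<omega>" "0 < \<omega>"
  shows "As \<in> orbit_ball k Bs \<omega>"
proof -
  have len: "length Bs = n" using Bs by (simp add: mat_tuples_def)
  have "sqrt (\<Sum>i<n. (n2 (tuple_family k As i - w * tuple_family k Bs i * star w))\<^sup>2)
      \<le> (\<Sum>i<n. n2 (tuple_family k As i - w * tuple_family k Bs i * star w))"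
    unfolding L2_set_def[symmetric] by (rule L2_set_le_sum) simp
  also have "\<dots> \<le> real n * d"
    using sum_bounded_above[of "{..<n}" "\<lambda>i. n2 (tuple_family k As i - w * tuple_family k Bs i * star w)" d] le by simp
  finally have "tuple_norm2 (map2 (\<lambda>A B. A - mat_at w k * B * mat_adjoint (mat_at w k)) As Bs) < \<omega>"
    using d tuple_norm2_map2[OF As Bs mat_at_carrier refl] by simp
  then show ?thesis
    using As unitary_group_mat_at[OF w] by (auto simp: orbit_ball_def len)
qed

text \<open>Gives meaning to the \<open>LEAST\<close> in \<open>orbit_covering_number\<close>.
  Entries are bounded, so rounding them to a grid of mesh 1 / N leaves finitely many patterns, and
  tuples with the same pattern are close even without conjugation.\<close>

lemma ex_finite_orbit_cover:
  assumes \<Gamma>: "\<Gamma> \<subseteq> mat_tuples n k" and R: "0 \<le> R" "\<And>As. As \<in> \<Gamma> \<Longrightarrow> \<forall>A\<in>set As. mat_opnorm A \<le> R"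
    and \<omega>: "0 < \<omega>"
  shows "\<exists>C\<subseteq>\<Gamma>. finite C \<and> \<Gamma> \<subseteq> (\<Union>Bs\<in>C. orbit_ball k Bs \<omega>)"
proof -
  have entry: "cmod (As ! i $$ (r, s)) \<le> sqrt k * R" if A: "As \<in> \<Gamma>" and i: "i < n" and rs: "r < k" "s < k"
    for As i r s
  proof -
    let ?a = "tuple_family k As i"
    have at: "mat_at ?a k = As ! i"
      using A \<Gamma> i by (intro tuple_family_at) auto
    have "As ! i \<in> set As"
      using A \<Gamma> i by (auto simp: mat_tuples_def)
    then have "bnd ?a R"
      using R A by (subst bnd_iff_opnorm) (auto simp: at)
    then have n: "n2 ?a \<le> R" by (rule n2_le_bnd)
    have "(cmod (As ! i $$ (r, s)))\<^sup>2 \<le> (\<Sum>s<k. (cmod (As ! i $$ (r, s)))\<^sup>2)"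
      using rs by (intro member_le_sum[of s "{..<k}" "\<lambda>s. (cmod (As ! i $$ (r, s)))\<^sup>2"]) auto
    also have "\<dots> \<le> (\<Sum>r<k. \<Sum>s<k. (cmod (As ! i $$ (r, s)))\<^sup>2)"
      using rs by (intro member_le_sum[of r "{..<k}" "\<lambda>r. \<Sum>s<k. (cmod (As ! i $$ (r, s)))\<^sup>2"]) (auto intro: sum_nonneg)
    also have "\<dots> = k * (n2 ?a)\<^sup>2"
      using n2_sq_entries[of ?a] k_pos by (simp add: at)
    also have "\<dots> \<le> k * R\<^sup>2"
      using n by (intro mult_left_mono power_mono) auto
    also have "\<dots> = (sqrt k * R)\<^sup>2"
      by (simp add: power_mult_distrib)
    finally show ?thesis
      by (rule power2_le_imp_le) (use R in simp)
  qed
  \<comment> \<open>Equal roundings put entries within 2 / N and 2-norms within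
    \<open>2 * sqrt k / N\<close>; N makes n times the latter smaller than \<omega>.\<close>
  define N where "N = (real n + 1) * 2 * sqrt k / \<omega> + 1"
  have N: "0 < N" "real n * (2 * sqrt k / N) < \<omega>"
  proof -
    have 0: "0 \<le> (real n + 1) * 2 * sqrt k / \<omega>" using \<omega> by simp
    then show "0 < N" unfolding N_def by linarith
    have "real n * (2 * sqrt k) \<le> (real n + 1) * 2 * sqrt k"
      by (simp add: algebra_simps)
    also have "\<dots> < N * \<omega>"
      using \<omega> by (simp add: N_def field_simps)
    finally show "real n * (2 * sqrt k / N) < \<omega>"
      using \<open>0 < N\<close> by (simp add: field_simps)
  qed
  define I where "I = {..<n} \<times> {..<k} \<times> {..<k}"
  define L where "L = \<lceil>N * (sqrt k * R)\<rceil> + 1"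
  define g where "g As = restrict (\<lambda>(i, r, s). (\<lfloor>N * Re (As ! i $$ (r, s))\<rfloor>, \<lfloor>N * Im (As ! i $$ (r, s))\<rfloor>)) I" for As
  have fl: "\<lfloor>N * x\<rfloor> \<in> {- L..L}" if "\<bar>x\<bar> \<le> sqrt k * R" for x
  proof -
    have "\<bar>N * x\<bar> \<le> N * (sqrt k * R)"
      using that N by (simp add: abs_mult)
    then show ?thesis
      unfolding L_def by (simp add: abs_le_iff) linarith
  qed
  have "g ` \<Gamma> \<subseteq> (\<Pi>\<^sub>E x\<in>I. {- L..L} \<times> {- L..L})"
  proof (intro image_subsetI PiE_I)
    fix As x assume As: "As \<in> \<Gamma>" and "x \<in> I"
    then obtain i r s where x: "x = (i, r, s)" "i < n" "r < k" "s < k"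
      by (auto simp: I_def)
    have "\<bar>Re (As ! i $$ (r, s))\<bar> \<le> sqrt k * R" "\<bar>Im (As ! i $$ (r, s))\<bar> \<le> sqrt k * R"
      using entry[OF As x(2-4)] abs_Re_le_cmod abs_Im_le_cmod order_trans by blast+
    then show "g As x \<in> {- L..L} \<times> {- L..L}"
      using fl \<open>x \<in> I\<close> by (simp add: g_def x)
  qed (simp add: g_def)
  moreover have "finite (\<Pi>\<^sub>E x\<in>I. {- L..L} \<times> {- L..L})"
    by (intro finite_PiE) (auto simp: I_def)
  ultimately have fin: "finite (g ` \<Gamma>)"
    by (rule finite_subset)
  \<comment> \<open>One representative for each pattern, taken in \<Gamma> because centers must lie
    there.\<close>
  define h where "h y = (SOME As. As \<in> \<Gamma> \<and> g As = y)" for y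
  have h: "h (g As) \<in> \<Gamma> \<and> g (h (g As)) = g As" if "As \<in> \<Gamma>" for As
    unfolding h_def by (rule someI[of _ As]) (use that in simp)
  have close: "As \<in> orbit_ball k Bs \<omega>" if A: "As \<in> \<Gamma>" "Bs \<in> \<Gamma>" and eq: "g As = g Bs" for As Bs
  proof (rule orbit_ballI[where w = 1 and d = "2 * sqrt k / N"])
    show "As \<in> mat_tuples n k" "Bs \<in> mat_tuples n k" using A \<Gamma> by auto
    then have at: "mat_at (tuple_family k As i) k = As ! i" "mat_at (tuple_family k Bs i) k = Bs ! i"
      if "i < n" for i
      using that by (simp_all add: tuple_family_at)
    show "is_unitary (1 :: mat_family)" by (simp add: is_unitary_def)
    fix i assume i: "i < n"
    let ?d = "tuple_family k As i - 1 * tuple_family k Bs i * star 1"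
    have d: "mat_at ?d k $$ (r, s) = As ! i $$ (r, s) - Bs ! i $$ (r, s)" if "r < k" "s < k" for r s
    proof -
      have "Bs ! i \<in> carrier_mat k k"
        using mat_at_carrier[of "tuple_family k Bs i" k] at(2)[OF i] by simp
      then show ?thesis
        using that at[OF i] by (simp add: minus_mat_family.rep_eq)
    qed
    have "(cmod (mat_at ?d k $$ (r, s)))\<^sup>2 \<le> (2 / N)\<^sup>2" if rs: "r < k" "s < k" for r s
    proof (rule power_mono)
      have "g As (i, r, s) = g Bs (i, r, s)" using eq by simp
      then have f: "\<lfloor>N * Re (As ! i $$ (r, s))\<rfloor> = \<lfloor>N * Re (Bs ! i $$ (r, s))\<rfloor>"
        "\<lfloor>N * Im (As ! i $$ (r, s))\<rfloor> = \<lfloor>N * Im (Bs ! i $$ (r, s))\<rfloor>"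
        using i rs by (simp_all add: g_def I_def)
      have *: "\<bar>x - y\<bar> \<le> 1 / N" if "\<lfloor>N * x\<rfloor> = \<lfloor>N * y\<rfloor>" for x y
      proof -
        have "\<bar>N * x - N * y\<bar> \<le> 1" using that by linarith
        then have "N * \<bar>x - y\<bar> \<le> 1" 
          using N(1) by (simp add: right_diff_distrib[symmetric] abs_mult)
        then show ?thesis using N(1) by (simp add: field_simps)
      qed
      have "cmod (As ! i $$ (r, s) - Bs ! i $$ (r, s)) \<le> 1 / N + 1 / N"
        by (rule order_trans[OF cmod_le]) (use *[OF f(1)] *[OF f(2)] in simp)
      then show "cmod (mat_at ?d k $$ (r, s)) \<le> 2 / N"
        using d[OF rs] by simp
    qed simp
    then have "(\<Sum>r<k. \<Sum>s<k. (cmod (mat_at ?d k $$ (r, s)))\<^sup>2) \<le> (\<Sum>r<k. \<Sum>s<k. (2 / N)\<^sup>2)"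
      by (intro sum_mono) auto
    also have "\<dots> = (2 * sqrt k / N)\<^sup>2 * k"
      by (simp add: power_mult_distrib power_divide)
    finally have "(n2 ?d)\<^sup>2 \<le> (2 * sqrt k / N)\<^sup>2 * k / k"
      unfolding n2_sq_entries by (rule divide_right_mono) simp
    then have "(n2 ?d)\<^sup>2 \<le> (2 * sqrt k / N)\<^sup>2"
      using k_pos by simp
    then show "n2 ?d \<le> 2 * sqrt k / N"
      by (rule power2_le_imp_le) (use N in simp)
  qed (use N \<omega> in auto)
  show ?thesis
  proof (intro exI[of _ "h ` g ` \<Gamma>"] conjI)
    show "\<Gamma> \<subseteq> (\<Union>Bs\<in>h ` g ` \<Gamma>. orbit_ball k Bs \<omega>)"
      using close h by fastforce
  qed (use fin h in auto)
qed

end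

lemma orbit_covering_number_le:
  assumes "C \<subseteq> \<Gamma>" "finite C" "\<Gamma> \<subseteq> (\<Union>Bs\<in>C. orbit_ball k Bs \<omega>)" "\<Gamma> \<noteq> {}"
  shows "orbit_covering_number k \<Gamma> \<omega> \<le> card C"
  unfolding orbit_covering_number_def using assms by (auto intro!: Least_le)

lemma orbit_covering_number_attained:
  assumes "C \<subseteq> \<Gamma>" "finite C" "\<Gamma> \<subseteq> (\<Union>Bs\<in>C. orbit_ball k Bs \<omega>)" "\<Gamma> \<noteq> {}"
  shows "\<exists>C\<subseteq>\<Gamma>. finite C \<and> card C = orbit_covering_number k \<Gamma> \<omega> \<and> \<Gamma> \<subseteq> (\<Union>Bs\<in>C. orbit_ball k Bs \<omega>)"
proof -
  have "\<exists>C'\<subseteq>\<Gamma>. finite C' \<and> card C' = card C \<and> \<Gamma> \<subseteq> (\<Union>Bs\<in>C'. orbit_ball k Bs \<omega>)"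
    using assms by blast
  from LeastI[of "\<lambda>N. \<exists>C\<subseteq>\<Gamma>. finite C \<and> card C = N \<and> \<Gamma> \<subseteq> (\<Union>Bs\<in>C. orbit_ball k Bs \<omega>)", OF this]
  show ?thesis
    using assms(4) by (simp add: orbit_covering_number_def)
qed

section \<open>Transfer of microstates\<close>

lemma op_word_eq:
  assumes "\<forall>(i, s)\<in>set w. i < length xs" "\<And>i. i < length xs \<Longrightarrow> op_of (v i) = xs ! i"
  shows "op_word xs w = op_of (word_value v w)"
  using assms(1)
proof (induction w)
  case (Cons a w)
  then show ?case
    using assms(2)
    by (cases a) (auto simp: op_word_def times_cop.rep_eq star_cop.rep_eq)
qed (simp add: op_word_def one_cop.rep_eq)

lemma finite_star_words: "finite (star_words n m)"
proof (rule finite_subset)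
  show "star_words n m \<subseteq> {w. set w \<subseteq> {..<n} \<times> UNIV \<and> length w \<le> m}"
    by (auto simp: star_words_def)
qed (intro finite_lists_length_le finite_cartesian_product; simp)

text \<open>\<psi> recovers Bs from its image \<open>F Bs\<close> up to d. The center of a ball
  around \<open>F Bs\<close> need not be an image under F, nor need its value under \<psi> lie in
  \<Delta>; a member of \<Delta> whose image falls into the ball replaces it, which doubles the
  error.\<close>

lemma (in matrix_size) orbit_covering_number_transfer:
  fixes \<phi> \<psi> :: "nat \<Rightarrow> star_poly"
  assumes \<Gamma>: "\<Gamma> \<subseteq> mat_tuples n k" and R: "0 \<le> R" "\<And>As. As \<in> \<Gamma> \<Longrightarrow> \<forall>A\<in>set As. mat_opnorm A \<le> R"
    and \<Delta>: "\<Delta> \<subseteq> mat_tuples p k"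
    and \<phi>: "\<And>Bs. Bs \<in> \<Delta> \<Longrightarrow> map (\<lambda>i. mat_at (eval (tuple_family k Bs) (\<phi> i)) k) [0..<n] \<in> \<Gamma>"
    and \<phi>0: "\<And>i. n \<le> i \<Longrightarrow> \<phi> i = Const 0"
    and \<psi>: "\<And>Bs j. Bs \<in> \<Delta> \<Longrightarrow> j < p \<Longrightarrow>
      n2 (eval (\<lambda>i. eval (tuple_family k Bs) (\<phi> i)) (\<psi> j) - tuple_family k Bs j) \<le> d"
    and L: "\<And>j. j < p \<Longrightarrow> poly_lipschitz R (\<psi> j) \<le> L"
    and \<omega>': "0 < \<omega>'" and \<omega>: "0 < \<omega>" "real p * (2 * (d + L * \<omega>')) < \<omega>" and ne: "\<Delta> \<noteq> {}"
  shows "orbit_covering_number k \<Delta> \<omega> \<le> orbit_covering_number k \<Gamma> \<omega>'"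
proof -
  define F where "F Bs = map (\<lambda>i. mat_at (eval (tuple_family k Bs) (\<phi> i)) k) [0..<n]" for Bs
  have F\<Gamma>: "F Bs \<in> \<Gamma>" if "Bs \<in> \<Delta>" for Bs
    using \<phi>[OF that] by (simp add: F_def)
  have "\<Gamma> \<noteq> {}" using ne F\<Gamma> by blast
  obtain C0 where "C0 \<subseteq> \<Gamma>" "finite C0" "\<Gamma> \<subseteq> (\<Union>Bs\<in>C0. orbit_ball k Bs \<omega>')"
    using ex_finite_orbit_cover[OF \<Gamma> R \<omega>'] by blast
  then obtain C where C: "C \<subseteq> \<Gamma>" "finite C" "card C = orbit_covering_number k \<Gamma> \<omega>'"
      "\<Gamma> \<subseteq> (\<Union>Bs\<in>C. orbit_ball k Bs \<omega>')"
    using orbit_covering_number_attained[of C0 \<Gamma> k \<omega>'] \<open>\<Gamma> \<noteq> {}\<close> by blast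
  have bndF: "bnd (tuple_family k As i) R" if "As \<in> \<Gamma>" for As i
  proof (cases "i < n")
    case True
    have "As ! i \<in> set As"
      using that \<Gamma> True by (auto simp: mat_tuples_def)
    moreover have "mat_at (tuple_family k As i) k = As ! i"
      using that \<Gamma> True by (intro tuple_family_at) auto
    ultimately show ?thesis
      using R that by (subst bnd_iff_opnorm) auto
  next
    case False
    then have "tuple_family k As i = 0"
      using that \<Gamma> by (auto simp: tuple_family_def mat_tuples_def)
    then show ?thesis using R by (simp add: bnd_zero)
  qed
  \<comment> \<open>Bs is within d of \<psi> at \<open>F Bs\<close>, and \<open>F Bs\<close> is
    within \<omega>' of a conjugate of As, an error that \<psi> multiplies by at most L.\<close>
  have near: "\<exists>w. is_unitary w \<and> (\<forall>j<p. n2 (tuple_family k Bs j - w * eval (tuple_family k As) (\<psi> j) * star w) \<le> d + L * \<omega>')"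
    if Bs: "Bs \<in> \<Delta>" and As: "As \<in> C" and ball: "F Bs \<in> orbit_ball k As \<omega>'" for Bs As
  proof -
    have As': "As \<in> \<Gamma>" using As C by blast
    then have "As \<in> mat_tuples n k" using \<Gamma> by blast
    then obtain w where w: "is_unitary w"
        "\<And>i. n2 (tuple_family k (F Bs) i - w * tuple_family k As i * star w) \<le> \<omega>'"
      using orbit_ballD[OF ball] by blast
    \<comment> \<open>Beyond n both sides are 0, which is the purpose of \<phi>0.\<close>
    have FB: "mat_at (tuple_family k (F Bs) i) k = mat_at (eval (tuple_family k Bs) (\<phi> i)) k" for i
    proof (cases "i < n")
      case True
      then show ?thesis
        using F\<Gamma>[OF Bs] \<Gamma> by (subst tuple_family_at[of _ n]) (auto simp: F_def)
    qed (simp add: tuple_family_def F_def \<phi>0)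
    have "n2 (tuple_family k Bs j - w * eval (tuple_family k As) (\<psi> j) * star w) \<le> d + L * \<omega>'" if j: "j < p" for j
    proof -
      let ?e = "eval (\<lambda>i. eval (tuple_family k Bs) (\<phi> i)) (\<psi> j)"
      have "n2 (tuple_family k Bs j - w * eval (tuple_family k As) (\<psi> j) * star w)
        \<le> n2 (tuple_family k Bs j - ?e) + n2 (?e - w * eval (tuple_family k As) (\<psi> j) * star w)"
        by (intro n2_diff_trans) auto
      also have "n2 (tuple_family k Bs j - ?e) \<le> d"
        using \<psi>[OF Bs j] by (subst n2_diff_commute) auto
      also have "n2 (?e - w * eval (tuple_family k As) (\<psi> j) * star w)
          = n2 (eval (tuple_family k (F Bs)) (\<psi> j) - eval (\<lambda>i. w * tuple_family k As i * star w) (\<psi> j))"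
        unfolding eval_conjugate[OF w(1)]
        by (rule n2_cong) (simp add: minus_mat_family.rep_eq eval_at_cong[OF FB])
      also have "\<dots> \<le> poly_lipschitz R (\<psi> j) * \<omega>'"
      proof (rule eval_lipschitz)
        show "bnd (tuple_family k (F Bs) i) R" for i
          using bndF F\<Gamma>[OF Bs] by blast
        show "bnd (w * tuple_family k As i * star w) R" for i
          using bnd_mult[OF bnd_mult[OF bnd_unitary[OF w(1)] bndF[OF As']] bnd_star[OF bnd_unitary[OF w(1)]]]
          by simp
      qed (rule w)
      also have "\<dots> \<le> L * \<omega>'"
        using L[OF j] \<omega>' by (intro mult_right_mono) auto
      finally show ?thesis by simp
    qed
    then show ?thesis using w(1) by blast
  qed
  define hit where "hit As \<longleftrightarrow> (\<exists>Bs\<in>\<Delta>. F Bs \<in> orbit_ball k As \<omega>')" for As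
  \<comment> \<open>The representative in \<Delta> of a center that is hit; the other centers are
    dropped.\<close>
  define c where "c As = (SOME Bs. Bs \<in> \<Delta> \<and> F Bs \<in> orbit_ball k As \<omega>')" for As
  have c: "c As \<in> \<Delta>" "F (c As) \<in> orbit_ball k As \<omega>'" if "hit As" for As
    using someI_ex[of "\<lambda>Bs. Bs \<in> \<Delta> \<and> F Bs \<in> orbit_ball k As \<omega>'"] that unfolding hit_def c_def by blast+
  define D where "D = c ` {As \<in> C. hit As}"
  have "\<Delta> \<subseteq> (\<Union>Bs\<in>D. orbit_ball k Bs \<omega>)"
  proof
    fix Bs assume Bs: "Bs \<in> \<Delta>"
    obtain As where As: "As \<in> C" "F Bs \<in> orbit_ball k As \<omega>'"
      using F\<Gamma>[OF Bs] C(4) by blast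
    then have hit: "hit As" using Bs by (auto simp: hit_def)
    obtain w where w: "is_unitary w"
        "\<forall>j<p. n2 (tuple_family k Bs j - w * eval (tuple_family k As) (\<psi> j) * star w) \<le> d + L * \<omega>'"
      using near[OF Bs As] by blast
    obtain u where u: "is_unitary u"
        "\<forall>j<p. n2 (tuple_family k (c As) j - u * eval (tuple_family k As) (\<psi> j) * star u) \<le> d + L * \<omega>'"
      using near[OF c(1)[OF hit] As(1) c(2)[OF hit]] by blast
    \<comment> \<open>Both Bs and the representative are close to conjugates of the same tuple, the
      value of \<psi> at As, by w and by u; \<open>w * star u\<close> carries one conjugate to the
      other.\<close>
    have "Bs \<in> orbit_ball k (c As) \<omega>"
    proof (rule orbit_ballI[where w = "w * star u" and d = "2 * (d + L * \<omega>')"])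
      show "Bs \<in> mat_tuples p k" "c As \<in> mat_tuples p k"
        using \<Delta> Bs c(1)[OF hit] by auto
      show "is_unitary (w * star u)"
        using w(1) u(1) by (intro is_unitary_mult is_unitary_star)
      fix j assume j: "j < p"
      let ?e = "eval (tuple_family k As) (\<psi> j)"
      let ?b = "tuple_family k (c As) j"
      have "n2 (tuple_family k Bs j - (w * star u) * ?b * star (w * star u))
        \<le> n2 (tuple_family k Bs j - w * ?e * star w) + n2 (w * ?e * star w - (w * star u) * ?b * star (w * star u))"
        by (intro n2_diff_trans) auto
      also have "w * ?e * star w - (w * star u) * ?b * star (w * star u)
          = (w * star u) * (u * ?e * star u - ?b) * star (w * star u)"
        using is_unitary_mult_cancel[OF u(1)] by (simp add: algebra_simps)
      also have "n2 \<dots> \<le> n2 (u * ?e * star u - ?b)"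
        using w(1) u(1) by (intro n2_conjugate_le is_unitary_mult is_unitary_star) auto
      also have "\<dots> = n2 (?b - u * ?e * star u)"
        by (rule n2_diff_commute) auto
      finally show "n2 (tuple_family k Bs j - (w * star u) * ?b * star (w * star u)) \<le> 2 * (d + L * \<omega>')"
        using w(2) u(2) j by fastforce
    qed (use \<omega> in auto)
    then show "Bs \<in> (\<Union>Bs\<in>D. orbit_ball k Bs \<omega>)"
      using hit As(1) by (auto simp: D_def)
  qed
  moreover have "D \<subseteq> \<Delta>" "finite D"
    using c(1) C(2) by (auto simp: D_def)
  ultimately have "orbit_covering_number k \<Delta> \<omega> \<le> card D"
    using ne by (intro orbit_covering_number_le)
  also have "\<dots> \<le> card {As \<in> C. hit As}"
    unfolding D_def using C(2) by (intro card_image_le) auto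
  also have "\<dots> \<le> card C"
    using C(2) by (intro card_mono) auto
  finally show ?thesis
    using C(3) by simp
qed

text \<open>An empty \<Delta> has covering number 1 by convention, so the left side is 0; the right
  side is the logarithm of a natural number, which is nonnegative since
  \<open>ln 0 = 0\<close>.\<close>

lemma ln_orbit_covering_number_mono:
  assumes "\<Delta> \<noteq> {} \<Longrightarrow> orbit_covering_number k \<Delta> \<omega> \<le> orbit_covering_number k \<Gamma> \<omega>'"
  shows "ln (real (orbit_covering_number k \<Delta> \<omega>)) \<le> ln (real (orbit_covering_number k \<Gamma> \<omega>'))"
proof (cases "\<Delta> = {} \<or> orbit_covering_number k \<Delta> \<omega> = 0")
  case True
  have ln0: "0 \<le> ln (real N)" for N :: nat
    by (cases "N = 0") auto
  have "ln (real (orbit_covering_number k \<Delta> \<omega>)) = 0"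
    using True
  proof
    assume "\<Delta> = {}"
    then show ?thesis by (simp add: orbit_covering_number_def)
  qed simp
  then show ?thesis using ln0 by simp
next
  case False
  then show ?thesis
    using assms by (intro ln_mono) auto
qed

context normal_trace
begin

text \<open>\<open>orbit_dim_at_radius\<close> is an infimum over (m', \<epsilon>') at fixed
  \<omega>' and R'. Hence R' and \<omega>' come first, R' read off from xs and \<omega>' from
  \<psi>, while \<phi>, m and \<epsilon> may depend on (m', \<epsilon>').\<close>

lemma microstate_transfer:
  fixes xs ys :: "('h \<Rightarrow>\<^sub>L 'h) list"
  assumes xs: "generates xs M" and ys: "generates ys M" and \<omega>: "0 < \<omega>" and R: "0 < R"
  shows "\<exists>R' \<omega>'. 0 < R' \<and> 0 < \<omega>' \<and> \<omega>' < 1 \<and> (\<forall>m' \<epsilon>'. 0 < \<epsilon>' \<longrightarrow> (\<exists>m \<epsilon>. 0 < \<epsilon> \<and> (\<forall>k>0.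
      ln (real (orbit_covering_number k (microstates \<tau> ys R m k \<epsilon>) \<omega>))
      \<le> ln (real (orbit_covering_number k (microstates \<tau> xs R' m' k \<epsilon>') \<omega>')))))"
proof -
  define n where "n = length xs"
  define p where "p = length ys"
  define x where "x i = (if i < length xs then Abs_cop (xs ! i) else 0)" for i
  define y where "y i = (if i < length ys then Abs_cop (ys ! i) else 0)" for i
  have mem: "zs ! i \<in> M" if "generates zs M" "i < length zs" for zs i
    using that hull_subset[of "set zs" von_neumann_algebra] unfolding generates_def by auto
  have opx: "op_of (x i) = xs ! i" if "i < length xs" for i
    using that mem[OF xs that] by (simp add: x_def op_of_Abs linear)
  have opy: "op_of (y i) = ys ! i" if "i < length ys" for i
    using that mem[OF ys that] by (simp add: y_def op_of_Abs linear)
  have xA: "x i \<in> op_algebra M" for i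
    by (cases "i < length xs") (simp_all add: op_algebra_iff opx mem[OF xs], simp add: x_def zero_cop.rep_eq zero_mem)
  have yA: "y i \<in> op_algebra M" for i
    by (cases "i < length ys") (simp_all add: op_algebra_iff opy mem[OF ys], simp add: y_def zero_cop.rep_eq zero_mem)
  have dense_x: "limit_poly n x a" if "a \<in> op_algebra M" for a
    using dense_polynomials[OF xs that] by (simp add: n_def x_def[abs_def])
  have dense_y: "limit_poly p y a" if "a \<in> op_algebra M" for a
    using dense_polynomials[OF ys that] by (simp add: p_def y_def[abs_def])
  \<comment> \<open>Dominates the bound that \<open>uniformly_bounded_approximation\<close> gives
    for each \<open>x i\<close>, whatever the accuracy.\<close>
  define R' where "R' = (\<Sum>i<n. 12 * (norm (op_of (x i)) + 1)) + 1"
  have R'_ge: "12 * (norm (op_of (x i)) + 1) \<le> R'" if "i < n" for i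
  proof -
    have "12 * (norm (op_of (x i)) + 1) \<le> (\<Sum>i<n. 12 * (norm (op_of (x i)) + 1))"
      using that by (intro member_le_sum[of i "{..<n}" "\<lambda>i. 12 * (norm (op_of (x i)) + 1)"]) auto
    then show ?thesis by (simp add: R'_def)
  qed
  have R': "0 < R'"
    unfolding R'_def by (intro add_nonneg_pos sum_nonneg) auto
  have bx: "bnd (x i) R'" for i
  proof (cases "i < n")
    case True
    have "norm (op_of (x i)) \<le> 12 * (norm (op_of (x i)) + 1)"
      using norm_ge_zero[of "op_of (x i)"] by (simp add: distrib_left)
    then show ?thesis
      using order_trans[OF _ R'_ge[OF True]] by (intro bnd_if_norm_le xA) blast
  next
    case False
    then have "x i = 0" by (simp add: x_def n_def)
    then show ?thesis using R' by (simp add: bnd_zero)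
  qed
  \<comment> \<open>One bound for both the operators y and matrices of norm at most R, since a
    cutoff is built for a single bound on the generators.\<close>
  define S where "S = R + (\<Sum>j<p. norm (op_of (y j)))"
  have S: "0 \<le> S" "R \<le> S"
    unfolding S_def using R by (auto intro!: add_nonneg_nonneg sum_nonneg)
  have bndy: "bnd (y j) S" for j
  proof (cases "j < p")
    case True
    have "norm (op_of (y j)) \<le> (\<Sum>j<p. norm (op_of (y j)))"
      using True by (intro member_le_sum[of j "{..<p}" "\<lambda>j. norm (op_of (y j))"]) auto
    then show ?thesis
      using R by (intro bnd_if_norm_le yA) (auto simp: S_def)
  next
    case False
    then have "y j = 0" by (simp add: y_def p_def)
    then show ?thesis using S by (simp add: bnd_zero)
  qed
  \<comment> \<open>The error allowed in one coordinate, before it is doubled and summed over the p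
    coordinates.\<close>
  define d where "d = \<omega> / (4 * (real p + 1))"
  have d: "0 < d" "real p * (2 * d) < \<omega>"
  proof -
    show "0 < d" using \<omega> by (simp add: d_def)
    have "real p * (2 * d) = \<omega> * (real p / (2 * (real p + 1)))"
      by (simp add: d_def field_simps)
    also have "\<dots> < \<omega> * 1"
      using \<omega> by (intro mult_strict_left_mono) (auto simp: field_simps)
    finally show "real p * (2 * d) < \<omega>" by simp
  qed
  have "\<exists>q. gens q \<subseteq> {..<n} \<and> n2 (eval x q - y j) < d / 4" for j
    using d(1) by (intro limit_polyD dense_x yA) simp
  then obtain \<psi> where \<psi>: "\<And>j. gens (\<psi> j) \<subseteq> {..<n}" "\<And>j. n2 (eval x (\<psi> j) - y j) < d / 4"
    by metis
  define L where "L = (\<Sum>j<p. poly_lipschitz R' (\<psi> j)) + 1"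
  have L0: "0 < L"
    unfolding L_def using R' by (intro add_nonneg_pos sum_nonneg poly_lipschitz_nonneg) auto
  have L: "poly_lipschitz R' (\<psi> j) \<le> L" if "j < p" for j
  proof -
    have "poly_lipschitz R' (\<psi> j) \<le> (\<Sum>j<p. poly_lipschitz R' (\<psi> j))"
      using that R' by (intro member_le_sum[of j "{..<p}" "\<lambda>j. poly_lipschitz R' (\<psi> j)"])
        (auto intro: poly_lipschitz_nonneg)
    then show ?thesis by (simp add: L_def)
  qed
  \<comment> \<open>Half of d pays for the Lipschitz image of \<omega>', the other half for the
    failure of \<psi> to invert \<phi> exactly.\<close>
  define \<omega>' where "\<omega>' = min (1/2) (d / (2 * L))"
  have \<omega>': "0 < \<omega>'" "\<omega>' < 1" "L * \<omega>' \<le> d / 2"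
  proof -
    have "L * \<omega>' \<le> L * (d / (2 * L))"
      using L0 by (intro mult_left_mono) (auto simp: \<omega>'_def)
    then show "L * \<omega>' \<le> d / 2" using L0 by simp
  qed (use d L0 in \<open>auto simp: \<omega>'_def\<close>)
  have "\<exists>m \<epsilon>. 0 < \<epsilon> \<and> (\<forall>k>0.
      ln (real (orbit_covering_number k (microstates \<tau> ys R m k \<epsilon>) \<omega>))
      \<le> ln (real (orbit_covering_number k (microstates \<tau> xs R' m' k \<epsilon>') \<omega>')))"
    if \<epsilon>': "0 < \<epsilon>'" for m' \<epsilon>'
  proof -
    define Lw where "Lw = (\<Sum>w\<in>star_words n m'. poly_lipschitz R' (word_poly w)) + 1"
    have Lw0: "0 < Lw"
      unfolding Lw_def using R' by (intro add_nonneg_pos sum_nonneg poly_lipschitz_nonneg) auto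
    have Lw: "poly_lipschitz R' (word_poly w) \<le> Lw" if "w \<in> star_words n m'" for w
    proof -
      have "poly_lipschitz R' (word_poly w) \<le> (\<Sum>w\<in>star_words n m'. poly_lipschitz R' (word_poly w))"
        using that R' by (intro member_le_sum[of w _ "\<lambda>w. poly_lipschitz R' (word_poly w)"])
          (auto intro: poly_lipschitz_nonneg finite_star_words)
      then show ?thesis by (simp add: Lw_def)
    qed
    \<comment> \<open>The two terms limit the error of \<psi> after \<phi> and that of the word
      traces.\<close>
    define \<delta> where "\<delta> = min (d / (8 * L)) (\<epsilon>' / (4 * Lw))"
    have \<delta>: "0 < \<delta>" "L * \<delta> \<le> d / 8" "Lw * \<delta> \<le> \<epsilon>' / 4"
    proof -
      have "\<delta> \<le> d / (8 * L)" "\<delta> \<le> \<epsilon>' / (4 * Lw)"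
        by (auto simp: \<delta>_def)
      then have "L * \<delta> \<le> L * (d / (8 * L))" "Lw * \<delta> \<le> Lw * (\<epsilon>' / (4 * Lw))"
        using L0 Lw0 by (auto intro: mult_left_mono simp del: times_divide_eq_right)
      then show "L * \<delta> \<le> d / 8" "Lw * \<delta> \<le> \<epsilon>' / 4" using L0 Lw0 by simp_all
    qed (use d L0 Lw0 \<epsilon>' in \<open>auto simp: \<delta>_def\<close>)
    have "\<exists>q. gens q \<subseteq> {..<p} \<and> n2 (eval y q - x i) < \<delta> \<and> bnd (eval y q) (12 * (norm (op_of (x i)) + 1)) \<and>
       (\<forall>(B :: mat_family set) tr u. tracial_algebra B tr \<longrightarrow> (\<forall>i. tracial_algebra.bnd B tr (u i) S) \<longrightarrow>
       tracial_algebra.bnd B tr (eval u q) (12 * (norm (op_of (x i)) + 1)))" for i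
      by (rule uniformly_bounded_approximation[OF dense_y bndy xA \<delta>(1)])
    then obtain \<phi>' where \<phi>': "\<And>i. gens (\<phi>' i) \<subseteq> {..<p}" "\<And>i. n2 (eval y (\<phi>' i) - x i) < \<delta>"
        "\<And>i. bnd (eval y (\<phi>' i)) (12 * (norm (op_of (x i)) + 1))"
        "\<And>i. \<forall>(B :: mat_family set) tr u. tracial_algebra B tr \<longrightarrow> (\<forall>i. tracial_algebra.bnd B tr (u i) S) \<longrightarrow>
       tracial_algebra.bnd B tr (eval u (\<phi>' i)) (12 * (norm (op_of (x i)) + 1))"
      by metis
    \<comment> \<open>The default agrees with the value 0 of x and of \<open>tuple_family\<close>
      beyond n.\<close>
    define \<phi> where "\<phi> i = (if i < n then \<phi>' i else Const 0)" for i
    have gens\<phi>: "gens (\<phi> i) \<subseteq> {..<p}" for i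
      using \<phi>'(1) by (simp add: \<phi>_def)
    have \<phi>x: "n2 (eval y (\<phi> i) - x i) \<le> \<delta>" for i
    proof (cases "i < n")
      case True
      then show ?thesis using \<phi>'(2)[of i] by (simp add: \<phi>_def)
    next
      case False
      then show ?thesis using \<delta>(1) by (simp add: \<phi>_def x_def n_def)
    qed
    have \<phi>b: "bnd (eval y (\<phi> i)) R'" for i
      using bnd_mono[OF \<phi>'(3) R'_ge] R' by (simp add: \<phi>_def bnd_zero)
    \<comment> \<open>The defect of \<psi> after \<phi>, as a polynomial in y. Its squared 2-norm is
      a trace, so its smallness in M passes to microstates through moments.\<close>
    define D where "D j = Plus (subst_poly \<phi> (\<psi> j)) (Times (Const (- 1)) (Gen j))" for j
    have evD: "eval v (D j) = eval (\<lambda>i. eval v (\<phi> i)) (\<psi> j) - v j" for v :: "nat \<Rightarrow> 'z::star_algebra" and j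
      by (simp add: D_def eval_subst_poly scl_minus_left)
    define P where "P = (\<lambda>w. subst_poly \<phi> (word_poly w)) ` star_words n m' \<union> (\<lambda>j. Times (Adj (D j)) (D j)) ` {..<p}"
    \<comment> \<open>The shares add up as \<epsilon>'/2 + \<epsilon>'/4 < \<epsilon>' and (3 d/8)^2
      + d^2/16 \<le> (d/2)^2.\<close>
    define \<delta>' where "\<delta>' = min (\<epsilon>' / 2) (d\<^sup>2 / 16)"
    have "0 < \<delta>'" using d \<epsilon>' by (simp add: \<delta>'_def)
    moreover have "finite P"
      by (simp add: P_def finite_star_words)
    moreover have "gens q \<subseteq> {..<p}" if "q \<in> P" for q
    proof -
      have "gens (subst_poly \<phi> q') \<subseteq> {..<p}" for q'
        unfolding gens_subst_poly using gens\<phi> by blast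
      moreover have "gens (D j) \<subseteq> {..<p}" if "j < p" for j
        using that calculation[of "\<psi> j"] by (simp add: D_def)
      ultimately show ?thesis
        using that by (auto simp: P_def simp del: gens.simps) (auto simp: subset_eq)
    qed
    ultimately obtain m \<epsilon> where \<epsilon>: "0 < \<epsilon>" and
      close: "\<forall>(A :: mat_family set) tr v (B :: 'h cop set) tr' u.
        tracial_algebra A tr \<longrightarrow> tracial_algebra B tr' \<longrightarrow> (\<forall>i. v i \<in> A) \<longrightarrow> (\<forall>i. u i \<in> B) \<longrightarrow>
        (\<forall>w\<in>star_words p m. cmod (tr (word_value v w) - tr' (word_value u w)) < \<epsilon>) \<longrightarrow>
        (\<forall>q\<in>P. cmod (tr (eval v q) - tr' (eval u q)) < \<delta>')"
      using moments_determine_traces[of P p \<delta>', where ?'a = mat_family and ?'b = "'h cop"] by auto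
    have "ln (real (orbit_covering_number k (microstates \<tau> ys R m k \<epsilon>) \<omega>))
      \<le> ln (real (orbit_covering_number k (microstates \<tau> xs R' m' k \<epsilon>') \<omega>'))" if k: "0 < k" for k
    proof (rule ln_orbit_covering_number_mono)
      interpret ms: matrix_size k by standard (rule k)
      assume ne: "microstates \<tau> ys R m k \<epsilon> \<noteq> {}"
      have tr_word_y: "\<tau> (op_word ys w) = op_trace \<tau> (word_value y w)" if "\<forall>(i, s)\<in>set w. i < p" for w
        using that opy by (subst op_word_eq[where v = y]) (auto simp: p_def op_trace_def)
      have tr_word_x: "\<tau> (op_word xs w) = op_trace \<tau> (word_value x w)" if "\<forall>(i, s)\<in>set w. i < n" for w
        using that opx by (subst op_word_eq[where v = x]) (auto simp: n_def op_trace_def)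
      have facts: "(\<forall>q\<in>P. cmod (family_trace k (eval (tuple_family k Bs) q) - op_trace \<tau> (eval y q)) < \<delta>') \<and>
          (\<forall>j. ms.bnd (tuple_family k Bs j) R)"
        if Bs: "Bs \<in> microstates \<tau> ys R m k \<epsilon>" for Bs
      proof -
        have Bp: "Bs \<in> mat_tuples p k" and nB: "\<forall>A\<in>set Bs. mat_opnorm A \<le> R"
          and mom: "\<forall>w\<in>star_words p m. cmod (mat_ntrace (mat_word k Bs w) - \<tau> (op_word ys w)) < \<epsilon>"
          using Bs by (simp_all add: microstates_def p_def)
        have "cmod (family_trace k (word_value (tuple_family k Bs) w) - op_trace \<tau> (word_value y w)) < \<epsilon>"
          if w: "w \<in> star_words p m" for w
        proof -
          have letters: "\<forall>(i, s)\<in>set w. i < p" using w by (simp add: star_words_def)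
          show ?thesis
            using bspec[OF mom w] mat_word_eq[OF Bp letters] tr_word_y[OF letters] by (simp add: family_trace_def)
        qed
        then have "\<forall>q\<in>P. cmod (family_trace k (eval (tuple_family k Bs) q) - op_trace \<tau> (eval y q)) < \<delta>'"
          using close[rule_format, where A = UNIV and tr = "family_trace k" and B = "op_algebra M"
              and tr' = "op_trace \<tau>" and v = "tuple_family k Bs" and u = y]
            ms.tracial_algebra_axioms tracial_algebra_axioms yA by blast
        moreover have "ms.bnd (tuple_family k Bs j) R" for j
        proof (cases "j < p")
          case True
          then have "Bs ! j \<in> set Bs" using Bp by (auto simp: mat_tuples_def)
          then show ?thesis
            using nB R tuple_family_at[OF Bp True] by (subst ms.bnd_iff_opnorm) auto
        next
          case False
          then have "tuple_family k Bs j = 0"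
            using Bp by (auto simp: tuple_family_def mat_tuples_def)
          then show ?thesis using R by (simp add: ms.bnd_zero)
        qed
        ultimately show ?thesis by blast
      qed
      show "orbit_covering_number k (microstates \<tau> ys R m k \<epsilon>) \<omega>
          \<le> orbit_covering_number k (microstates \<tau> xs R' m' k \<epsilon>') \<omega>'"
      proof (rule ms.orbit_covering_number_transfer[where \<phi> = \<phi> and \<psi> = \<psi> and n = n and p = p and d = "d / 2" and L = L and R = R'])
        show "microstates \<tau> xs R' m' k \<epsilon>' \<subseteq> mat_tuples n k" "microstates \<tau> ys R m k \<epsilon> \<subseteq> mat_tuples p k"
          by (auto simp: microstates_def n_def p_def)
        show "0 \<le> R'" "0 < \<omega>'" "0 < \<omega>" using R' \<omega>' \<omega> by auto
        show "\<forall>A\<in>set As. mat_opnorm A \<le> R'" if "As \<in> microstates \<tau> xs R' m' k \<epsilon>'" for As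
          using that by (simp add: microstates_def)
        show "\<phi> i = Const 0" if "n \<le> i" for i
          using that by (simp add: \<phi>_def)
        show "poly_lipschitz R' (\<psi> j) \<le> L" if "j < p" for j
          by (rule L[OF that])
        have "real p * (2 * (d / 2 + L * \<omega>')) \<le> real p * (2 * d)"
          using \<omega>'(3) by (intro mult_left_mono) auto
        then show "real p * (2 * (d / 2 + L * \<omega>')) < \<omega>"
          using d(2) by simp
      next
        fix Bs j assume Bs: "Bs \<in> microstates \<tau> ys R m k \<epsilon>" and j: "j < p"
        have "n2 (eval (\<lambda>i. eval y (\<phi> i)) (\<psi> j) - y j)
          \<le> n2 (eval (\<lambda>i. eval y (\<phi> i)) (\<psi> j) - eval x (\<psi> j)) + n2 (eval x (\<psi> j) - y j)"
          using xA yA \<phi>b by (intro n2_diff_trans eval_closed) auto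
        also have "n2 (eval (\<lambda>i. eval y (\<phi> i)) (\<psi> j) - eval x (\<psi> j)) \<le> poly_lipschitz R' (\<psi> j) * \<delta>"
          by (intro eval_lipschitz \<phi>b bx \<phi>x)
        also have "poly_lipschitz R' (\<psi> j) * \<delta> \<le> L * \<delta>"
          using L[OF j] \<delta>(1) by (intro mult_right_mono) auto
        \<comment> \<open>d/8 comes from \<phi> and d/4 from \<psi>.\<close>
        finally have "n2 (eval y (D j)) \<le> 3 / 8 * d"
          unfolding evD using \<delta>(2) \<psi>(2)[of j] by linarith
        moreover have DA: "eval y (D j) \<in> op_algebra M"
          by (intro eval_closed yA)
        ultimately have "(n2 (eval y (D j)))\<^sup>2 \<le> (3 / 8 * d)\<^sup>2"
          by (intro power_mono) auto
        moreover have "(n2 (eval y (D j)))\<^sup>2 = Re (op_trace \<tau> (eval y (Times (Adj (D j)) (D j))))"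
          using DA by (simp add: n2_power2 ip_def)
        moreover have "(ms.n2 (eval (tuple_family k Bs) (D j)))\<^sup>2
            = Re (family_trace k (eval (tuple_family k Bs) (Times (Adj (D j)) (D j))))"
          by (simp add: ms.n2_power2 ms.ip_def)
        moreover have "Times (Adj (D j)) (D j) \<in> P"
          using j by (simp add: P_def)
        then have "cmod (family_trace k (eval (tuple_family k Bs) (Times (Adj (D j)) (D j)))
            - op_trace \<tau> (eval y (Times (Adj (D j)) (D j)))) < d\<^sup>2 / 16"
          using facts[OF Bs] by (fastforce simp: \<delta>'_def)
        then have "Re (family_trace k (eval (tuple_family k Bs) (Times (Adj (D j)) (D j))))
            - Re (op_trace \<tau> (eval y (Times (Adj (D j)) (D j)))) < d\<^sup>2 / 16"
          using complex_Re_le_cmod[of "family_trace k (eval (tuple_family k Bs) (Times (Adj (D j)) (D j)))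
            - op_trace \<tau> (eval y (Times (Adj (D j)) (D j)))"] by simp
        ultimately have "(ms.n2 (eval (tuple_family k Bs) (D j)))\<^sup>2 \<le> (3 / 8 * d)\<^sup>2 + d\<^sup>2 / 16"
          by linarith
        also have "\<dots> \<le> (d / 2)\<^sup>2"
          using zero_le_power2[of d] by (simp add: power_mult_distrib power_divide)
        finally have "ms.n2 (eval (tuple_family k Bs) (D j)) \<le> d / 2"
          by (rule power2_le_imp_le) (use d in simp)
        then show "ms.n2 (eval (\<lambda>i. eval (tuple_family k Bs) (\<phi> i)) (\<psi> j) - tuple_family k Bs j) \<le> d / 2"
          by (simp add: evD)
      next
        fix Bs assume Bs: "Bs \<in> microstates \<tau> ys R m k \<epsilon>"
        define As where "As = map (\<lambda>i. mat_at (eval (tuple_family k Bs) (\<phi> i)) k) [0..<n]"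
        have As: "As \<in> mat_tuples n k"
          by (auto simp: As_def mat_tuples_def)
        have bB: "\<forall>j. ms.bnd (tuple_family k Bs j) S"
          using facts[OF Bs] ms.bnd_mono S(2) by blast
        have b\<phi>: "ms.bnd (eval (tuple_family k Bs) (\<phi> i)) R'" if "i < n" for i
        proof -
          have "ms.bnd (eval (tuple_family k Bs) (\<phi>' i)) (12 * (norm (op_of (x i)) + 1))"
            using \<phi>'(4)[rule_format, where B = UNIV and tr = "family_trace k" and u = "tuple_family k Bs"]
              ms.tracial_algebra_axioms bB by blast
          then show ?thesis
            using ms.bnd_mono R'_ge[OF that] that by (auto simp: \<phi>_def)
        qed
        have "mat_opnorm A \<le> R'" if "A \<in> set As" for A
        proof -
          obtain i where i: "i < n" "A = mat_at (eval (tuple_family k Bs) (\<phi> i)) k"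
            using \<open>A \<in> set As\<close> by (auto simp: As_def)
          then show ?thesis
            using b\<phi>[OF i(1)] R' by (subst (asm) ms.bnd_iff_opnorm) auto
        qed
        moreover have "cmod (mat_ntrace (mat_word k As w) - \<tau> (op_word xs w)) < \<epsilon>'"
          if w: "w \<in> star_words n m'" for w
        proof -
          have letters: "\<forall>(i, s)\<in>set w. i < n" using w by (simp add: star_words_def)
          let ?q = "subst_poly \<phi> (word_poly w)"
          have at: "mat_at (tuple_family k As i) k = mat_at (eval (tuple_family k Bs) (\<phi> i)) k" for i
          proof (cases "i < n")
            case True
            then show ?thesis
              by (subst tuple_family_at[OF As]) (auto simp: As_def)
          qed (simp add: tuple_family_def As_def \<phi>_def)
          have "mat_at (eval (tuple_family k As) (word_poly w)) k
              = mat_at (eval (\<lambda>i. eval (tuple_family k Bs) (\<phi> i)) (word_poly w)) k"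
            by (rule ms.eval_at_cong) (rule at)
          then have 1: "mat_ntrace (mat_word k As w) = family_trace k (eval (tuple_family k Bs) ?q)"
            by (simp add: mat_word_eq[OF As letters] family_trace_def eval_subst_poly eval_word_poly)
          have "?q \<in> P" using w by (simp add: P_def)
          then have 2: "cmod (family_trace k (eval (tuple_family k Bs) ?q) - op_trace \<tau> (eval y ?q)) < \<epsilon>' / 2"
            using facts[OF Bs] by (fastforce simp: \<delta>'_def)
          have c: "eval (\<lambda>i. eval y (\<phi> i)) (word_poly w) \<in> op_algebra M" "eval x (word_poly w) \<in> op_algebra M"
            using bnd_closed[OF \<phi>b] xA by (simp_all add: eval_closed)
          have "cmod (op_trace \<tau> (eval y ?q) - op_trace \<tau> (word_value x w))
              = cmod (op_trace \<tau> (eval (\<lambda>i. eval y (\<phi> i)) (word_poly w) - eval x (word_poly w)))"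
            using c by (simp add: eval_subst_poly eval_word_poly tr_diff)
          also have "\<dots> \<le> n2 (eval (\<lambda>i. eval y (\<phi> i)) (word_poly w) - eval x (word_poly w))"
            using c by (intro norm_tr_le) auto
          also have "\<dots> \<le> poly_lipschitz R' (word_poly w) * \<delta>"
            by (intro eval_lipschitz \<phi>b bx \<phi>x)
          also have "\<dots> \<le> Lw * \<delta>"
            using Lw[OF w] \<delta>(1) by (intro mult_right_mono) auto
          finally have 3: "cmod (op_trace \<tau> (eval y ?q) - op_trace \<tau> (word_value x w)) \<le> \<epsilon>' / 4"
            using \<delta>(3) by linarith
          have "cmod (mat_ntrace (mat_word k As w) - \<tau> (op_word xs w))
            \<le> cmod (family_trace k (eval (tuple_family k Bs) ?q) - op_trace \<tau> (eval y ?q))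
              + cmod (op_trace \<tau> (eval y ?q) - op_trace \<tau> (word_value x w))"
            unfolding 1 tr_word_x[OF letters] by (rule norm_diff_triangle_le) auto
          then show ?thesis
            using 2 3 \<epsilon>' by linarith
        qed
        ultimately have "As \<in> microstates \<tau> xs R' m' k \<epsilon>'"
          using As by (simp add: microstates_def n_def)
        then show "map (\<lambda>i. mat_at (eval (tuple_family k Bs) (\<phi> i)) k) [0..<n] \<in> microstates \<tau> xs R' m' k \<epsilon>'"
          by (simp add: As_def)
      qed (rule ne)
    qed
    then show ?thesis
      using \<epsilon> by blast
  qed
  then show ?thesis
    using R' \<omega>'(1,2) by blast
qed

text \<open>Passing from xs to ys does not increase the logarithm for suitable parameters, and
  exchanging \<omega>' for \<omega> in the normalization multiplies the quotient by a fixed factor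
  c. Such a factor is harmless because the value for xs is 0.\<close>

lemma upper_orbit_dim_le_0:
  assumes xs: "generates xs M" and ys: "generates ys M" and zero: "upper_orbit_dim \<tau> xs = 0"
  shows "upper_orbit_dim \<tau> ys \<le> 0"
  unfolding upper_orbit_dim_def orbit_dim_at_def
proof (intro SUP_least)
  fix \<omega> R :: real assume "\<omega> \<in> {0<..<1}" "R \<in> {0<..}"
  then have \<omega>: "0 < \<omega>" "\<omega> < 1" and R: "0 < R" by auto
  obtain R' \<omega>' where R': "0 < R'" and \<omega>': "0 < \<omega>'" "\<omega>' < 1" and
    tr: "\<And>m' \<epsilon>'. 0 < \<epsilon>' \<Longrightarrow> \<exists>m \<epsilon>. 0 < \<epsilon> \<and> (\<forall>k>0.
      ln (real (orbit_covering_number k (microstates \<tau> ys R m k \<epsilon>) \<omega>))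
      \<le> ln (real (orbit_covering_number k (microstates \<tau> xs R' m' k \<epsilon>') \<omega>')))"
    using microstate_transfer[OF xs ys \<omega>(1) R] by blast
  have "orbit_dim_at_radius \<tau> xs \<omega>' R' \<le> orbit_dim_at \<tau> xs \<omega>'"
    unfolding orbit_dim_at_def using R' by (intro SUP_upper) auto
  also have "\<dots> \<le> upper_orbit_dim \<tau> xs"
    unfolding upper_orbit_dim_def using \<omega>' by (intro SUP_upper) auto
  finally have x0: "orbit_dim_at_radius \<tau> xs \<omega>' R' \<le> 0"
    using zero by simp
  define c where "c = ln \<omega>' / ln \<omega>"
  have ln: "ln \<omega> < 0" "ln \<omega>' < 0"
    using \<omega> \<omega>' by simp_all
  then have c: "0 < c"
    by (simp add: c_def divide_neg_neg)
  show "orbit_dim_at_radius \<tau> ys \<omega> R \<le> 0"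
  proof (rule ereal_le_epsilon2)
    fix e :: real assume e: "0 < e"
    have "orbit_dim_at_radius \<tau> xs \<omega>' R' < ereal (e / c)"
      using x0 e c by (intro order.strict_trans1[OF x0]) simp
    then obtain m' \<epsilon>' where \<epsilon>': "0 < \<epsilon>'" and lim: "limsup (\<lambda>k. ereal
          (ln (real (orbit_covering_number k (microstates \<tau> xs R' m' k \<epsilon>') \<omega>'))
            / (- (real k)\<^sup>2 * ln \<omega>'))) < ereal (e / c)"
      unfolding orbit_dim_at_radius_def INF_less_iff by auto
    obtain m \<epsilon> where \<epsilon>: "0 < \<epsilon>" and le: "\<And>k. 0 < k \<Longrightarrow>
      ln (real (orbit_covering_number k (microstates \<tau> ys R m k \<epsilon>) \<omega>))
      \<le> ln (real (orbit_covering_number k (microstates \<tau> xs R' m' k \<epsilon>') \<omega>'))"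
      using tr[OF \<epsilon>'] by blast
    have "eventually (\<lambda>k. ereal (ln (real (orbit_covering_number k (microstates \<tau> xs R' m' k \<epsilon>') \<omega>'))
            / (- (real k)\<^sup>2 * ln \<omega>')) < ereal (e / c)) sequentially"
      using lim by (rule Limsup_lessD)
    then have "eventually (\<lambda>k. ereal (ln (real (orbit_covering_number k (microstates \<tau> ys R m k \<epsilon>) \<omega>))
            / (- (real k)\<^sup>2 * ln \<omega>)) \<le> ereal e) sequentially"
      using eventually_gt_at_top[of 0]
    proof eventually_elim
      case (elim k)
      define a where "a = ln (real (orbit_covering_number k (microstates \<tau> ys R m k \<epsilon>) \<omega>))"
      define b where "b = ln (real (orbit_covering_number k (microstates \<tau> xs R' m' k \<epsilon>') \<omega>'))"
      have pos: "0 < - (real k)\<^sup>2 * ln \<omega>"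
        using elim(2) ln by (simp add: mult_pos_neg)
      have "a / (- (real k)\<^sup>2 * ln \<omega>) \<le> b / (- (real k)\<^sup>2 * ln \<omega>)"
        using le[OF elim(2)] pos unfolding a_def b_def by (intro divide_right_mono) auto
      also have "\<dots> = c * (b / (- (real k)\<^sup>2 * ln \<omega>'))"
        using ln elim(2) by (simp add: c_def field_simps)
      also have "\<dots> \<le> c * (e / c)"
        using elim(1) c unfolding b_def by (intro mult_left_mono) auto
      also have "\<dots> = e" using c by simp
      finally show ?case by (simp add: a_def)
    qed
    then have "limsup (\<lambda>k. ereal (ln (real (orbit_covering_number k (microstates \<tau> ys R m k \<epsilon>) \<omega>))
            / (- (real k)\<^sup>2 * ln \<omega>))) \<le> ereal e"
      by (rule Limsup_bounded)
    moreover have "orbit_dim_at_radius \<tau> ys \<omega> R \<le> limsup (\<lambda>k. ereal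
          (ln (real (orbit_covering_number k (microstates \<tau> ys R m k \<epsilon>) \<omega>))
            / (- (real k)\<^sup>2 * ln \<omega>)))"
      unfolding orbit_dim_at_radius_def using \<epsilon> by (intro INF_lower2[of "(m, \<epsilon>)"]) auto
    ultimately show "orbit_dim_at_radius \<tau> ys \<omega> R \<le> 0 + ereal e"
      by simp
  qed
qed

end

theorem theorem1:
  fixes M :: "('h::complex_hilbert_space \<Rightarrow>\<^sub>L 'h) set"
    and \<tau> :: "('h \<Rightarrow>\<^sub>L 'h) \<Rightarrow> complex"
    and xs :: "('h \<Rightarrow>\<^sub>L 'h) list"
  assumes "von_neumann_algebra M"
    and "tracial_state M \<tau>" and "faithful M \<tau>" and "normal_functional M \<tau>"
    and "generates xs M"
    and "upper_orbit_dim \<tau> xs = 0"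
  shows "upper_free_orbit_dimension M \<tau> = 0"
proof -
  interpret normal_trace M \<tau>
    using assms by unfold_locales
  have "upper_free_orbit_dimension M \<tau> \<le> 0"
    unfolding upper_free_orbit_dimension_def
    using upper_orbit_dim_le_0[OF assms(5) _ assms(6)] by (intro SUP_least) auto
  \<comment> \<open>xs is itself a generating family, so the supremum is at least 0.\<close>
  moreover have "upper_orbit_dim \<tau> xs \<le> upper_free_orbit_dimension M \<tau>"
    unfolding upper_free_orbit_dimension_def using assms(5) by (intro SUP_upper) simp
  ultimately show ?thesis
    using assms(6) by simp
qed

end
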